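(* Let $\phi(x)=\phi_{0,1}(x)=\sqrt2\cos\left(\frac{x}{\sqrt2}\right)$ on $I=\left(-\frac{\pi}{\sqrt2},\frac{\pi}{\sqrt2}\right)$, and let $\mathcal{L}_\phi=-\phi(\partial_x^2+2)\phi$. The operator $\mathcal{L}_\phi$ is limit point (at both endpoints of $I$) and satisfies the following: 1. The ground state energy (lowest eigenvalue) is $\lambda_0=-2$, with positive ground state $\phi$. 2. The first excited eigenvalue is $\lambda_1=0$, with corresponding eigenfunction $\phi_x$. 3. The operator has continuous spectrum $[\frac14,\infty)$.
   Context: $\mathcal{L}_\phi w=-\phi\,(\partial_x^2+2)(\phi w)$ is regarded as a singular Sturm–Liouville operator, i.e. a symmetric unbounded operator on $L^2(I)$ with domain $C_0^\infty(I)$; it is bounded below, and $\mathcal{L}_\phi$ also denotes its Friedrichs extension. Limit point at an endpoint means that for some (equivalently every) $\lambda\in\mathbb{C}$ not all solutions of $\mathcal{L}_\phi u=\lambda u$ are square integrable near that endpoint. The first excited eigenvalue is the second-lowest eigenvalue. *)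

theory Defs
  imports "HOL-Analysis.Analysis"
begin

section \<open>Operators in \<open>L\<^sup>2\<close>\<close>

text \<open>
  Elements of the complex Hilbert space \<open>L\<^sup>2(M)\<close> are represented by square integrable
  functions, so equality in \<open>L\<^sup>2(M)\<close> is equality almost everywhere. A possibly unbounded
  operator is represented by its graph, a set of pairs \<open>(u, T u)\<close>.
\<close>

definition L2_space :: "'a measure \<Rightarrow> ('a \<Rightarrow> complex) set" where
  "L2_space M = {f \<in> borel_measurable M. integrable M (\<lambda>x. (cmod (f x))\<^sup>2)}"

definition L2_inner :: "'a measure \<Rightarrow> ('a \<Rightarrow> complex) \<Rightarrow> ('a \<Rightarrow> complex) \<Rightarrow> complex" where
  "L2_inner M f g = (LINT x|M. f x * cnj (g x))"

definition L2_norm :: "'a measure \<Rightarrow> ('a \<Rightarrow> complex) \<Rightarrow> real" where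
  "L2_norm M f = sqrt (LINT x|M. (cmod (f x))\<^sup>2)"

type_synonym 'a op_graph = "(('a \<Rightarrow> complex) \<times> ('a \<Rightarrow> complex)) set"

definition adjoint_op :: "'a measure \<Rightarrow> 'a op_graph \<Rightarrow> 'a op_graph" where
  "adjoint_op M T = {(u, f). u \<in> L2_space M \<and> f \<in> L2_space M \<and>
     (\<forall>(v, g)\<in>T. L2_inner M g u = L2_inner M v f)}"

text \<open>
  The domain of the closure of the quadratic form \<open>q(u) = \<langle>T u, u\<rangle>\<close> of a symmetric operator
  \<open>T \<ge> -c\<close>, that is, the completion of the domain of \<open>T\<close> inside \<open>L\<^sup>2(M)\<close> for the norm
  \<open>(q(u) + (1 + c) \<parallel>u\<parallel>\<^sup>2)\<^sup>1\<^sup>/\<^sup>2\<close>. Along a sequence that converges in \<open>L\<^sup>2(M)\<close>, the Cauchy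
  condition for this norm reduces to \<open>q(u\<^sub>m - u\<^sub>n) \<longrightarrow> 0\<close>; hence \<open>c\<close> does not occur.
\<close>

definition form_domain :: "'a measure \<Rightarrow> 'a op_graph \<Rightarrow> ('a \<Rightarrow> complex) set" where
  "form_domain M T = {u \<in> L2_space M. \<exists>v g. (\<forall>n::nat. (v n, g n) \<in> T) \<and>
     (\<lambda>n. L2_norm M (\<lambda>x. v n x - u x)) \<longlonglongrightarrow> 0 \<and>
     (\<forall>e>0. \<exists>N. \<forall>m\<ge>N. \<forall>n\<ge>N.
        cmod (L2_inner M (\<lambda>x. g m x - g n x) (\<lambda>x. v m x - v n x)) < e)}"

text \<open>
  The Friedrichs extension of a densely defined symmetric operator that is bounded below is
  the restriction of its adjoint to the form domain.
\<close>

definition friedrichs_extension :: "'a measure \<Rightarrow> 'a op_graph \<Rightarrow> 'a op_graph" where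
  "friedrichs_extension M T = {(u, f) \<in> adjoint_op M T. u \<in> form_domain M T}"

definition eigenfunction ::
  "'a measure \<Rightarrow> 'a op_graph \<Rightarrow> complex \<Rightarrow> ('a \<Rightarrow> complex) \<Rightarrow> bool" where
  "eigenfunction M T \<mu> u \<longleftrightarrow> (u, \<lambda>x. \<mu> * u x) \<in> T \<and> \<not> (AE x in M. u x = 0)"

definition point_spectrum :: "'a measure \<Rightarrow> 'a op_graph \<Rightarrow> complex set" where
  "point_spectrum M T = {\<mu>. \<exists>u. eigenfunction M T \<mu> u}"

text \<open>
  \<open>\<mu>\<close> is in the resolvent set if \<open>T - \<mu>\<close> maps the domain onto \<open>L\<^sup>2(M)\<close> and has a bounded
  inverse; injectivity is part of the norm estimate.
\<close>

definition resolvent_set :: "'a measure \<Rightarrow> 'a op_graph \<Rightarrow> complex set" where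
  "resolvent_set M T = {\<mu>.
     (\<forall>f\<in>L2_space M. \<exists>u. (u, \<lambda>x. \<mu> * u x + f x) \<in> T) \<and>
     (\<exists>C. \<forall>(u, g)\<in>T. L2_norm M u \<le> C * L2_norm M (\<lambda>x. g x - \<mu> * u x))}"

text \<open>
  The continuous spectrum in the classification of the spectrum into point, continuous and
  residual spectrum: \<open>T - \<mu>\<close> is injective with dense range but has no bounded everywhere
  defined inverse.
\<close>

definition continuous_spectrum :: "'a measure \<Rightarrow> 'a op_graph \<Rightarrow> complex set" where
  "continuous_spectrum M T = {\<mu>.
     \<mu> \<notin> point_spectrum M T \<and>
     (\<forall>f\<in>L2_space M. \<forall>e>0. \<exists>(u, g)\<in>T. L2_norm M (\<lambda>x. g x - \<mu> * u x - f x) < e) \<and>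
     \<mu> \<notin> resolvent_set M T}"


section \<open>The singular Sturm-Liouville operator\<close>

definition vderiv :: "(real \<Rightarrow> 'b::real_normed_vector) \<Rightarrow> real \<Rightarrow> 'b" where
  "vderiv f x = vector_derivative f (at x)"

text \<open>The space \<open>C\<^sub>0\<^sup>\<infinity>(I)\<close>; its elements are extended by zero outside \<open>I\<close>.\<close>

definition test_functions :: "real set \<Rightarrow> (real \<Rightarrow> complex) set" where
  "test_functions I = {f. (\<forall>n x. (vderiv ^^ n) f differentiable (at x)) \<and>
     compact (closure {x. f x \<noteq> 0}) \<and> closure {x. f x \<noteq> 0} \<subseteq> I}"

text \<open>The differential expression \<open>w \<mapsto> -\<phi> (\<partial>\<^sub>x\<^sup>2 + 2) (\<phi> w)\<close>.\<close>

definition L_expr :: "(real \<Rightarrow> real) \<Rightarrow> (real \<Rightarrow> complex) \<Rightarrow> real \<Rightarrow> complex" where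
  "L_expr \<phi> w x =
     - (\<phi> x *\<^sub>R (vderiv (vderiv (\<lambda>y. \<phi> y *\<^sub>R w y)) x + 2 * (\<phi> x *\<^sub>R w x)))"

definition L_min :: "(real \<Rightarrow> real) \<Rightarrow> real set \<Rightarrow> real op_graph" where
  "L_min \<phi> I = {(w, L_expr \<phi> w) | w. w \<in> test_functions I}"

definition L_op :: "(real \<Rightarrow> real) \<Rightarrow> real set \<Rightarrow> real op_graph" where
  "L_op \<phi> I = friedrichs_extension (lebesgue_on I) (L_min \<phi> I)"

definition L_solution ::
  "(real \<Rightarrow> real) \<Rightarrow> real set \<Rightarrow> complex \<Rightarrow> (real \<Rightarrow> complex) \<Rightarrow> bool" where
  "L_solution \<phi> I \<mu> u \<longleftrightarrow> (\<forall>x\<in>I.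
     (\<lambda>y. \<phi> y *\<^sub>R u y) differentiable (at x) \<and>
     vderiv (\<lambda>y. \<phi> y *\<^sub>R u y) differentiable (at x) \<and>
     L_expr \<phi> u x = \<mu> * u x)"

definition limit_point_left :: "(real \<Rightarrow> real) \<Rightarrow> real \<Rightarrow> real \<Rightarrow> bool" where
  "limit_point_left \<phi> a b \<longleftrightarrow> (\<exists>\<mu>. \<not> (\<forall>u. L_solution \<phi> {a<..<b} \<mu> u \<longrightarrow>
     (\<exists>c\<in>{a<..<b}. u \<in> L2_space (lebesgue_on {a<..<c}))))"

definition limit_point_right :: "(real \<Rightarrow> real) \<Rightarrow> real \<Rightarrow> real \<Rightarrow> bool" where
  "limit_point_right \<phi> a b \<longleftrightarrow> (\<exists>\<mu>. \<not> (\<forall>u. L_solution \<phi> {a<..<b} \<mu> u \<longrightarrow>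
     (\<exists>c\<in>{a<..<b}. u \<in> L2_space (lebesgue_on {c<..<b}))))"

definition phi01 :: "real \<Rightarrow> real" where
  "phi01 x = sqrt 2 * cos (x / sqrt 2)"

end

theory Submission
  imports Defs
begin

text \<open>
  Put \<open>A w = \<phi> w' - \<phi>' w\<close> and \<open>B w = \<phi> w'\<close>. Then \<open>L + 2 = A\<^sup>* A\<close> with \<open>A \<phi> = 0\<close>,
  \<open>A A\<^sup>* - 2 = B\<^sup>* B\<close> with \<open>B (A \<phi>') = 0\<close>, and \<open>B B\<^sup>* = - \<phi> \<partial>\<^sup>2 \<phi> \<ge> 1/4\<close> by a Hardy inequality.
  Hence \<open>L \<ge> 1/4\<close> on the orthogonal complement of \<open>\<phi>\<close> and \<open>\<phi>'\<close>, which are eigenfunctions for \<open>-2\<close>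
  and \<open>0\<close>. A Morawetz identity for \<open>B B\<^sup>*\<close> shows that there are no further eigenfunctions.

  Since \<open>L + 6 = - \<phi>\<^sup>3 \<partial> \<phi>\<^sup>-\<^sup>4 \<partial> \<phi>\<^sup>3\<close> has an explicit kernel without square integrable elements, \<open>L\<close> is
  essentially self-adjoint on test functions, so the Friedrichs extension is the adjoint and the
  estimates for test functions pass to its whole domain. Below \<open>1/4\<close> they bound the resolvent;
  above, singular sequences \<open>\<phi>\<^sup>-\<^sup>1\<^sup>/\<^sup>2 exp (\<i> \<omega> z) \<chi>(z / N)\<close> in the variable \<open>z\<close> with \<open>z' = 1 / \<phi>\<close> show that \<open>L - \<mu>\<close>
  has no bounded inverse.
\<close>

section \<open>The Hilbert space \<open>L\<^sup>2\<close>\<close>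

text \<open>With \<open>z = artanh (sin (x / sqrt 2))\<close> one has
  \<open>\<phi>\<^sup>2 = 2 sech\<^sup>2 z\<close>, and
  \<open>w = \<phi>\<^sup>-\<^sup>1\<^sup>/\<^sup>2 v\<close> turns \<open>L\<close> into the
  Poeschl-Teller operator \<open>- d\<^sup>2/dz\<^sup>2 + 1/4 - (15/4) sech\<^sup>2 z\<close>. Since
  15/4 is 3/2 times 5/2, it has two bound states. Each factorization lowers the parameter 3/2 by
  one, and the last operator, \<open>- d\<^sup>2/dz\<^sup>2 + 1/4 + (1/4) sech\<^sup>2 z\<close>,
  has a repulsive potential; hence two steps suffice and a Morawetz argument applies. The shift by 6
  comes from looking at powers: \<open>\<phi>^s\<close> solves the eigenvalue equation only for
  \<open>s = 1\<close> with value -2 and for \<open>s = -3\<close> with value -6. The second value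
  lies strictly below the lower bound -2, so \<open>L + 6\<close> is coercive and its kernel is
  elementary. The obstacle is that elements of the domain are only weak solutions. Integration by
  parts is therefore done on regular functions, where the zeros of \<open>\<phi>\<close> at the
  endpoints remove the boundary terms, and only the resulting inequalities pass to limits.\<close>

lemma borel_measurable_cnj [measurable]:
  "g \<in> borel_measurable M \<Longrightarrow> (\<lambda>x. cnj (g x)) \<in> borel_measurable M"
  by (rule measurable_compose[OF _ borel_measurable_continuous_onI[OF continuous_on_cnj[OF continuous_on_id]]]) simp

lemma L2_measurable: "f \<in> L2_space M \<Longrightarrow> f \<in> borel_measurable M"
  by (simp add: L2_space_def)

lemma L2_sq_integrable: "f \<in> L2_space M \<Longrightarrow> integrable M (\<lambda>x. (cmod (f x))\<^sup>2)"
  by (simp add: L2_space_def)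

lemma norm_add_sq_le: "(cmod (x + y))\<^sup>2 \<le> 2 * (cmod x)\<^sup>2 + 2 * (cmod y)\<^sup>2"
proof -
  have "(cmod (x + y))\<^sup>2 \<le> (cmod x + cmod y)\<^sup>2"
    by (simp add: norm_triangle_ineq power_mono)
  also have "\<dots> \<le> 2 * (cmod x)\<^sup>2 + 2 * (cmod y)\<^sup>2"
    using sum_squares_bound[of "cmod x" "cmod y"] by (simp add: power2_sum)
  finally show ?thesis .
qed

lemma L2_add: assumes "f \<in> L2_space M" "g \<in> L2_space M"
  shows "(\<lambda>x. f x + g x) \<in> L2_space M"
proof -
  have [measurable]: "f \<in> borel_measurable M" "g \<in> borel_measurable M"
    using assms by (auto simp: L2_measurable)
  have "integrable M (\<lambda>x. 2 * (cmod (f x))\<^sup>2 + 2 * (cmod (g x))\<^sup>2)"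
    using assms by (intro Bochner_Integration.integrable_add integrable_mult_right L2_sq_integrable)
  then have "integrable M (\<lambda>x. (cmod (f x + g x))\<^sup>2)"
    by (rule Bochner_Integration.integrable_bound) (auto simp: norm_add_sq_le)
  then show ?thesis by (simp add: L2_space_def)
qed

lemma L2_scale: "f \<in> L2_space M \<Longrightarrow> (\<lambda>x. c * f x) \<in> L2_space M"
  by (auto simp: L2_space_def norm_mult power_mult_distrib)

lemma L2_diff: "f \<in> L2_space M \<Longrightarrow> g \<in> L2_space M \<Longrightarrow> (\<lambda>x. f x - g x) \<in> L2_space M"
  using L2_add[of f M "\<lambda>x. (-1) * g x"] L2_scale[of g M "-1"] by simp

lemma L2_inner_integrable:
  assumes "f \<in> L2_space M" "g \<in> L2_space M"
  shows "integrable M (\<lambda>x. f x * cnj (g x))"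
proof -
  have [measurable]: "f \<in> borel_measurable M" "g \<in> borel_measurable M"
    using assms by (auto simp: L2_measurable)
  have "integrable M (\<lambda>x. (cmod (f x))\<^sup>2 + (cmod (g x))\<^sup>2)"
    using assms by (intro Bochner_Integration.integrable_add L2_sq_integrable)
  then show ?thesis
  proof (rule Bochner_Integration.integrable_bound)
    have "cmod (f x) * cmod (g x) \<le> (cmod (f x))\<^sup>2 + (cmod (g x))\<^sup>2" for x
      using sum_squares_bound[of "cmod (f x)" "cmod (g x)"]
        mult_nonneg_nonneg[of "cmod (f x)" "cmod (g x)"] by (simp add: ac_simps del: mult_nonneg_nonneg)
    then show "AE x in M. norm (f x * cnj (g x)) \<le> norm ((cmod (f x))\<^sup>2 + (cmod (g x))\<^sup>2)"
      by (simp add: norm_mult)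
  qed simp
qed

lemma L2_inner_commute: "L2_inner M g f = cnj (L2_inner M f g)"
proof -
  have "cnj (L2_inner M f g) = (LINT x|M. cnj (f x * cnj (g x)))"
    unfolding L2_inner_def by (rule Bochner_Integration.integral_cnj[symmetric])
  then show ?thesis by (simp add: L2_inner_def mult.commute)
qed

lemma L2_inner_add_left:
  assumes "f \<in> L2_space M" "g \<in> L2_space M" "h \<in> L2_space M"
  shows "L2_inner M (\<lambda>x. f x + g x) h = L2_inner M f h + L2_inner M g h"
  using assms by (simp add: L2_inner_def distrib_right L2_inner_integrable)

lemma L2_inner_diff_left:
  assumes "f \<in> L2_space M" "g \<in> L2_space M" "h \<in> L2_space M"
  shows "L2_inner M (\<lambda>x. f x - g x) h = L2_inner M f h - L2_inner M g h"
  using assms by (simp add: L2_inner_def left_diff_distrib L2_inner_integrable)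

lemma L2_inner_scale_left: "L2_inner M (\<lambda>x. c * f x) h = c * L2_inner M f h"
  by (simp add: L2_inner_def mult.assoc)

lemma L2_inner_add_right:
  assumes "f \<in> L2_space M" "g \<in> L2_space M" "h \<in> L2_space M"
  shows "L2_inner M h (\<lambda>x. f x + g x) = L2_inner M h f + L2_inner M h g"
  using assms by (simp add: L2_inner_def distrib_left L2_inner_integrable)

lemma L2_inner_diff_right:
  assumes "f \<in> L2_space M" "g \<in> L2_space M" "h \<in> L2_space M"
  shows "L2_inner M h (\<lambda>x. f x - g x) = L2_inner M h f - L2_inner M h g"
  using assms by (simp add: L2_inner_def right_diff_distrib L2_inner_integrable)

lemma L2_inner_scale_right: "L2_inner M h (\<lambda>x. c * f x) = cnj c * L2_inner M h f"
  by (simp add: L2_inner_def mult.left_commute[of _ "cnj c"])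

lemma L2_norm_nonneg [simp]: "0 \<le> L2_norm M f"
  by (simp add: L2_norm_def)

lemma L2_norm_sq: "(L2_norm M f)\<^sup>2 = (LINT x|M. (cmod (f x))\<^sup>2)"
  by (simp add: L2_norm_def)

lemma L2_inner_self: "L2_inner M f f = complex_of_real ((L2_norm M f)\<^sup>2)"
proof -
  have "L2_inner M f f = (LINT x|M. complex_of_real ((cmod (f x))\<^sup>2))"
    unfolding L2_inner_def by (rule Bochner_Integration.integral_cong) (simp_all only: complex_norm_square)
  then show ?thesis by (simp add: L2_norm_sq del: of_real_power)
qed

lemma L2_norm_scale: "L2_norm M (\<lambda>x. c * f x) = cmod c * L2_norm M f"
  by (simp add: L2_norm_def norm_mult power_mult_distrib real_sqrt_mult)

lemma L2_norm_minus_commute: "L2_norm M (\<lambda>x. f x - g x) = L2_norm M (\<lambda>x. g x - f x)"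
  by (simp add: L2_norm_def norm_minus_commute)

lemma L2_norm_cong_AE:
  assumes "f \<in> borel_measurable M" "g \<in> borel_measurable M" "AE x in M. f x = g x"
  shows "L2_norm M f = L2_norm M g"
proof -
  have "(LINT x|M. (cmod (f x))\<^sup>2) = (LINT x|M. (cmod (g x))\<^sup>2)"
    using assms by (intro integral_cong_AE) auto
  then show ?thesis by (simp add: L2_norm_def)
qed

lemma L2_norm_eq_0:
  assumes "f \<in> L2_space M"
  shows "L2_norm M f = 0 \<longleftrightarrow> (AE x in M. f x = 0)"
proof -
  have "(LINT x|M. (cmod (f x))\<^sup>2) = 0 \<longleftrightarrow> (AE x in M. (cmod (f x))\<^sup>2 = 0)"
    by (rule integral_nonneg_eq_0_iff_AE) (auto simp: L2_sq_integrable assms)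
  then show ?thesis by (simp add: L2_norm_def)
qed

lemma L2_inner_zero_AE:
  assumes "AE x in M. f x = 0" "f \<in> L2_space M" "g \<in> L2_space M"
  shows "L2_inner M f g = 0"
proof -
  have [measurable]: "f \<in> borel_measurable M" "g \<in> borel_measurable M"
    using assms by (auto simp: L2_measurable)
  have "L2_inner M f g = (LINT x|M. 0)"
    unfolding L2_inner_def using assms(1) by (intro integral_cong_AE) auto
  then show ?thesis by simp
qed

lemma L2_norm_diff_sq:
  assumes "f \<in> L2_space M" "g \<in> L2_space M"
  shows "(L2_norm M (\<lambda>x. f x - g x))\<^sup>2 = (L2_norm M f)\<^sup>2 - 2 * Re (L2_inner M f g) + (L2_norm M g)\<^sup>2"
proof -
  have "complex_of_real ((L2_norm M (\<lambda>x. f x - g x))\<^sup>2) =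
      L2_inner M f f - L2_inner M g f - (L2_inner M f g - L2_inner M g g)"
    using assms by (simp only: L2_inner_self[symmetric])
      (simp add: L2_inner_diff_left L2_inner_diff_right L2_diff)
  also have "Re \<dots> = (L2_norm M f)\<^sup>2 - 2 * Re (L2_inner M f g) + (L2_norm M g)\<^sup>2"
    by (simp add: L2_inner_self L2_inner_commute[of M g f])
  finally show ?thesis by simp
qed

lemma L2_Cauchy_Schwarz:
  assumes f: "f \<in> L2_space M" and g: "g \<in> L2_space M"
  shows "cmod (L2_inner M f g) \<le> L2_norm M f * L2_norm M g"
proof (cases "L2_norm M g = 0")
  case True
  then have "AE x in M. g x = 0" using L2_norm_eq_0[OF g] by simp
  then have "L2_inner M g f = 0" using f g L2_inner_zero_AE by blast
  then show ?thesis using L2_inner_commute[of M f g] by simp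
next
  case False
  define N where "N = (L2_norm M g)\<^sup>2"
  have N: "N > 0" using False by (simp add: N_def)
  define z where "z = L2_inner M f g"
  \<comment> \<open>The coefficient of the orthogonal projection of \<open>f\<close> onto the line
    through \<open>g\<close>; the inequality is that the squared distance is nonnegative.\<close>
  define c where "c = z / complex_of_real N"
  have "0 \<le> (L2_norm M (\<lambda>x. f x - c * g x))\<^sup>2" by simp
  also have "\<dots> = (L2_norm M f)\<^sup>2 - 2 * Re (cnj c * z) + (cmod c)\<^sup>2 * N"
    using f g by (simp add: L2_norm_diff_sq L2_scale L2_inner_scale_right L2_norm_scale power_mult_distrib N_def z_def)
  also have "Re (cnj c * z) = (cmod z)\<^sup>2 / N"
  proof -
    have "cnj c * z = complex_of_real ((cmod z)\<^sup>2 / N)"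
      by (simp only: of_real_divide complex_norm_square) (simp add: c_def mult.commute)
    then show ?thesis by (simp only: Re_complex_of_real)
  qed
  also have "(cmod c)\<^sup>2 * N = (cmod z)\<^sup>2 / N"
    using N by (simp add: c_def norm_divide power_divide power2_eq_square)
  finally have "(cmod z)\<^sup>2 \<le> (L2_norm M f)\<^sup>2 * N" using N by (simp add: field_simps)
  then have "(cmod z)\<^sup>2 \<le> (L2_norm M f * L2_norm M g)\<^sup>2" by (simp add: N_def power_mult_distrib)
  then show ?thesis unfolding z_def by (rule power2_le_imp_le) simp
qed

lemma L2_norm_triangle_diff:
  assumes f: "f \<in> L2_space M" and g: "g \<in> L2_space M"
  shows "L2_norm M (\<lambda>x. f x - g x) \<le> L2_norm M f + L2_norm M g"
proof (rule power2_le_imp_le)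
  have "- Re (L2_inner M f g) \<le> L2_norm M f * L2_norm M g"
    using L2_Cauchy_Schwarz[OF f g] abs_Re_le_cmod[of "L2_inner M f g"] by linarith
  then show "(L2_norm M (\<lambda>x. f x - g x))\<^sup>2 \<le> (L2_norm M f + L2_norm M g)\<^sup>2"
    by (simp add: L2_norm_diff_sq[OF f g] power2_sum)
qed simp

lemma L2_norm_triangle:
  assumes f: "f \<in> L2_space M" and g: "g \<in> L2_space M"
  shows "L2_norm M (\<lambda>x. f x + g x) \<le> L2_norm M f + L2_norm M g"
  using L2_norm_triangle_diff[OF f L2_scale[OF g, of "-1"]] by (simp add: L2_norm_def)

lemma L2_norm_triangle3:
  assumes "f \<in> L2_space M" "g \<in> L2_space M" "h \<in> L2_space M"
  shows "L2_norm M (\<lambda>x. f x - h x) \<le> L2_norm M (\<lambda>x. f x - g x) + L2_norm M (\<lambda>x. g x - h x)"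
  using L2_norm_triangle[OF L2_diff[OF assms(1,2)] L2_diff[OF assms(2,3)]] by simp

lemma L2_norm_triangle_lower:
  assumes f: "f \<in> L2_space M" and g: "g \<in> L2_space M"
  shows "\<bar>L2_norm M f - L2_norm M g\<bar> \<le> L2_norm M (\<lambda>x. f x - g x)"
  using L2_norm_triangle[OF L2_diff[OF f g] g] L2_norm_triangle[OF L2_diff[OF g f] f]
  by (simp add: L2_norm_minus_commute[of M g f])

lemma L2_norm_tendsto:
  assumes "\<And>n. f n \<in> L2_space M" "u \<in> L2_space M" "(\<lambda>n. L2_norm M (\<lambda>x. f n x - u x)) \<longlonglongrightarrow> 0"
  shows "(\<lambda>n. L2_norm M (f n)) \<longlonglongrightarrow> L2_norm M u"
proof -
  have "(\<lambda>n. L2_norm M (f n) - L2_norm M u) \<longlonglongrightarrow> 0"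
    by (rule Lim_null_comparison[OF _ assms(3)]) (simp add: L2_norm_triangle_lower assms(1,2))
  then show ?thesis by (simp add: LIM_zero_iff)
qed

lemma L2_inner_tendsto:
  assumes f: "\<And>n. f n \<in> L2_space M" "u \<in> L2_space M" "(\<lambda>n. L2_norm M (\<lambda>x. f n x - u x)) \<longlonglongrightarrow> 0"
    and g: "\<And>n. g n \<in> L2_space M" "v \<in> L2_space M" "(\<lambda>n. L2_norm M (\<lambda>x. g n x - v x)) \<longlonglongrightarrow> 0"
  shows "(\<lambda>n. L2_inner M (f n) (g n)) \<longlonglongrightarrow> L2_inner M u v"
proof -
  have "(\<lambda>n. L2_norm M (\<lambda>x. f n x - u x) * L2_norm M (g n) + L2_norm M u * L2_norm M (\<lambda>x. g n x - v x))
      \<longlonglongrightarrow> 0 * L2_norm M v + L2_norm M u * 0"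
    by (intro tendsto_intros f(3) g(3) L2_norm_tendsto g(1,2))
  then have lim: "(\<lambda>n. L2_norm M (\<lambda>x. f n x - u x) * L2_norm M (g n) + L2_norm M u * L2_norm M (\<lambda>x. g n x - v x)) \<longlonglongrightarrow> 0"
    by simp
  have "L2_inner M (f n) (g n) - L2_inner M u v =
      L2_inner M (\<lambda>x. f n x - u x) (g n) + L2_inner M u (\<lambda>x. g n x - v x)" for n
    using f(1,2) g(1,2) by (simp add: L2_inner_diff_left L2_inner_diff_right)
  then have "cmod (L2_inner M (f n) (g n) - L2_inner M u v) \<le>
      L2_norm M (\<lambda>x. f n x - u x) * L2_norm M (g n) + L2_norm M u * L2_norm M (\<lambda>x. g n x - v x)" for n
    using f(1,2) g(1,2) by (auto intro!: norm_triangle_le add_mono L2_Cauchy_Schwarz L2_diff)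
  then have "(\<lambda>n. L2_inner M (f n) (g n) - L2_inner M u v) \<longlonglongrightarrow> 0"
    by (intro Lim_null_comparison[OF _ lim]) simp
  then show ?thesis by (simp add: LIM_zero_iff)
qed

lemma L2_inner_tendsto_const:
  assumes "\<And>n. f n \<in> L2_space M" "u \<in> L2_space M" "(\<lambda>n. L2_norm M (\<lambda>x. f n x - u x)) \<longlonglongrightarrow> 0"
    and "v \<in> L2_space M"
  shows "(\<lambda>n. L2_inner M (f n) v) \<longlonglongrightarrow> L2_inner M u v"
    and "(\<lambda>n. L2_inner M v (f n)) \<longlonglongrightarrow> L2_inner M v u"
  using assms by (intro L2_inner_tendsto; simp add: L2_norm_def)+

section \<open>Completeness and best approximation\<close>

lemma L2_const: "finite_measure M \<Longrightarrow> (\<lambda>x. c) \<in> L2_space M"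
  by (simp add: L2_space_def finite_measure.integrable_const)

lemma L2_norm_abs: "L2_norm M (\<lambda>x. complex_of_real (cmod (f x))) = L2_norm M f"
  by (simp add: L2_norm_def)

lemma L2_abs: "f \<in> L2_space M \<Longrightarrow> (\<lambda>x. complex_of_real (cmod (f x))) \<in> L2_space M"
  by (auto simp: L2_space_def intro: measurable_compose[OF borel_measurable_norm borel_measurable_of_real])

lemma L2_integrable:
  assumes "finite_measure M" "f \<in> L2_space M"
  shows "integrable M f"
  using L2_inner_integrable[OF assms(2) L2_const[OF assms(1), of 1]] by simp

lemma L2_L1_le:
  assumes "finite_measure M" "f \<in> L2_space M"
  shows "(LINT x|M. cmod (f x)) \<le> L2_norm M f * L2_norm M (\<lambda>x. 1)"
proof -
  have "L2_inner M (\<lambda>x. complex_of_real (cmod (f x))) (\<lambda>x. 1) = complex_of_real (LINT x|M. cmod (f x))"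
    by (simp add: L2_inner_def)
  then have "\<bar>LINT x|M. cmod (f x)\<bar> \<le> L2_norm M f * L2_norm M (\<lambda>x. 1)"
    using L2_Cauchy_Schwarz[OF L2_abs[OF assms(2)] L2_const[OF assms(1), of 1]]
    by (simp add: L2_norm_abs)
  then show ?thesis by linarith
qed

text \<open>Riesz-Fischer: along a subsequence with geometrically small increments the increments
  are summable in \<open>L1\<close>, hence almost everywhere, and Fatou carries the Cauchy bound
  over to the pointwise limit. Finiteness of the measure bounds \<open>L1\<close> norms by
  \<open>L2\<close> norms.\<close>

lemma L2_complete:
  assumes fin: "finite_measure M" and f: "\<And>n::nat. f n \<in> L2_space M"
    and cauchy: "\<And>e. e > 0 \<Longrightarrow> \<exists>N. \<forall>m\<ge>N. \<forall>n\<ge>N. L2_norm M (\<lambda>x. f m x - f n x) < e"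
  obtains u where "u \<in> L2_space M" "(\<lambda>n. L2_norm M (\<lambda>x. f n x - u x)) \<longlonglongrightarrow> 0"
proof -
  have [measurable]: "f n \<in> borel_measurable M" for n
    using f by (rule L2_measurable)
  have "\<forall>k. \<exists>N. \<forall>m\<ge>N. \<forall>n\<ge>N. L2_norm M (\<lambda>x. f m x - f n x) < (1/2)^k"
    by (intro allI cauchy) simp
  then obtain N where N: "\<And>k m n. N k \<le> m \<Longrightarrow> N k \<le> n \<Longrightarrow> L2_norm M (\<lambda>x. f m x - f n x) < (1/2)^k"
    by metis
  \<comment> \<open>Summing all thresholds makes \<open>r\<close> monotone with \<open>r k\<close>
    at least \<open>N k\<close>, so that differences beyond \<open>r k\<close> are smaller than
    \<open>(1/2)^k\<close>.\<close>
  define r where "r k = k + (\<Sum>i\<le>k. N i)" for k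
  have rN: "N k \<le> r k" for k
    using member_le_sum[of k "{..k}" N] by (simp add: r_def)
  have r_mono: "r k \<le> r j" if "k \<le> j" for k j
    using that unfolding r_def by (intro add_mono sum_mono2) auto
  define d where "d k x = cmod (f (r (Suc k)) x - f (r k) x)" for k x
  define K where "K = L2_norm M (\<lambda>x. 1)"
  have K: "K \<ge> 0" by (simp add: K_def)
  have d_int: "integrable M (d k)" for k
    unfolding d_def by (intro integrable_norm L2_integrable fin L2_diff f)
  have d_le: "(LINT x|M. d k x) \<le> (1/2)^k * K" for k
  proof -
    have "(LINT x|M. d k x) \<le> L2_norm M (\<lambda>x. f (r (Suc k)) x - f (r k) x) * K"
      unfolding d_def K_def by (intro L2_L1_le fin L2_diff f)
    also have "\<dots> \<le> (1/2)^k * K"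
      using N[of k "r (Suc k)" "r k"] rN[of k] r_mono[of k "Suc k"] K
      by (intro mult_right_mono) auto
    finally show ?thesis .
  qed
  have "(\<integral>\<^sup>+x. (\<Sum>k. ennreal (d k x)) \<partial>M) = (\<Sum>k. \<integral>\<^sup>+x. ennreal (d k x) \<partial>M)"
    using borel_measurable_integrable[OF d_int] by (intro nn_integral_suminf) simp
  also have "\<dots> = (\<Sum>k. ennreal (LINT x|M. d k x))"
    by (intro arg_cong[where f=suminf] ext nn_integral_eq_integral d_int) (simp add: d_def)
  also have "\<dots> \<le> (\<Sum>k. ennreal ((1/2)^k * K))"
    by (intro suminf_le ennreal_leI d_le) auto
  also have "\<dots> = ennreal (\<Sum>k. (1/2)^k * K)"
    using K by (intro suminf_ennreal2 summable_mult2 summable_geometric) auto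
  also have "\<dots> < \<infinity>" by simp
  finally have "AE x in M. (\<Sum>k. ennreal (d k x)) \<noteq> \<infinity>"
    using borel_measurable_integrable[OF d_int] by (intro nn_integral_PInf_AE) auto
  then have ae: "AE x in M. convergent (\<lambda>k. f (r k) x)"
  proof (rule AE_mp, intro AE_I2 impI)
    fix x assume "(\<Sum>k. ennreal (d k x)) \<noteq> \<infinity>"
    then have "summable (\<lambda>k. d k x)"
      by (intro summable_suminf_not_top) (auto simp: d_def)
    then have "summable (\<lambda>k. f (r (Suc k)) x - f (r k) x)"
      unfolding d_def by (rule summable_norm_cancel)
    then have "convergent (\<lambda>n. \<Sum>k<n. f (r (Suc k)) x - f (r k) x)"
      by (simp add: summable_iff_convergent)
    then have "convergent (\<lambda>n. f (r n) x - f (r 0) x)"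
      by (simp add: sum_lessThan_telescope[of "\<lambda>k. f (r k) x"])
    then have "convergent (\<lambda>n. (f (r n) x - f (r 0) x) + f (r 0) x)"
      by (intro convergent_add convergent_const)
    then show "convergent (\<lambda>k. f (r k) x)" by simp
  qed
  define u where "u x = lim (\<lambda>k. f (r k) x)" for x
  have [measurable]: "u \<in> borel_measurable M"
    unfolding u_def by (rule borel_measurable_lim_metric) simp
  have fatou: "(\<integral>\<^sup>+x. ennreal ((cmod (f n x - u x))\<^sup>2) \<partial>M) \<le> ennreal (((1/2)^k)\<^sup>2)" if n: "r k \<le> n" for n k
  proof -
    have "(\<integral>\<^sup>+x. ennreal ((cmod (f n x - u x))\<^sup>2) \<partial>M) =
        (\<integral>\<^sup>+x. liminf (\<lambda>j. ennreal ((cmod (f n x - f (r j) x))\<^sup>2)) \<partial>M)"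
    proof (rule nn_integral_cong_AE, use ae in \<open>rule AE_mp\<close>, intro AE_I2 impI)
      fix x assume "convergent (\<lambda>k. f (r k) x)"
      then have "(\<lambda>j. f (r j) x) \<longlonglongrightarrow> u x" by (simp add: u_def convergent_LIMSEQ_iff)
      then have "(\<lambda>j. ennreal ((cmod (f n x - f (r j) x))\<^sup>2)) \<longlonglongrightarrow> ennreal ((cmod (f n x - u x))\<^sup>2)"
        by (intro tendsto_intros)
      then show "ennreal ((cmod (f n x - u x))\<^sup>2) = liminf (\<lambda>j. ennreal ((cmod (f n x - f (r j) x))\<^sup>2))"
        by (intro lim_imp_Liminf[symmetric]) simp_all
    qed
    also have "\<dots> \<le> liminf (\<lambda>j. \<integral>\<^sup>+x. ennreal ((cmod (f n x - f (r j) x))\<^sup>2) \<partial>M)"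
      by (intro nn_integral_liminf) simp
    also have "\<dots> \<le> liminf (\<lambda>j::nat. ennreal (((1/2)^k)\<^sup>2))"
    proof (intro Liminf_mono eventually_sequentiallyI[of k])
      fix j assume "k \<le> j"
      then have "L2_norm M (\<lambda>x. f n x - f (r j) x) < (1/2)^k"
        using n rN[of k] r_mono[of k j] by (intro N) auto
      then have "(L2_norm M (\<lambda>x. f n x - f (r j) x))\<^sup>2 \<le> ((1/2)^k)\<^sup>2"
        by (intro power_mono) auto
      then have "(LINT x|M. (cmod (f n x - f (r j) x))\<^sup>2) \<le> ((1/2)^k)\<^sup>2"
        by (simp only: L2_norm_sq)
      then show "(\<integral>\<^sup>+x. ennreal ((cmod (f n x - f (r j) x))\<^sup>2) \<partial>M) \<le> ennreal (((1/2)^k)\<^sup>2)"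
        using L2_sq_integrable[OF L2_diff[OF f[of n] f[of "r j"]]]
        by (subst nn_integral_eq_integral) (auto intro: ennreal_leI)
    qed
    also have "\<dots> = ennreal (((1/2)^k)\<^sup>2)" by (simp add: Liminf_const)
    finally show ?thesis .
  qed
  have diff_L2: "(\<lambda>x. f n x - u x) \<in> L2_space M" if "r 0 \<le> n" for n
  proof -
    have "integrable M (\<lambda>x. (cmod (f n x - u x))\<^sup>2)"
      using fatou[OF that] by (intro integrableI_bounded) (auto simp: top.not_eq_extremum intro: le_less_trans)
    then show ?thesis by (simp add: L2_space_def)
  qed
  have u: "u \<in> L2_space M"
    using L2_diff[OF f[of "r 0"] diff_L2[of "r 0"]] by simp
  have le: "L2_norm M (\<lambda>x. f n x - u x) \<le> (1/2)^k" if "r k \<le> n" for n k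
  proof (rule power2_le_imp_le)
    have "ennreal (LINT x|M. (cmod (f n x - u x))\<^sup>2) \<le> ennreal (((1/2)^k)\<^sup>2)"
      using fatou[OF that] L2_sq_integrable[OF L2_diff[OF f[of n] u]]
      by (subst (asm) nn_integral_eq_integral) auto
    then show "(L2_norm M (\<lambda>x. f n x - u x))\<^sup>2 \<le> ((1/2)^k)\<^sup>2"
      unfolding L2_norm_sq by (subst (asm) ennreal_le_iff) auto
  qed simp
  have "(\<lambda>n. L2_norm M (\<lambda>x. f n x - u x)) \<longlonglongrightarrow> 0"
  proof (rule LIMSEQ_I)
    fix e :: real assume "e > 0"
    then obtain k where "(1/2)^k < e" using real_arch_pow_inv[of e "1/2"] by auto
    then show "\<exists>no. \<forall>n\<ge>no. norm (L2_norm M (\<lambda>x. f n x - u x) - 0) < e"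
      using le[of k] by (intro exI[of _ "r k"]) (auto intro: le_less_trans)
  qed
  with u show ?thesis by (rule that)
qed

lemma quadratic_min_imp_zero:
  assumes "\<And>t::real. 0 \<le> t * t * p - 2 * t * q" shows "q = 0"
proof (rule ccontr)
  assume q: "q \<noteq> 0"
  \<comment> \<open>The denominator is positive for either sign of \<open>p\<close>, and at this
    \<open>s\<close> the quadratic term is less than half the size of the linear one.\<close>
  define s where "s = q / (\<bar>p\<bar> + 1)"
  have "s * s * p - 2 * s * q = q\<^sup>2 / (\<bar>p\<bar> + 1)\<^sup>2 * (p - 2 * (\<bar>p\<bar> + 1))"
    by (simp add: s_def power2_eq_square divide_simps) (simp add: algebra_simps)
  also have "\<dots> < 0"
    using q by (intro mult_pos_neg) auto
  finally show False using assms[of s] by simp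
qed

text \<open>The error of a best approximation from \<open>S\<close> is orthogonal to \<open>S\<close>.\<close>

lemma L2_dense:
  assumes fin: "finite_measure M" and S: "\<And>f. f \<in> S \<Longrightarrow> f \<in> L2_space M"
    and S0: "S \<noteq> {}"
    and S_add: "\<And>f g. f \<in> S \<Longrightarrow> g \<in> S \<Longrightarrow> (\<lambda>x. f x + g x) \<in> S"
    and S_scale: "\<And>c f. f \<in> S \<Longrightarrow> (\<lambda>x. c * f x) \<in> S"
    and orth: "\<And>y. y \<in> L2_space M \<Longrightarrow> (\<And>s. s \<in> S \<Longrightarrow> L2_inner M s y = 0) \<Longrightarrow> AE x in M. y x = 0"
    and f: "f \<in> L2_space M" and e: "e > 0"
  obtains s where "s \<in> S" "L2_norm M (\<lambda>x. s x - f x) < e"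
proof -
  define D where "D = (\<lambda>s. (L2_norm M (\<lambda>x. s x - f x))\<^sup>2) ` S"
  define d where "d = Inf D"
  have bdd: "bdd_below D" unfolding D_def by (rule bdd_belowI2[of _ 0]) simp
  have d_le: "d \<le> (L2_norm M (\<lambda>x. s x - f x))\<^sup>2" if "s \<in> S" for s
    unfolding d_def using that by (intro cInf_lower bdd) (auto simp: D_def)
  have "\<exists>s\<in>S. (L2_norm M (\<lambda>x. s x - f x))\<^sup>2 < d + 1 / real (Suc n)" for n
  proof -
    have "\<exists>y\<in>D. y < d + 1 / real (Suc n)"
      using S0 by (intro cInf_lessD) (auto simp: D_def d_def[unfolded D_def, symmetric])
    then show ?thesis by (auto simp: D_def)
  qed
  then obtain s where s: "\<And>n. s n \<in> S" and
    s_d: "\<And>n. (L2_norm M (\<lambda>x. s n x - f x))\<^sup>2 < d + 1 / real (Suc n)" by metis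
  have sL: "s n \<in> L2_space M" for n by (intro S s)
  \<comment> \<open>Parallelogram law for the errors: the midpoint of \<open>s m\<close> and
    \<open>s n\<close> lies in \<open>S\<close>, so its squared error is at least \<open>d\<close>,
    and a minimizing sequence is Cauchy.\<close>
  have para: "(L2_norm M (\<lambda>x. s m x - s n x))\<^sup>2 \<le> 2 / real (Suc m) + 2 / real (Suc n)" for m n
  proof -
    let ?a = "\<lambda>x. s m x - f x" and ?b = "\<lambda>x. s n x - f x"
    have a: "?a \<in> L2_space M" and b: "?b \<in> L2_space M" by (intro L2_diff sL f)+
    have "(L2_norm M (\<lambda>x. ?a x - ?b x))\<^sup>2 = 2 * (L2_norm M ?a)\<^sup>2 + 2 * (L2_norm M ?b)\<^sup>2
        - (L2_norm M (\<lambda>x. ?a x - (-1) * ?b x))\<^sup>2"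
      unfolding L2_norm_diff_sq[OF a b] L2_norm_diff_sq[OF a L2_scale[OF b]]
      by (simp only: L2_inner_scale_right L2_norm_scale) simp
    also have "(L2_norm M (\<lambda>x. ?a x - (-1) * ?b x))\<^sup>2 = 4 * (L2_norm M (\<lambda>x. (1/2) * (s m x + s n x) - f x))\<^sup>2"
    proof -
      have "(\<lambda>x. ?a x - (-1) * ?b x) = (\<lambda>x. 2 * ((1/2) * (s m x + s n x) - f x))"
        by (auto simp: algebra_simps)
      then have "L2_norm M (\<lambda>x. ?a x - (-1) * ?b x) = 2 * L2_norm M (\<lambda>x. (1/2) * (s m x + s n x) - f x)"
        by (simp only: L2_norm_scale) simp
      then show ?thesis by (simp add: power_mult_distrib)
    qed
    finally have "(L2_norm M (\<lambda>x. ?a x - ?b x))\<^sup>2 = 2 * (L2_norm M ?a)\<^sup>2 + 2 * (L2_norm M ?b)\<^sup>2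
        - 4 * (L2_norm M (\<lambda>x. (1/2) * (s m x + s n x) - f x))\<^sup>2" .
    moreover have "d \<le> (L2_norm M (\<lambda>x. (1/2) * (s m x + s n x) - f x))\<^sup>2"
      by (intro d_le S_scale S_add s)
    ultimately have "(L2_norm M (\<lambda>x. ?a x - ?b x))\<^sup>2 \<le> 2 * (L2_norm M ?a)\<^sup>2 + 2 * (L2_norm M ?b)\<^sup>2 - 4 * d"
      by linarith
    then have "(L2_norm M (\<lambda>x. ?a x - ?b x))\<^sup>2 \<le> 2 * (1 / real (Suc m)) + 2 * (1 / real (Suc n))"
      using s_d[of m] s_d[of n] by linarith
    then show ?thesis by simp
  qed
  obtain u where u: "u \<in> L2_space M" and lim: "(\<lambda>n. L2_norm M (\<lambda>x. s n x - u x)) \<longlonglongrightarrow> 0"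
  proof (rule L2_complete[OF fin sL])
    fix e :: real assume e: "e > 0"
    obtain N where N: "N > 0" "inverse (real N) < e\<^sup>2 / 4"
      using ex_inverse_of_nat_less[of "e\<^sup>2/4"] e by auto
    show "\<exists>N. \<forall>m\<ge>N. \<forall>n\<ge>N. L2_norm M (\<lambda>x. s m x - s n x) < e"
    proof (intro exI allI impI)
      fix m n assume "N \<le> m" "N \<le> n"
      then have "1 / real (Suc m) \<le> 1 / real N" "1 / real (Suc n) \<le> 1 / real N"
        using N by (auto simp: frac_le)
      then have "(L2_norm M (\<lambda>x. s m x - s n x))\<^sup>2 < e\<^sup>2"
        using para[of m n] N by (simp add: inverse_eq_divide)
      then show "L2_norm M (\<lambda>x. s m x - s n x) < e" using e by (auto intro: power_less_imp_less_base[where n = 2])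
    qed
  qed
  define y where "y x = u x - f x" for x
  have y: "y \<in> L2_space M" unfolding y_def by (intro L2_diff u f)
  have lim_y: "(\<lambda>n. L2_norm M (\<lambda>x. (s n x - f x) - y x)) \<longlonglongrightarrow> 0"
    using lim by (simp add: y_def)
  have n_y: "(\<lambda>n. (L2_norm M (\<lambda>x. s n x - f x))\<^sup>2) \<longlonglongrightarrow> (L2_norm M y)\<^sup>2"
    by (intro tendsto_power L2_norm_tendsto lim_y L2_diff sL f y)
  have "(L2_norm M y)\<^sup>2 \<le> d"
  proof (rule LIMSEQ_le[OF n_y])
    show "(\<lambda>n. d + 1 / real (Suc n)) \<longlonglongrightarrow> d"
      using tendsto_add[OF tendsto_const LIMSEQ_Suc[OF lim_1_over_n], of d] by simp
  qed (use s_d in \<open>auto intro: less_imp_le\<close>)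
  have var: "d \<le> (L2_norm M (\<lambda>x. y x - c * v x))\<^sup>2" if v: "v \<in> S" for v c
  proof (rule LIMSEQ_le_const)
    show "(\<lambda>n. (L2_norm M (\<lambda>x. (s n x - f x) - c * v x))\<^sup>2) \<longlonglongrightarrow> (L2_norm M (\<lambda>x. y x - c * v x))\<^sup>2"
    proof (intro tendsto_power L2_norm_tendsto)
      have "(\<lambda>x. (s n x - f x - c * v x) - (y x - c * v x)) = (\<lambda>x. (s n x - f x) - y x)" for n by auto
      then show "(\<lambda>n. L2_norm M (\<lambda>x. (s n x - f x - c * v x) - (y x - c * v x))) \<longlonglongrightarrow> 0"
        using lim_y by simp
    qed (intro L2_diff L2_scale sL f y S[OF v])+
    have "d \<le> (L2_norm M (\<lambda>x. (s n x + (- c) * v x) - f x))\<^sup>2" for n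
      by (intro d_le S_scale S_add s v)
    then show "\<exists>N. \<forall>n\<ge>N. d \<le> (L2_norm M (\<lambda>x. (s n x - f x) - c * v x))\<^sup>2"
      by (simp add: algebra_simps)
  qed
  have "AE x in M. y x = 0"
  proof (rule orth[OF y])
    fix v assume v: "v \<in> S"
    \<comment> \<open>Minimality over real multiples of \<open>c * v\<close> yields only a vanishing
      real part; the choices 1 and \<open>\<i>\<close> for \<open>c\<close> together give the whole
      inner product.\<close>
    have Re0: "Re (cnj c * L2_inner M y v) = 0" for c
    proof (rule quadratic_min_imp_zero[where p = "(cmod c * L2_norm M v)\<^sup>2"])
      fix t :: real
      have "(L2_norm M (\<lambda>x. y x - (of_real t * c) * v x))\<^sup>2 =
        (L2_norm M y)\<^sup>2 - 2 * t * Re (cnj c * L2_inner M y v) + t * t * (cmod c * L2_norm M v)\<^sup>2"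
        unfolding L2_norm_diff_sq[OF y L2_scale[OF S[OF v]]] L2_inner_scale_right L2_norm_scale
        by (simp add: norm_mult power_mult_distrib power2_eq_square algebra_simps)
      then show "0 \<le> t * t * (cmod c * L2_norm M v)\<^sup>2 - 2 * t * Re (cnj c * L2_inner M y v)"
        using var[OF v, of "of_real t * c"] \<open>(L2_norm M y)\<^sup>2 \<le> d\<close> by simp
    qed
    have "L2_inner M y v = 0" using Re0[of 1] Re0[of "\<i>"] by (simp add: complex_eq_iff)
    then show "L2_inner M v y = 0" by (simp add: L2_inner_commute[of M v y])
  qed
  then have "L2_norm M y = 0" using L2_norm_eq_0[OF y] by simp
  then have "(\<lambda>n. (L2_norm M (\<lambda>x. s n x - f x))\<^sup>2) \<longlonglongrightarrow> 0" using n_y by simp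
  from order_tendstoD(2)[OF this, of "e\<^sup>2"] obtain n where "(L2_norm M (\<lambda>x. s n x - f x))\<^sup>2 < e\<^sup>2"
    using e by (auto simp only: eventually_sequentially zero_less_power)
  then have "L2_norm M (\<lambda>x. s n x - f x) < e" using e by (auto intro: power_less_imp_less_base[where n = 2])
  with s show ?thesis by (rule that)
qed

section \<open>Factorization of the operator\<close>

definition Iphi :: "real set" where "Iphi = {- (pi / sqrt 2)<..<pi / sqrt 2}"

definition dphi :: "real \<Rightarrow> real" where "dphi x = - sin (x / sqrt 2)"

abbreviation (input) Mphi :: "real measure" where "Mphi \<equiv> lebesgue_on Iphi"

lemma open_Iphi [simp]: "open Iphi"
  by (simp add: Iphi_def)

lemma Iphi_angle: "x \<in> Iphi \<Longrightarrow> - (pi / 2) < x / sqrt 2 \<and> x / sqrt 2 < pi / 2"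
proof -
  assume "x \<in> Iphi"
  then have "- (pi / sqrt 2) / sqrt 2 < x / sqrt 2" "x / sqrt 2 < pi / sqrt 2 / sqrt 2"
    unfolding Iphi_def by (intro divide_strict_right_mono; simp)+
  then show ?thesis by simp
qed

lemma sqrt2_half: "sqrt 2 * c / 2 = c / sqrt 2"
proof -
  have "c * 2 = sqrt 2 * c * sqrt 2"
    by (simp only: mult.commute[of "sqrt 2"] mult.assoc real_sqrt_mult_self)
  then show ?thesis by (subst frac_eq_eq) auto
qed

lemma phi01_pos: "x \<in> Iphi \<Longrightarrow> 0 < phi01 x"
  using Iphi_angle[of x] by (simp add: phi01_def cos_gt_zero_pi)

lemma phi01_nz: "x \<in> Iphi \<Longrightarrow> phi01 x \<noteq> 0"
  using phi01_pos[of x] by simp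

lemma DERIV_phi01: "(phi01 has_real_derivative dphi x) (at x within S)"
proof -
  have "((\<lambda>x. sqrt 2 * cos (x / sqrt 2)) has_real_derivative dphi x) (at x within S)"
    by (auto intro!: derivative_eq_intros simp: dphi_def)
  then show ?thesis by (simp add: phi01_def[abs_def])
qed

lemma DERIV_dphi: "(dphi has_real_derivative - phi01 x / 2) (at x within S)"
proof -
  have "((\<lambda>x. - sin (x / sqrt 2)) has_real_derivative - (cos (x / sqrt 2) / sqrt 2)) (at x within S)"
    using DERIV_minus[OF DERIV_chain2[OF DERIV_sin DERIV_cdivide[OF DERIV_ident]], of "sqrt 2" x S] by simp
  moreover have "cos (x / sqrt 2) / sqrt 2 = phi01 x / 2"
    by (simp add: phi01_def sqrt2_half)
  ultimately show ?thesis by (simp add: dphi_def[abs_def])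
qed

lemmas DERIV_phi [derivative_intros] =
  DERIV_phi01[THEN DERIV_chain2] DERIV_dphi[THEN DERIV_chain2]

text \<open>The only algebraic relation between \<open>phi01\<close> and its derivative. Unfolding
  it eliminates \<open>phi01\<^sup>2\<close>, after which the integrands below agree as
  polynomials.\<close>

lemma phi01_dphi: "phi01 x * phi01 x = 2 - 2 * (dphi x * dphi x)"
  unfolding power2_eq_square[symmetric]
  by (simp add: phi01_def dphi_def power_mult_distrib cos_squared_eq)

lemma continuous_on_phi01 [continuous_intros]: "continuous_on S phi01"
  by (auto intro!: DERIV_continuous_on DERIV_phi01)

lemma continuous_on_dphi [continuous_intros]: "continuous_on S dphi"
  by (auto intro!: DERIV_continuous_on DERIV_dphi)

lemma phi01_endpoint: "phi01 (pi / sqrt 2) = 0" "phi01 (- (pi / sqrt 2)) = 0"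
  by (simp_all add: phi01_def cos_minus)

lemma finite_measure_Mphi [simp]: "finite_measure Mphi"
  by (rule finite_measure_lebesgue_on) (auto simp: Iphi_def)

section \<open>Bounded continuous functions and vanishing boundary terms\<close>

text \<open>Boundedness without endpoint values is all that integration by parts needs in the
  presence of a factor \<open>phi01\<close>. Unlike compact support it survives subtraction of
  multiples of \<open>phi01\<close> and \<open>dphi\<close>.\<close>

definition cb :: "(real \<Rightarrow> real) \<Rightarrow> bool" where
  "cb f \<longleftrightarrow> continuous_on Iphi f \<and> bounded (f ` Iphi)"

lemma cbI: "continuous_on Iphi f \<Longrightarrow> (\<And>x. x \<in> Iphi \<Longrightarrow> \<bar>f x\<bar> \<le> C) \<Longrightarrow> cb f"
  by (auto simp: cb_def bounded_iff)

lemma cbE: assumes "cb f" obtains C where "C > 0" "\<And>x. x \<in> Iphi \<Longrightarrow> \<bar>f x\<bar> \<le> C"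
proof -
  obtain C where "\<And>x. x \<in> Iphi \<Longrightarrow> \<bar>f x\<bar> \<le> C" using assms by (auto simp: cb_def bounded_iff)
  then have "\<bar>f x\<bar> \<le> \<bar>C\<bar> + 1" if "x \<in> Iphi" for x
    using that by (meson abs_ge_self add_increasing2 order_trans zero_le_one)
  then show thesis by (intro that[of "\<bar>C\<bar> + 1"]) auto
qed

lemma cb_const [intro!, simp]: "cb (\<lambda>x. c)"
  by (rule cbI[of _ "\<bar>c\<bar>"]) (auto intro: continuous_intros)

lemma cb_phi01 [intro!, simp]: "cb phi01"
  by (rule cbI[of _ "sqrt 2"]) (auto intro!: continuous_intros simp: phi01_def abs_mult mult_le_cancel_left1)

lemma cb_dphi [intro!, simp]: "cb dphi"
  by (rule cbI[of _ 1]) (auto intro!: continuous_intros simp: dphi_def)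

lemma cb_minus [intro!]: "cb f \<Longrightarrow> cb (\<lambda>x. - f x)"
  by (auto simp: cb_def bounded_iff intro: continuous_intros)

lemma cb_add [intro!]: assumes "cb f" "cb g" shows "cb (\<lambda>x. f x + g x)"
proof -
  obtain C D where "\<And>x. x \<in> Iphi \<Longrightarrow> \<bar>f x\<bar> \<le> C" "\<And>x. x \<in> Iphi \<Longrightarrow> \<bar>g x\<bar> \<le> D"
    using assms by (metis cbE)
  then show ?thesis using assms
    by (intro cbI[of _ "C + D"]) (auto simp: cb_def intro: continuous_intros order_trans[OF abs_triangle_ineq] add_mono)
qed

lemma cb_diff [intro!]: "cb f \<Longrightarrow> cb g \<Longrightarrow> cb (\<lambda>x. f x - g x)"
  using cb_add[of f "\<lambda>x. - g x"] cb_minus[of g] by simp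

lemma cb_mult [intro!]: assumes "cb f" "cb g" shows "cb (\<lambda>x. f x * g x)"
proof -
  obtain C D where C: "C > 0" "\<And>x. x \<in> Iphi \<Longrightarrow> \<bar>f x\<bar> \<le> C" and "\<And>x. x \<in> Iphi \<Longrightarrow> \<bar>g x\<bar> \<le> D"
    using assms by (metis cbE)
  then show ?thesis using assms
    by (intro cbI[of _ "C * D"]) (auto simp: cb_def abs_mult intro: continuous_intros mult_mono')
qed

lemma cb_power2 [intro!]: "cb f \<Longrightarrow> cb (\<lambda>x. (f x)\<^sup>2)"
  by (simp add: power2_eq_square cb_mult)

lemma cb_divide_const [intro!]: "cb f \<Longrightarrow> cb (\<lambda>x. f x / c)"
  using cb_mult[of f "\<lambda>x. 1/c"] by simp

lemma cb_measurable: "cb f \<Longrightarrow> f \<in> borel_measurable Mphi"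
  unfolding cb_def by (auto intro!: continuous_imp_measurable_on_sets_lebesgue simp: Iphi_def)

lemma cb_integrable: assumes "cb f" shows "integrable Mphi f"
proof -
  obtain C where "\<And>x. x \<in> Iphi \<Longrightarrow> \<bar>f x\<bar> \<le> C" using assms by (metis cbE)
  then show ?thesis
    by (intro finite_measure.integrable_const_bound[of _ _ C] cb_measurable assms) auto
qed

lemma cb_int_mono:
  "cb f \<Longrightarrow> cb g \<Longrightarrow> (\<And>x. x \<in> Iphi \<Longrightarrow> f x \<le> g x) \<Longrightarrow> (LINT x|Mphi. f x) \<le> (LINT x|Mphi. g x)"
  by (intro integral_mono) (auto intro: cb_integrable)

lemma cb_int_nonneg:
  fixes f :: "real \<Rightarrow> real"
  shows "(\<And>x. x \<in> Iphi \<Longrightarrow> 0 \<le> f x) \<Longrightarrow> 0 \<le> (LINT x|Mphi. f x)"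
  by (intro integral_nonneg_AE) auto

text \<open>The integrand is the derivative of \<open>phi01 * k\<close>. A bounded \<open>k\<close>
  makes this product tend to 0 at both endpoints, so its extension \<open>G\<close> by 0 is
  continuous on the closed interval and the fundamental theorem of calculus applies. The identities
  of this section are instances for suitable \<open>k\<close>.\<close>

lemma integral_phi_mult_deriv:
  assumes k: "\<And>x. x \<in> Iphi \<Longrightarrow> (k has_real_derivative k' x) (at x)"
    and p: "\<And>x. x \<in> Iphi \<Longrightarrow> p x = dphi x * k x + phi01 x * k' x"
    and "cb k" "cb p"
  shows "(LINT x|Mphi. p x) = 0"
proof -
  define a b :: real where "a = - (pi / sqrt 2)" and "b = pi / sqrt 2"
  have I: "Iphi = {a<..<b}" and ab: "a < b" by (auto simp: Iphi_def a_def b_def)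
  have phi_ab: "phi01 a = 0" "phi01 b = 0" by (simp_all add: a_def b_def phi01_endpoint)
  define G where "G x = phi01 x * (if x \<in> Iphi then k x else 0)" for x
  obtain C where C: "C > 0" "\<And>x. x \<in> Iphi \<Longrightarrow> \<bar>k x\<bar> \<le> C" using \<open>cb k\<close> by (metis cbE)
  have G_deriv: "(G has_real_derivative p x) (at x)" if "x \<in> Iphi" for x
  proof -
    have "((\<lambda>x. phi01 x * k x) has_real_derivative p x) (at x)"
      using that p by (auto intro!: derivative_eq_intros k)
    moreover have "eventually (\<lambda>y. y \<in> Iphi) (nhds x)"
      using that by (intro eventually_nhds_in_open) auto
    ultimately show ?thesis
      by (subst DERIV_cong_ev[OF refl _ refl]) (auto simp: G_def elim: eventually_mono)
  qed
  have G_end: "isCont G x" if "phi01 x = 0" for x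
  proof -
    have "\<bar>G y\<bar> \<le> \<bar>phi01 y\<bar> * C" for y
      using C by (auto simp: G_def abs_mult intro!: mult_left_mono)
    moreover have "((\<lambda>y. \<bar>phi01 y\<bar> * C) \<longlongrightarrow> \<bar>phi01 x\<bar> * C) (at x)"
      using DERIV_phi01[of x UNIV, THEN DERIV_isCont] by (intro tendsto_intros) (simp add: isCont_def)
    ultimately have "(G \<longlongrightarrow> 0) (at x)"
      using that by (intro Lim_null_comparison[of G "\<lambda>y. \<bar>phi01 y\<bar> * C"]) auto
    then show ?thesis using that by (simp add: isCont_def G_def)
  qed
  have "continuous_on {a..b} G"
  proof (rule continuous_at_imp_continuous_on, rule ballI)
    fix x assume "x \<in> {a..b}"
    then consider "x \<in> Iphi" | "x = a" | "x = b" by (auto simp: I order_less_le)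
    then show "isCont G x"
      using G_end phi_ab G_deriv DERIV_isCont by cases blast+
  qed
  then have "(p has_integral (G b - G a)) {a..b}"
    using ab G_deriv by (intro fundamental_theorem_of_calculus_interior) (auto simp: I has_real_derivative_iff_has_vector_derivative)
  then have "(p has_integral 0) Iphi"
    using phi_ab by (simp add: G_def I has_integral_Icc_iff_Ioo)
  moreover have "(p has_integral (LINT x|Mphi. p x)) Iphi"
    using \<open>cb p\<close> by (intro has_integral_integral_lebesgue_on cb_integrable) (auto simp: I)
  ultimately show ?thesis by (rule has_integral_unique[symmetric])
qed

text \<open>
  \<open>reg u f y\<close> says that \<open>L u = f\<close> and \<open>A u = y\<close>; \<open>chain u g h\<close> says that \<open>u = A\<^sup>* g\<close> and
  \<open>g = B\<^sup>* h\<close>.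
\<close>

definition reg :: "(real \<Rightarrow> real) \<Rightarrow> (real \<Rightarrow> real) \<Rightarrow> (real \<Rightarrow> real) \<Rightarrow> bool" where
  "reg u f y \<longleftrightarrow> cb u \<and> cb f \<and> cb y \<and>
     (\<forall>x\<in>Iphi. (u has_real_derivative (y x + dphi x * u x) / phi01 x) (at x)) \<and>
     (\<forall>x\<in>Iphi. (y has_real_derivative - (f x + 2 * u x + 2 * dphi x * y x) / phi01 x) (at x))"

definition chain :: "(real \<Rightarrow> real) \<Rightarrow> (real \<Rightarrow> real) \<Rightarrow> (real \<Rightarrow> real) \<Rightarrow> bool" where
  "chain u g h \<longleftrightarrow> cb u \<and> cb g \<and> cb h \<and>
     (\<forall>x\<in>Iphi. (g has_real_derivative - (u x + 2 * dphi x * g x) / phi01 x) (at x)) \<and>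
     (\<forall>x\<in>Iphi. (h has_real_derivative - (g x + dphi x * h x) / phi01 x) (at x))"

section \<open>Integral identities for the two factorizations\<close>

lemma reg_phi01: "reg phi01 (\<lambda>x. - 2 * phi01 x) (\<lambda>x. 0)"
  by (auto simp: reg_def phi01_nz intro!: derivative_eq_intros DERIV_phi01 cb_mult)

lemma reg_dphi: "reg dphi (\<lambda>x. 0) (\<lambda>x. -1)"
proof -
  have "(dphi has_real_derivative (- 1 + dphi x * dphi x) / phi01 x) (at x)" if "x \<in> Iphi" for x
    using phi01_dphi[of x] phi01_nz[OF that] by (intro DERIV_cong[OF DERIV_dphi]) (simp add: field_simps)
  then show ?thesis by (auto simp: reg_def phi01_nz)
qed

lemma reg_add:
  assumes "reg u f y" "reg v g z"
  shows "reg (\<lambda>x. u x + v x) (\<lambda>x. f x + g x) (\<lambda>x. y x + z x)"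
proof -
  have "((\<lambda>x. u x + v x) has_real_derivative (y x + z x + dphi x * (u x + v x)) / phi01 x) (at x)"
    "((\<lambda>x. y x + z x) has_real_derivative - (f x + g x + 2 * (u x + v x) + 2 * dphi x * (y x + z x)) / phi01 x) (at x)"
    if "x \<in> Iphi" for x
    using assms that unfolding reg_def
    by (auto intro!: derivative_eq_intros simp: phi01_nz field_simps)
  then show ?thesis using assms by (auto simp: reg_def)
qed

lemma reg_scale:
  assumes "reg u f y"
  shows "reg (\<lambda>x. c * u x) (\<lambda>x. c * f x) (\<lambda>x. c * y x)"
proof -
  have "((\<lambda>x. c * u x) has_real_derivative (c * y x + dphi x * (c * u x)) / phi01 x) (at x)"
    "((\<lambda>x. c * y x) has_real_derivative - (c * f x + 2 * (c * u x) + 2 * dphi x * (c * y x)) / phi01 x) (at x)"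
    if "x \<in> Iphi" for x
    using assms that unfolding reg_def
    by (auto intro!: derivative_eq_intros simp: phi01_nz field_simps)
  then show ?thesis using assms by (auto simp: reg_def)
qed

text \<open>Green's identity. The function \<open>k\<close> is \<open>phi01\<close> times the
  Wronskian of \<open>u\<close> and \<open>v\<close>: in \<open>v * A u - u * A v\<close> the terms
  with \<open>dphi\<close> cancel.\<close>

lemma reg_symmetric:
  assumes "reg u f y" "reg v g z"
  shows "(LINT x|Mphi. f x * v x) = (LINT x|Mphi. u x * g x)"
proof -
  note r = assms[unfolded reg_def]
  have [intro]: "cb u" "cb f" "cb y" "cb v" "cb g" "cb z" using r by auto
  have "(LINT x|Mphi. u x * g x - f x * v x) = 0"
  proof (rule integral_phi_mult_deriv[where k = "\<lambda>x. v x * y x - u x * z x"])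
    fix x assume x: "x \<in> Iphi"
    show "((\<lambda>x. v x * y x - u x * z x) has_real_derivative
       (u x * g x - f x * v x - dphi x * (v x * y x - u x * z x)) / phi01 x) (at x)"
      using r x by (auto intro!: derivative_eq_intros simp: phi01_nz field_simps)
  qed (auto simp: phi01_nz)
  then show ?thesis by (subst (asm) Bochner_Integration.integral_diff) (auto intro: cb_integrable)
qed

text \<open>Moving one factor across gives \<open><A u, A u> = <A\<^sup>* A u, u>\<close>, and
  \<open>A\<^sup>* A = L + 2\<close>.\<close>

lemma reg_form:
  assumes "reg u f y"
  shows "(LINT x|Mphi. (y x)\<^sup>2) = (LINT x|Mphi. f x * u x) + 2 * (LINT x|Mphi. (u x)\<^sup>2)"
proof -
  note r = assms[unfolded reg_def]
  have [intro]: "cb u" "cb f" "cb y" using r by auto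
  have "(LINT x|Mphi. (y x)\<^sup>2 - (f x * u x + 2 * (u x)\<^sup>2)) = 0"
  proof (rule integral_phi_mult_deriv[where k = "\<lambda>x. u x * y x"])
    fix x assume x: "x \<in> Iphi"
    show "((\<lambda>x. u x * y x) has_real_derivative
       ((y x)\<^sup>2 - (f x * u x + 2 * (u x)\<^sup>2) - dphi x * (u x * y x)) / phi01 x) (at x)"
      using r x by (auto intro!: derivative_eq_intros simp: phi01_nz field_simps power2_eq_square)
  qed (auto simp: phi01_nz)
  moreover have "(LINT x|Mphi. f x * u x + 2 * (u x)\<^sup>2) = (LINT x|Mphi. f x * u x) + 2 * (LINT x|Mphi. (u x)\<^sup>2)"
    by (subst Bochner_Integration.integral_add) (auto intro!: cb_integrable)
  ultimately show ?thesis
    by (subst (asm) Bochner_Integration.integral_diff) (auto intro!: cb_integrable)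
qed

text \<open>Here \<open>q = B g\<close>. The first identity is
  \<open>A A\<^sup>* = B\<^sup>* B + 2\<close> as a form, the second is
  \<open><B\<^sup>* h, g> = <h, B g>\<close>, and the third is the Hardy inequality before
  nonnegative terms are dropped: \<open>g + dphi h / 2 = - phi\<^sup>1\<^sup>/\<^sup>2
  (phi\<^sup>1\<^sup>/\<^sup>2 h)'\<close> is the substitution that extracts the threshold 1/4, and
  \<open>phi\<^sup>2 / 8\<close> is the repulsive potential that is left.\<close>

lemma chain_identities:
  assumes "chain u g h"
  defines "q \<equiv> \<lambda>x. - (u x + 2 * dphi x * g x)"
  shows "(LINT x|Mphi. (u x)\<^sup>2) = (LINT x|Mphi. (q x)\<^sup>2) + 2 * (LINT x|Mphi. (g x)\<^sup>2)"
    and "(LINT x|Mphi. (g x)\<^sup>2) = (LINT x|Mphi. q x * h x)"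
    and "(LINT x|Mphi. (g x)\<^sup>2) = (LINT x|Mphi. (g x + dphi x * h x / 2)\<^sup>2 + (1/4 + phi01 x * phi01 x / 8) * (h x)\<^sup>2)"
proof -
  note r = assms(1)[unfolded chain_def]
  have [intro]: "cb u" "cb g" "cb h" using r by auto
  have [intro]: "cb q" unfolding q_def by auto
  have "(LINT x|Mphi. (u x)\<^sup>2 - ((q x)\<^sup>2 + 2 * (g x)\<^sup>2)) = 0"
  proof (rule integral_phi_mult_deriv[where k = "\<lambda>x. 2 * dphi x * (g x)\<^sup>2"])
    fix x assume x: "x \<in> Iphi"
    show "((\<lambda>x. 2 * dphi x * (g x)\<^sup>2) has_real_derivative
       - phi01 x * (g x)\<^sup>2 + 4 * dphi x * g x * q x / phi01 x) (at x)"
      using r x by (auto intro!: derivative_eq_intros simp: phi01_nz field_simps power2_eq_square q_def)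
    have "(u x)\<^sup>2 - ((q x)\<^sup>2 + 2 * (g x)\<^sup>2) =
       dphi x * (2 * dphi x * (g x)\<^sup>2) + (- (phi01 x * phi01 x) * (g x)\<^sup>2 + 4 * dphi x * g x * q x)"
      unfolding phi01_dphi q_def by (simp add: algebra_simps power2_eq_square)
    then show "(u x)\<^sup>2 - ((q x)\<^sup>2 + 2 * (g x)\<^sup>2) =
       dphi x * (2 * dphi x * (g x)\<^sup>2) + phi01 x * (- phi01 x * (g x)\<^sup>2 + 4 * dphi x * g x * q x / phi01 x)"
      using x by (simp add: phi01_nz distrib_left right_diff_distrib)
  qed auto
  moreover have "(LINT x|Mphi. (q x)\<^sup>2 + 2 * (g x)\<^sup>2) = (LINT x|Mphi. (q x)\<^sup>2) + 2 * (LINT x|Mphi. (g x)\<^sup>2)"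
    by (subst Bochner_Integration.integral_add) (auto intro!: cb_integrable)
  ultimately show "(LINT x|Mphi. (u x)\<^sup>2) = (LINT x|Mphi. (q x)\<^sup>2) + 2 * (LINT x|Mphi. (g x)\<^sup>2)"
    by (subst (asm) Bochner_Integration.integral_diff) (auto intro!: cb_integrable)
  have "(LINT x|Mphi. (g x)\<^sup>2 - q x * h x) = 0"
  proof (rule integral_phi_mult_deriv[where k = "\<lambda>x. - (g x * h x)"])
    fix x assume x: "x \<in> Iphi"
    show "((\<lambda>x. - (g x * h x)) has_real_derivative
       ((g x)\<^sup>2 - q x * h x + dphi x * (g x * h x)) / phi01 x) (at x)"
      using r x by (auto intro!: derivative_eq_intros simp: phi01_nz field_simps power2_eq_square q_def)
  qed (auto simp: phi01_nz)
  then show "(LINT x|Mphi. (g x)\<^sup>2) = (LINT x|Mphi. q x * h x)"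
    by (subst (asm) Bochner_Integration.integral_diff) (auto intro!: cb_integrable)
  let ?r = "\<lambda>x. (g x + dphi x * h x / 2)\<^sup>2 + (1/4 + phi01 x * phi01 x / 8) * (h x)\<^sup>2"
  have "(LINT x|Mphi. (g x)\<^sup>2 - ?r x) = 0"
  proof (rule integral_phi_mult_deriv[where k = "\<lambda>x. dphi x * (h x)\<^sup>2 / 2"])
    fix x assume x: "x \<in> Iphi"
    show "((\<lambda>x. dphi x * (h x)\<^sup>2 / 2) has_real_derivative
       - phi01 x * (h x)\<^sup>2 / 4 - dphi x * h x * (g x + dphi x * h x) / phi01 x) (at x)"
      using r x by (auto intro!: derivative_eq_intros simp: phi01_nz field_simps power2_eq_square)
    have "(g x)\<^sup>2 - ?r x = dphi x * (dphi x * (h x)\<^sup>2 / 2) + (- (phi01 x * phi01 x) * (h x)\<^sup>2 / 4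
         - dphi x * h x * (g x + dphi x * h x))"
      unfolding phi01_dphi by (simp add: field_simps power2_eq_square)
    then show "(g x)\<^sup>2 - ?r x = dphi x * (dphi x * (h x)\<^sup>2 / 2) + phi01 x * (- phi01 x * (h x)\<^sup>2 / 4
         - dphi x * h x * (g x + dphi x * h x) / phi01 x)"
      using x by (simp add: phi01_nz right_diff_distrib)
  qed auto
  then show "(LINT x|Mphi. (g x)\<^sup>2) = (LINT x|Mphi. ?r x)"
    by (subst (asm) Bochner_Integration.integral_diff) (auto intro!: cb_integrable)
qed

text \<open>Dropping nonnegative terms from the Hardy identity gives
  \<open>B B\<^sup>* \<ge> 1/4\<close>. Young's inequality for \<open>q * h\<close> with weights 2
  and 1/8 transfers this to \<open>\<parallel>g\<parallel>\<^sup>2 \<le> 4 \<parallel>B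
  g\<parallel>\<^sup>2\<close>, and \<open>A A\<^sup>* = B\<^sup>* B + 2\<close> raises 1/4 to
  9/4.\<close>

lemma chain_bounds:
  assumes "chain u g h"
  shows "(LINT x|Mphi. (h x)\<^sup>2) \<le> 4 * (LINT x|Mphi. (g x)\<^sup>2)"
    and "9 * (LINT x|Mphi. (g x)\<^sup>2) \<le> 4 * (LINT x|Mphi. (u x)\<^sup>2)"
proof -
  have [intro]: "cb u" "cb g" "cb h" using assms by (auto simp: chain_def)
  define q where "q x = - (u x + 2 * dphi x * g x)" for x
  have [intro]: "cb q" unfolding q_def[abs_def] by auto
  note ids = chain_identities[OF assms, folded q_def]
  have "(LINT x|Mphi. (1/4) * (h x)\<^sup>2) \<le> (LINT x|Mphi. (g x)\<^sup>2)"
    unfolding ids(3)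
  proof (rule cb_int_mono)
    fix x
    show "(1/4) * (h x)\<^sup>2 \<le> (g x + dphi x * h x / 2)\<^sup>2 + (1/4 + phi01 x * phi01 x / 8) * (h x)\<^sup>2"
      using mult_nonneg_nonneg[OF _ zero_le_power2, of "phi01 x * phi01 x / 8" "h x"]
        zero_le_power2[of "g x + dphi x * h x / 2"] zero_le_square[of "phi01 x"]
      unfolding distrib_right by linarith
  qed auto
  then show h: "(LINT x|Mphi. (h x)\<^sup>2) \<le> 4 * (LINT x|Mphi. (g x)\<^sup>2)" by simp
  have "(LINT x|Mphi. (g x)\<^sup>2) \<le> (LINT x|Mphi. 2 * (q x)\<^sup>2 + (1/8) * (h x)\<^sup>2)"
    unfolding ids(2)
  proof (rule cb_int_mono)
    fix x show "q x * h x \<le> 2 * (q x)\<^sup>2 + (1/8) * (h x)\<^sup>2"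
      using zero_le_power2[of "4 * q x - h x"] by (simp add: power2_eq_square algebra_simps)
  qed auto
  also have "\<dots> = 2 * (LINT x|Mphi. (q x)\<^sup>2) + (1/8) * (LINT x|Mphi. (h x)\<^sup>2)"
    by (subst Bochner_Integration.integral_add) (auto intro!: cb_integrable)
  finally show "9 * (LINT x|Mphi. (g x)\<^sup>2) \<le> 4 * (LINT x|Mphi. (u x)\<^sup>2)"
    using h ids(1) by linarith
qed

text \<open>Since \<open>u = A\<^sup>* g\<close>, one has
  \<open>\<parallel>u\<parallel>\<^sup>2 = <g, A u>\<close>. The weights 9/8 and 2/9 are chosen so
  that the part with \<open>g\<close> is at most half of
  \<open>\<parallel>u\<parallel>\<^sup>2\<close>. What remains is \<open>\<parallel>A
  u\<parallel>\<^sup>2 \<ge> 9/4 \<parallel>u\<parallel>\<^sup>2\<close>, and subtracting 2 leaves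
  1/4.\<close>

lemma reg_chain_gap:
  assumes "reg u f y" "chain u g h"
  shows "(LINT x|Mphi. (u x)\<^sup>2) \<le> 4 * (LINT x|Mphi. f x * u x)"
proof -
  note r = assms[unfolded reg_def chain_def]
  have [intro]: "cb u" "cb f" "cb y" "cb g" using r by auto
  have "(LINT x|Mphi. (u x)\<^sup>2 - g x * y x) = 0"
  proof (rule integral_phi_mult_deriv[where k = "\<lambda>x. - (u x * g x)"])
    fix x assume x: "x \<in> Iphi"
    show "((\<lambda>x. - (u x * g x)) has_real_derivative
       ((u x)\<^sup>2 - g x * y x + dphi x * (u x * g x)) / phi01 x) (at x)"
      using r x by (auto intro!: derivative_eq_intros simp: phi01_nz field_simps power2_eq_square)
  qed (auto simp: phi01_nz)
  then have "(LINT x|Mphi. (u x)\<^sup>2) = (LINT x|Mphi. g x * y x)"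
    by (subst (asm) Bochner_Integration.integral_diff) (auto intro!: cb_integrable)
  also have "\<dots> \<le> (LINT x|Mphi. (9/8) * (g x)\<^sup>2 + (2/9) * (y x)\<^sup>2)"
  proof (rule cb_int_mono)
    fix x show "g x * y x \<le> (9/8) * (g x)\<^sup>2 + (2/9) * (y x)\<^sup>2"
      using zero_le_power2[of "9 * g x - 4 * y x"] by (simp add: power2_eq_square algebra_simps)
  qed auto
  also have "\<dots> = (9/8) * (LINT x|Mphi. (g x)\<^sup>2) + (2/9) * (LINT x|Mphi. (y x)\<^sup>2)"
    by (subst Bochner_Integration.integral_add) (auto intro!: cb_integrable)
  finally show ?thesis
    using chain_bounds(2)[OF assms(2)] reg_form[OF assms(1)] by linarith
qed

text \<open>Intertwining: \<open>(L - l) A\<^sup>* = A\<^sup>* (B\<^sup>* B - l)\<close> and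
  \<open>(B\<^sup>* B - l) B\<^sup>* = B\<^sup>* (B B\<^sup>* - l)\<close>. The residual
  \<open>f - l u\<close> thus has its own chain, ending in \<open>(B B\<^sup>* - l) h\<close>, so
  that the bounds for chains control this last function by the residual.\<close>

lemma chain_shift:
  assumes "reg u f y" "chain u g h"
  shows "chain (\<lambda>x. f x - l * u x) (\<lambda>x. y x - (2 + l) * g x) (\<lambda>x. - (u x + 2 * dphi x * g x) - l * h x)"
proof -
  note r = assms[unfolded reg_def chain_def]
  have [intro]: "cb u" "cb f" "cb y" "cb g" "cb h" using r by auto
  have "((\<lambda>x. y x - (2 + l) * g x) has_real_derivative
      - (f x - l * u x + 2 * dphi x * (y x - (2 + l) * g x)) / phi01 x) (at x)" if x: "x \<in> Iphi" for x
    using r x by (auto intro!: derivative_eq_intros simp: phi01_nz field_simps)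
  moreover have "((\<lambda>x. - (u x + 2 * dphi x * g x) - l * h x) has_real_derivative
      - (y x - (2 + l) * g x + dphi x * (- (u x + 2 * dphi x * g x) - l * h x)) / phi01 x) (at x)"
    if x: "x \<in> Iphi" for x
  proof -
    have "((\<lambda>x. - (u x + 2 * dphi x * g x) - l * h x) has_real_derivative
      (- (y x + dphi x * u x) + phi01 x * phi01 x * g x + 2 * dphi x * (u x + 2 * dphi x * g x)
       + l * (g x + dphi x * h x)) / phi01 x) (at x)"
      using r x by (auto intro!: derivative_eq_intros DERIV_dphi simp: phi01_nz field_simps)
    then show ?thesis
      by (rule DERIV_cong) (unfold phi01_dphi, simp add: algebra_simps)
  qed
  ultimately show ?thesis by (auto simp: chain_def)
qed

text \<open>
  A Morawetz estimate for \<open>B B\<^sup>* - l\<close>, with multiplier \<open>\<phi>' g + h / 2\<close>. It excludes all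
  eigenvalues with eigenfunctions orthogonal to \<open>\<phi>\<close> and \<open>\<phi>'\<close>, embedded ones included.
\<close>

lemma reg_chain_morawetz:
  assumes "reg u f y" "chain u g h" and t: "t > 0"
  shows "9 * (LINT x|Mphi. (phi01 x * g x)\<^sup>2) \<le>
    16 * ((LINT x|Mphi. (f x - l * u x)\<^sup>2) / t + t * (LINT x|Mphi. (u x)\<^sup>2))"
proof -
  note r = assms(1,2)[unfolded reg_def chain_def]
  have [intro]: "cb u" "cb f" "cb y" "cb g" "cb h" using r by auto
  note c = chain_shift[OF assms(1,2), of l]
  define p where "p x = - (u x + 2 * dphi x * g x) - l * h x" for x
  have [intro]: "cb p" unfolding p_def[abs_def] by auto
  \<comment> \<open>With \<open>V = phi01 * dphi\<close> this is \<open>- (V h' + V' h / 2)\<close>,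
    an antisymmetric first-order expression in \<open>h\<close>. The term \<open>l * h\<close> of
    \<open>p\<close> therefore integrates to 0 against it, and the estimate is uniform in
    \<open>l\<close>. In the variable \<open>z\<close> it is the multiplier
    \<open>tanh z d/dz + sech\<^sup>2 z / 2\<close>.\<close>
  define m where "m x = dphi x * g x + h x / 2" for x
  have [intro]: "cb m" unfolding m_def[abs_def] by auto
  have "(LINT x|Mphi. p x * m x - (1/2) * (phi01 x * g x)\<^sup>2) = 0"
  proof (rule integral_phi_mult_deriv[where k = "\<lambda>x. (1/2) * dphi x * (g x)\<^sup>2 + (1/2) * g x * h x + (l/2) * dphi x * (h x)\<^sup>2"])
    fix x assume x: "x \<in> Iphi"
    let ?q = "- (u x + 2 * dphi x * g x)" and ?s = "- (g x + dphi x * h x)"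
    let ?k' = "(- (phi01 x * phi01 x) / 4 * ((g x)\<^sup>2 + l * (h x)\<^sup>2) + dphi x * g x * ?q + (1/2) * ?q * h x
        + (1/2) * g x * ?s + l * dphi x * h x * ?s)"
    show "((\<lambda>x. (1/2) * dphi x * (g x)\<^sup>2 + (1/2) * g x * h x + (l/2) * dphi x * (h x)\<^sup>2) has_real_derivative
      ?k' / phi01 x) (at x)"
      using r x by (auto intro!: derivative_eq_intros DERIV_dphi simp: phi01_nz field_simps power2_eq_square)
    have "p x * m x - (1/2) * (phi01 x * phi01 x) * (g x)\<^sup>2 =
        dphi x * ((1/2) * dphi x * (g x)\<^sup>2 + (1/2) * g x * h x + (l/2) * dphi x * (h x)\<^sup>2) + ?k'"
      unfolding phi01_dphi p_def m_def by (simp add: field_simps power2_eq_square)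
    then show "p x * m x - (1/2) * (phi01 x * g x)\<^sup>2 =
        dphi x * ((1/2) * dphi x * (g x)\<^sup>2 + (1/2) * g x * h x + (l/2) * dphi x * (h x)\<^sup>2) + phi01 x * (?k' / phi01 x)"
      using x by (simp add: phi01_nz power2_eq_square mult.assoc mult.left_commute)
  qed auto
  then have "(LINT x|Mphi. (phi01 x * g x)\<^sup>2) = 2 * (LINT x|Mphi. p x * m x)"
    by (subst (asm) Bochner_Integration.integral_diff) (auto intro!: cb_integrable)
  also have "(LINT x|Mphi. p x * m x) \<le> (LINT x|Mphi. (1 / (2 * t)) * (p x)\<^sup>2 + t * ((g x)\<^sup>2 + (1/4) * (h x)\<^sup>2))"
  proof (rule cb_int_mono)
    fix x
    have "(m x)\<^sup>2 \<le> 2 * (dphi x)\<^sup>2 * (g x)\<^sup>2 + (1/2) * (h x)\<^sup>2"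
      using zero_le_power2[of "dphi x * g x - h x / 2"]
      by (simp add: m_def power2_eq_square algebra_simps)
    also have "\<dots> \<le> 2 * (g x)\<^sup>2 + (1/2) * (h x)\<^sup>2"
      by (intro add_right_mono mult_right_mono) (auto simp: dphi_def abs_square_le_1)
    finally have m: "(m x)\<^sup>2 \<le> 2 * (g x)\<^sup>2 + (1/2) * (h x)\<^sup>2" .
    have "p x * m x \<le> (1 / (2 * t)) * (p x)\<^sup>2 + (t / 2) * (m x)\<^sup>2"
      using zero_le_power2[of "p x - t * m x"] t by (simp add: power2_eq_square field_simps)
    also have "(t / 2) * (m x)\<^sup>2 \<le> (t / 2) * (2 * (g x)\<^sup>2 + (1/2) * (h x)\<^sup>2)"
      using t m by (intro mult_left_mono) auto
    finally show "p x * m x \<le> (1 / (2 * t)) * (p x)\<^sup>2 + t * ((g x)\<^sup>2 + (1/4) * (h x)\<^sup>2)"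
      by (simp add: algebra_simps)
  qed auto
  also have "\<dots> = (1 / (2 * t)) * (LINT x|Mphi. (p x)\<^sup>2)
      + t * ((LINT x|Mphi. (g x)\<^sup>2) + (1/4) * (LINT x|Mphi. (h x)\<^sup>2))"
    by (subst Bochner_Integration.integral_add, (auto intro!: cb_integrable)[2])+
      (subst integral_mult_right_zero, subst integral_mult_right_zero,
        subst Bochner_Integration.integral_add, auto intro!: cb_integrable)
  \<comment> \<open>The chain bounds, once for the residual and once for \<open>u\<close>: 16/9 is 4
    times 4/9, and 8/9 is 4/9 for \<open>g\<close> plus a quarter of 16/9 for
    \<open>h\<close>.\<close>
  also have "\<dots> \<le> (1 / (2 * t)) * (16/9 * (LINT x|Mphi. (f x - l * u x)\<^sup>2)) + t * (8/9 * (LINT x|Mphi. (u x)\<^sup>2))"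
  proof (intro add_mono mult_left_mono)
    show "(LINT x|Mphi. (p x)\<^sup>2) \<le> 16/9 * (LINT x|Mphi. (f x - l * u x)\<^sup>2)"
      using chain_bounds[OF c] unfolding p_def by linarith
    show "(LINT x|Mphi. (g x)\<^sup>2) + (1/4) * (LINT x|Mphi. (h x)\<^sup>2) \<le> 8/9 * (LINT x|Mphi. (u x)\<^sup>2)"
      using chain_bounds[OF assms(2)] by linarith
  qed (use t in auto)
  finally show ?thesis by (simp add: field_simps)
qed

text \<open>This is \<open><A\<^sup>* g, v> = <g, A v>\<close> with one factor \<open>phi01\<close>
  moved from \<open>A v\<close> to \<open>g\<close>, because the Morawetz estimate controls only
  \<open>phi01 * g\<close>. For a test function \<open>v\<close> the remaining quotient is
  bounded.\<close>

lemma chain_pairing: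
  assumes "chain u g h" and v: "\<And>x. x \<in> Iphi \<Longrightarrow> (v has_real_derivative v' x) (at x)"
    and cb: "cb v" "cb (\<lambda>x. v' x - dphi x * v x / phi01 x)"
  shows "(LINT x|Mphi. u x * v x) = (LINT x|Mphi. (phi01 x * g x) * (v' x - dphi x * v x / phi01 x))"
proof -
  note r = assms(1)[unfolded chain_def]
  have [intro]: "cb u" "cb g" using r by auto
  define z where "z x = v' x - dphi x * v x / phi01 x" for x
  have [intro]: "cb v" "cb z" using cb by (auto simp: z_def[abs_def])
  have "(LINT x|Mphi. u x * v x - (phi01 x * g x) * z x) = 0"
  proof (rule integral_phi_mult_deriv[where k = "\<lambda>x. - (g x * v x)"])
    fix x assume x: "x \<in> Iphi"
    show "((\<lambda>x. - (g x * v x)) has_real_derivative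
       (u x + 2 * dphi x * g x) / phi01 x * v x - g x * v' x) (at x)"
      using r x v by (auto intro!: derivative_eq_intros simp: phi01_nz field_simps)
    show "u x * v x - (phi01 x * g x) * z x =
       dphi x * - (g x * v x) + phi01 x * ((u x + 2 * dphi x * g x) / phi01 x * v x - g x * v' x)"
      using x by (simp add: phi01_nz field_simps z_def)
  qed auto
  then have "(LINT x|Mphi. u x * v x) = (LINT x|Mphi. (phi01 x * g x) * z x)"
    by (subst (asm) Bochner_Integration.integral_diff) (auto intro!: cb_integrable)
  then show ?thesis by (simp add: z_def)
qed

section \<open>Solving the first-order equations of a chain\<close>

text \<open>By the zero mean, the integral from the left endpoint equals minus the integral to the
  right endpoint, so one majorant \<open>C * \<theta>'\<close> bounds the antiderivative from both
  ends. This decay is what makes quotients by powers of \<open>phi01\<close> bounded.\<close>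

lemma cb_antiderivative:
  assumes w: "cb w" and w0: "(LINT x|Mphi. w x) = 0"
  obtains W where "\<And>x. x \<in> Iphi \<Longrightarrow> (W has_real_derivative w x) (at x)"
    and "\<And>C \<theta> \<theta>' x. x \<in> Iphi \<Longrightarrow> (\<And>x. x \<in> Iphi \<Longrightarrow> \<bar>w x\<bar> \<le> C * \<theta>' x) \<Longrightarrow>
      C * \<theta>' (- (pi / sqrt 2)) \<ge> 0 \<Longrightarrow> C * \<theta>' (pi / sqrt 2) \<ge> 0 \<Longrightarrow>
      (\<And>x. (\<theta> has_real_derivative \<theta>' x) (at x)) \<Longrightarrow>
      \<bar>W x\<bar> \<le> C * (\<theta> x - \<theta> (- (pi / sqrt 2))) \<and> \<bar>W x\<bar> \<le> C * (\<theta> (pi / sqrt 2) - \<theta> x)"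
proof -
  define a b :: real where "a = - (pi / sqrt 2)" and "b = pi / sqrt 2"
  have I: "Iphi = {a<..<b}" and ab: "a < b" by (auto simp: Iphi_def a_def b_def)
  define w' where "w' x = (if x \<in> Iphi then w x else 0)" for x
  have "(w has_integral 0) Iphi"
    using has_integral_integral_lebesgue_on[OF cb_integrable[OF w]] w0 by (simp add: I)
  then have "(w' has_integral 0) Iphi"
    by (rule has_integral_eq[rotated]) (simp add: w'_def)
  then have w'_int: "(w' has_integral 0) {a..b}"
    by (simp add: I has_integral_Icc_iff_Ioo)
  then have w'_on: "w' integrable_on {a..b}" by blast
  define W where "W x = integral {a..x} w'" for x
  show thesis
  proof (rule that[of W])
    fix x assume x: "x \<in> Iphi"
    have ev: "eventually (\<lambda>y. y \<in> Iphi) (nhds x)"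
      using x by (intro eventually_nhds_in_open) auto
    have "isCont w x" using w x by (auto simp: cb_def continuous_on_eq_continuous_at)
    then have "isCont w' x"
      by (subst isCont_cong[OF eventually_mono[OF ev]]) (auto simp: w'_def)
    then have "(W has_vector_derivative w' x) (at x within {a..b})"
      unfolding W_def using x integral_has_vector_derivative_continuous_at[OF w'_on, of x "{}"]
      by (auto simp: I intro: continuous_at_imp_continuous_at_within)
    then have "(W has_vector_derivative w' x) (at x)"
      using x by (subst (asm) at_within_interior) (auto simp: I)
    then show "(W has_real_derivative w x) (at x)"
      using x by (simp add: has_real_derivative_iff_has_vector_derivative w'_def)
  next
    fix C \<theta> \<theta>' x
    assume x: "x \<in> Iphi" and le: "\<And>x. x \<in> Iphi \<Longrightarrow> \<bar>w x\<bar> \<le> C * \<theta>' x"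
      and ends: "C * \<theta>' (- (pi / sqrt 2)) \<ge> 0" "C * \<theta>' (pi / sqrt 2) \<ge> 0"
      and \<theta>: "\<And>x. (\<theta> has_real_derivative \<theta>' x) (at x)"
    \<comment> \<open>At the two endpoints \<open>w'\<close> is 0, and the sign conditions on
      \<open>\<theta>'\<close> there extend the majorant to the closed interval.\<close>
    have le': "\<bar>w' t\<bar> \<le> C * \<theta>' t" if t: "t \<in> {a..b}" for t
    proof -
      consider "t \<in> Iphi" | "t = a" | "t = b" using t by (auto simp: I order_less_le)
      then show ?thesis using le ends by cases (auto simp: w'_def a_def b_def I)
    qed
    have ftc: "((\<lambda>t. C * \<theta>' t) has_integral C * (\<theta> d - \<theta> c)) {c..d}" if "c \<le> d" for c d
      using that \<theta>
      by (intro has_integral_mult_right fundamental_theorem_of_calculus)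
        (auto simp: has_real_derivative_iff_has_vector_derivative[symmetric] intro: has_field_derivative_at_within)
    have *: "\<bar>integral {c..d} w'\<bar> \<le> C * (\<theta> d - \<theta> c)" if "a \<le> c" "c \<le> d" "d \<le> b" for c d
    proof -
      have "\<bar>integral {c..d} w'\<bar> \<le> integral {c..d} (\<lambda>t. C * \<theta>' t)"
        using integral_norm_bound_integral[OF integrable_subinterval_real[OF w'_on]
            has_integral_integrable[OF ftc[OF that(2)]]] le' that by simp
      then show ?thesis unfolding integral_unique[OF ftc[OF that(2)]] .
    qed
    have "integral {a..x} w' + integral {x..b} w' = 0"
      using x Henstock_Kurzweil_Integration.integral_combine[of a x b w'] w'_on integral_unique[OF w'_int]
      by (simp add: I)
    then have "\<bar>W x\<bar> = \<bar>integral {x..b} w'\<bar>" by (simp add: W_def)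
    moreover have "\<bar>W x\<bar> \<le> C * (\<theta> x - \<theta> a)" unfolding W_def using x by (intro *) (auto simp: I)
    moreover have "\<bar>integral {x..b} w'\<bar> \<le> C * (\<theta> b - \<theta> x)" using x by (intro *) (auto simp: I)
    ultimately show "\<bar>W x\<bar> \<le> C * (\<theta> x - \<theta> (- (pi / sqrt 2))) \<and> \<bar>W x\<bar> \<le> C * (\<theta> (pi / sqrt 2) - \<theta> x)"
      by (simp add: a_def b_def)
  qed
qed

text \<open>Up to \<open>pi / 3\<close> the mean value theorem gives slope at least 1/2; beyond it
  the sine is at least 1/2, while \<open>t / 4\<close> is at most \<open>pi / 8\<close>.\<close>

lemma sin_ge_quarter: assumes "0 \<le> t" "t \<le> pi / 2" shows "t / 4 \<le> sin t"
proof (cases "t \<le> pi / 3")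
  case True
  have "\<exists>z. 0 < z \<and> z < t \<and> sin t - sin 0 = (t - 0) * cos z" if "0 < t"
    using that by (intro MVT2) auto
  then show ?thesis
  proof (cases "t = 0")
    case False
    then obtain z where z: "0 < z" "z < t" "sin t = t * cos z"
      using assms \<open>0 < t \<Longrightarrow> _\<close> by auto
    have "1 / 2 \<le> cos z"
      using cos_monotone_0_pi_le[of z "pi/3"] z True by (simp add: cos_60)
    then have "t * (1/2) \<le> t * cos z" using assms by (intro mult_left_mono)
    then show ?thesis using z assms by linarith
  qed auto
next
  case False
  have "sin (pi / 6) \<le> sin t" using False assms by (intro sin_monotone_2pi_le) auto
  then show ?thesis using assms pi_less_4 by (simp add: sin_30)
qed

text \<open>Zeros of \<open>phi01\<close> at the endpoints are only of first order, so a function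
  that vanishes linearly there may be divided by it.\<close>

lemma phi01_lower: assumes "x \<in> Iphi"
  shows "0 \<le> x \<Longrightarrow> pi / sqrt 2 - x \<le> 4 * phi01 x" and "x \<le> 0 \<Longrightarrow> x + pi / sqrt 2 \<le> 4 * phi01 x"
proof -
  have *: "pi / sqrt 2 - y \<le> 4 * phi01 y" if y: "y \<in> Iphi" "0 \<le> y" for y
  proof -
    define t where "t = pi / 2 - y / sqrt 2"
    have "t / 4 \<le> sin t" using Iphi_angle[OF y(1)] y(2) by (intro sin_ge_quarter) (auto simp: t_def)
    also have "sin t = cos (y / sqrt 2)" by (simp add: t_def sin_diff)
    finally have "sqrt 2 * t \<le> sqrt 2 * (4 * cos (y / sqrt 2))" by (intro mult_left_mono) auto
    moreover have "sqrt 2 * t = pi / sqrt 2 - y"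
      by (simp add: t_def right_diff_distrib sqrt2_half)
    ultimately show ?thesis by (simp add: phi01_def)
  qed
  show "0 \<le> x \<Longrightarrow> pi / sqrt 2 - x \<le> 4 * phi01 x" using * assms by blast
  show "x \<le> 0 \<Longrightarrow> x + pi / sqrt 2 \<le> 4 * phi01 x"
    using *[of "- x"] assms by (auto simp: Iphi_def phi01_def)
qed

text \<open>In divergence form the equations are \<open>(phi\<^sup>2 g)' = - phi u\<close> and
  \<open>(phi h)' = - g\<close>. The first has a bounded solution because \<open>phi u\<close> has
  mean zero. The second needs mean zero of \<open>g\<close>, and
  \<open><u, dphi> = <g, A dphi>\<close> with \<open>A dphi = -1\<close> reduces this to the second
  orthogonality.\<close>

lemma chain_exists:
  assumes u: "cb u" and o: "(LINT x|Mphi. u x * phi01 x) = 0" "(LINT x|Mphi. u x * dphi x) = 0"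
  obtains g h where "chain u g h"
proof -
  define b :: real where "b = pi / sqrt 2"
  have [intro]: "cb u" by fact
  have "cb (\<lambda>x. u x * phi01 x)" by auto
  from cb_antiderivative[OF this o(1)] obtain U where
    U: "\<And>x. x \<in> Iphi \<Longrightarrow> (U has_real_derivative u x * phi01 x) (at x)"
    and U_le: "\<And>C \<theta> \<theta>' x. x \<in> Iphi \<Longrightarrow> (\<And>x. x \<in> Iphi \<Longrightarrow> \<bar>u x * phi01 x\<bar> \<le> C * \<theta>' x) \<Longrightarrow>
      C * \<theta>' (- b) \<ge> 0 \<Longrightarrow> C * \<theta>' b \<ge> 0 \<Longrightarrow> (\<And>x. (\<theta> has_real_derivative \<theta>' x) (at x)) \<Longrightarrow>
      \<bar>U x\<bar> \<le> C * (\<theta> x - \<theta> (- b)) \<and> \<bar>U x\<bar> \<le> C * (\<theta> b - \<theta> x)"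
    unfolding b_def by blast
  obtain C where C: "C > 0" "\<And>x. x \<in> Iphi \<Longrightarrow> \<bar>u x\<bar> \<le> C" using u by (metis cbE)
  have sb: "sin (b / sqrt 2) = 1" "sin (- (b / sqrt 2)) = -1" by (simp_all add: b_def)
  have U_bound: "\<bar>U x\<bar> \<le> C * (phi01 x * phi01 x)" if x: "x \<in> Iphi" for x
  proof -
    \<comment> \<open>The majorant \<open>phi01\<close> has the antiderivative
      \<open>- 2 * dphi\<close>, whose distance to its endpoint values is of the order of
      \<open>phi01\<^sup>2\<close>. Hence \<open>U\<close> vanishes quadratically and the quotient
      \<open>g\<close> is bounded.\<close>
    have "\<bar>U x\<bar> \<le> C * (- 2 * dphi x - (- 2 * dphi (- b))) \<and> \<bar>U x\<bar> \<le> C * (- 2 * dphi b - (- 2 * dphi x))"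
    proof (rule U_le[OF x, where \<theta>' = phi01])
      fix x assume "x \<in> Iphi"
      then show "\<bar>u x * phi01 x\<bar> \<le> C * phi01 x"
        using C(2) phi01_pos[of x] by (auto simp: abs_mult intro!: mult_right_mono)
    next
      fix x show "((\<lambda>x. - 2 * dphi x) has_real_derivative phi01 x) (at x)"
        by (auto intro!: derivative_eq_intros DERIV_dphi)
    qed (auto simp: b_def phi01_endpoint)
    then have "\<bar>U x\<bar> \<le> C * (2 * (1 - dphi x)) \<and> \<bar>U x\<bar> \<le> C * (2 * (1 + dphi x))"
      using sb by (simp add: dphi_def algebra_simps)
    moreover have "min (2 * (1 - dphi x)) (2 * (1 + dphi x)) \<le> phi01 x * phi01 x"
    proof -
      have s: "- 1 \<le> dphi x" "dphi x \<le> 1" by (auto simp: dphi_def)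
      have "phi01 x * phi01 x = 2 * (1 - dphi x) * (1 + dphi x)"
        unfolding phi01_dphi by (simp add: algebra_simps)
      moreover have "2 * (1 - dphi x) * 1 \<le> 2 * (1 - dphi x) * (1 + dphi x)" if "0 \<le> dphi x"
        using that s by (intro mult_left_mono) auto
      moreover have "1 * (2 * (1 + dphi x)) \<le> (1 - dphi x) * (2 * (1 + dphi x))" if "dphi x \<le> 0"
        using that s by (intro mult_right_mono) auto
      ultimately show ?thesis by (cases "0 \<le> dphi x") (auto simp: algebra_simps min_le_iff_disj)
    qed
    ultimately show ?thesis
      using C(1) by (auto simp: min_le_iff_disj intro: order_trans mult_left_mono)
  qed
  define g where "g x = - U x / (phi01 x * phi01 x)" for x
  have g_deriv: "(g has_real_derivative - (u x + 2 * dphi x * g x) / phi01 x) (at x)" if x: "x \<in> Iphi" for x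
    unfolding g_def[abs_def] using x
    by (auto intro!: derivative_eq_intros U DERIV_phi01 simp: phi01_nz field_simps g_def)
  have [intro]: "cb g"
  proof (rule cbI)
    show "continuous_on Iphi g"
      using g_deriv by (intro continuous_at_imp_continuous_on ballI) (auto intro: DERIV_isCont)
    fix x assume x: "x \<in> Iphi"
    then show "\<bar>g x\<bar> \<le> C"
      using U_bound[OF x] phi01_pos[OF x] by (simp add: g_def abs_mult pos_divide_le_eq)
  qed
  have "(LINT x|Mphi. u x * dphi x + g x) = 0"
  proof (rule integral_phi_mult_deriv[where k = "\<lambda>x. - (dphi x * g x)"])
    fix x assume x: "x \<in> Iphi"
    show "((\<lambda>x. - (dphi x * g x)) has_real_derivative
       (phi01 x * phi01 x * g x / 2 + dphi x * (u x + 2 * dphi x * g x)) / phi01 x) (at x)"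
      using x by (auto intro!: derivative_eq_intros DERIV_dphi g_deriv simp: phi01_nz field_simps)
    have "u x * dphi x + g x = dphi x * - (dphi x * g x) + (phi01 x * phi01 x * g x / 2 + dphi x * (u x + 2 * dphi x * g x))"
      unfolding phi01_dphi by (simp add: field_simps)
    then show "u x * dphi x + g x = dphi x * - (dphi x * g x) +
        phi01 x * ((phi01 x * phi01 x * g x / 2 + dphi x * (u x + 2 * dphi x * g x)) / phi01 x)"
      using x by (simp add: phi01_nz)
  qed auto
  then have g0: "(LINT x|Mphi. g x) = 0"
    using o(2) by (subst (asm) Bochner_Integration.integral_add) (auto intro!: cb_integrable)
  from cb_antiderivative[OF \<open>cb g\<close> g0] obtain G where
    G: "\<And>x. x \<in> Iphi \<Longrightarrow> (G has_real_derivative g x) (at x)"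
    and G_le: "\<And>C \<theta> \<theta>' x. x \<in> Iphi \<Longrightarrow> (\<And>x. x \<in> Iphi \<Longrightarrow> \<bar>g x\<bar> \<le> C * \<theta>' x) \<Longrightarrow>
      C * \<theta>' (- b) \<ge> 0 \<Longrightarrow> C * \<theta>' b \<ge> 0 \<Longrightarrow> (\<And>x. (\<theta> has_real_derivative \<theta>' x) (at x)) \<Longrightarrow>
      \<bar>G x\<bar> \<le> C * (\<theta> x - \<theta> (- b)) \<and> \<bar>G x\<bar> \<le> C * (\<theta> b - \<theta> x)"
    unfolding b_def by blast
  obtain D where D: "D > 0" "\<And>x. x \<in> Iphi \<Longrightarrow> \<bar>g x\<bar> \<le> D" using \<open>cb g\<close> by (metis cbE)
  have G_bound: "\<bar>G x\<bar> \<le> 4 * D * phi01 x" if x: "x \<in> Iphi" for x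
  proof -
    have "\<bar>G x\<bar> \<le> D * (x - (- b)) \<and> \<bar>G x\<bar> \<le> D * (b - x)"
      using D by (intro G_le[OF x, where \<theta>' = "\<lambda>x. 1"]) auto
    moreover have "b - x \<le> 4 * phi01 x \<or> x - (- b) \<le> 4 * phi01 x"
      using phi01_lower[OF x] by (cases "0 \<le> x") (auto simp: b_def)
    ultimately have "\<bar>G x\<bar> \<le> D * (4 * phi01 x)"
      using D(1) by (meson less_imp_le mult_left_mono order_trans)
    then show ?thesis by (simp add: mult.assoc mult.left_commute)
  qed
  define h where "h x = - G x / phi01 x" for x
  have h_deriv: "(h has_real_derivative - (g x + dphi x * h x) / phi01 x) (at x)" if x: "x \<in> Iphi" for x
    unfolding h_def[abs_def] using x
    by (auto intro!: derivative_eq_intros G DERIV_phi01 simp: phi01_nz field_simps h_def)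
  have "cb h"
  proof (rule cbI)
    show "continuous_on Iphi h"
      using h_deriv by (intro continuous_at_imp_continuous_on ballI) (auto intro: DERIV_isCont)
    fix x assume x: "x \<in> Iphi"
    then show "\<bar>h x\<bar> \<le> 4 * D"
      using G_bound[OF x] phi01_pos[OF x] by (simp add: h_def pos_divide_le_eq)
  qed
  then have "chain u g h" using g_deriv h_deriv by (auto simp: chain_def)
  then show thesis by (rule that)
qed

section \<open>Smooth functions and test functions\<close>

text \<open>Existence of \<open>n\<close> derivatives at the points of \<open>S\<close>, in the
  iterated form used by \<open>test_functions\<close>. Finite orders are kept apart because the
  closure rules are proved by induction on \<open>n\<close>, applying the rule of order
  \<open>n\<close> to the derivative.\<close>

definition sm :: "nat \<Rightarrow> real set \<Rightarrow> (real \<Rightarrow> 'b::real_normed_vector) \<Rightarrow> bool" where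
  "sm n S f \<longleftrightarrow> (\<forall>k<n. \<forall>x\<in>S. (vderiv ^^ k) f differentiable (at x))"

definition smooth_on :: "real set \<Rightarrow> (real \<Rightarrow> 'b::real_normed_vector) \<Rightarrow> bool" where
  "smooth_on S f \<longleftrightarrow> (\<forall>n. sm n S f)"

lemma sm_0 [simp]: "sm 0 S f"
  by (simp add: sm_def)

lemma sm_subset: "sm n S f \<Longrightarrow> T \<subseteq> S \<Longrightarrow> sm n T f"
  by (auto simp: sm_def)

lemma sm_Un: "sm n S f \<Longrightarrow> sm n T f \<Longrightarrow> sm n (S \<union> T) f"
  by (auto simp: sm_def)

lemma sm_Suc: "sm (Suc n) S f \<longleftrightarrow> (\<forall>x\<in>S. f differentiable (at x)) \<and> sm n S (vderiv f)"
  by (auto simp: sm_def All_less_Suc2 funpow_Suc_right simp del: funpow.simps(2))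

lemma sm_SucD: "sm (Suc n) S f \<Longrightarrow> sm n S f"
  by (auto simp: sm_def)

lemma sm_has_vderiv: "sm (Suc n) S f \<Longrightarrow> x \<in> S \<Longrightarrow> (f has_vector_derivative vderiv f x) (at x)"
  unfolding vderiv_def by (subst vector_derivative_works[symmetric]) (simp add: sm_Suc)

lemma vderivI: "(f has_vector_derivative f') (at x) \<Longrightarrow> vderiv f x = f'"
  by (simp add: vderiv_def vector_derivative_at)

lemma has_vector_derivative_cong_open:
  assumes "open S" "x \<in> S" "\<And>y. y \<in> S \<Longrightarrow> f y = g y"
  shows "(f has_vector_derivative D) (at x) \<longleftrightarrow> (g has_vector_derivative D) (at x)"
  using has_vector_derivative_transform_within_open[OF _ assms(1,2), of f D g]
    has_vector_derivative_transform_within_open[OF _ assms(1,2), of g D f] assms(3)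
  by auto

lemma differentiable_vector: "f differentiable (at x) \<longleftrightarrow> (\<exists>D. (f has_vector_derivative D) (at (x::real)))"
  by (metis differentiableI_vector vector_derivative_works)

lemma sm_cong:
  assumes "open S" "\<And>x. x \<in> S \<Longrightarrow> f x = g x" "sm n S f"
  shows "sm n S g"
  using assms(2,3)
proof (induction n arbitrary: f g)
  case (Suc n)
  have eq: "(f has_vector_derivative D) (at x) \<longleftrightarrow> (g has_vector_derivative D) (at x)" if "x \<in> S" for x D
    using has_vector_derivative_cong_open[of S x f g, OF assms(1) that Suc.prems(1)] by blast
  have "vderiv f x = vderiv g x" if "x \<in> S" for x
    using eq[OF that] sm_has_vderiv[OF Suc.prems(2) that] by (metis vderivI)
  then have "sm n S (vderiv g)" using Suc.IH[of "vderiv f" "vderiv g"] Suc.prems(2) by (simp add: sm_Suc)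
  then show ?case using Suc.prems(2) eq by (auto simp: sm_Suc differentiable_vector)
qed simp

lemma sm_SucI:
  assumes "open S" "\<And>x. x \<in> S \<Longrightarrow> (f has_vector_derivative f' x) (at x)" "sm n S f'"
  shows "sm (Suc n) S f"
proof -
  have "sm n S (vderiv f)"
    by (rule sm_cong[OF assms(1) _ assms(3)]) (simp add: vderivI[OF assms(2)])
  then show ?thesis using assms(2) by (auto simp: sm_Suc differentiable_vector)
qed

lemma sm_const: "open S \<Longrightarrow> sm n S (\<lambda>x. c)"
proof (induction n arbitrary: c)
  case (Suc n)
  show ?case by (rule sm_SucI[OF Suc.prems _ Suc.IH[OF Suc.prems, of 0]]) (auto intro: derivative_eq_intros)
qed simp

lemma sm_ident: "open S \<Longrightarrow> sm n S (\<lambda>x::real. x)"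
  by (cases n) (auto intro!: sm_SucI[where f' = "\<lambda>x. 1"] sm_const derivative_eq_intros)

lemma sm_add:
  assumes "open S" "sm n S f" "sm n S g" shows "sm n S (\<lambda>x. f x + g x)"
  using assms(2,3)
proof (induction n arbitrary: f g)
  case (Suc n)
  then have "sm n S (\<lambda>x. vderiv f x + vderiv g x)" by (simp add: sm_Suc)
  then show ?case
    by (rule sm_SucI[OF assms(1), rotated])
      (intro has_vector_derivative_add sm_has_vderiv[OF Suc.prems(1)] sm_has_vderiv[OF Suc.prems(2)])
qed simp

lemma sm_linear:
  assumes "open S" "bounded_linear T" "sm n S f" shows "sm n S (\<lambda>x. T (f x))"
  using assms(3)
proof (induction n arbitrary: f)
  case (Suc n)
  then have "sm n S (\<lambda>x. T (vderiv f x))" by (simp add: sm_Suc)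
  then show ?case
    by (rule sm_SucI[OF assms(1), rotated])
      (intro bounded_linear.has_vector_derivative[OF assms(2)] sm_has_vderiv[OF Suc.prems])
qed simp

lemma sm_bilinear:
  assumes "open S" "bounded_bilinear T" "sm n S f" "sm n S g" shows "sm n S (\<lambda>x. T (f x) (g x))"
  using assms(3,4)
proof (induction n arbitrary: f g)
  case (Suc n)
  have f: "sm n S f" "sm n S (vderiv f)" and g: "sm n S g" "sm n S (vderiv g)"
    using Suc.prems sm_SucD by (auto simp: sm_Suc)
  have "sm n S (\<lambda>x. T (f x) (vderiv g x) + T (vderiv f x) (g x))"
    by (intro sm_add assms(1) Suc.IH f g)
  then show ?case
    by (rule sm_SucI[OF assms(1), rotated])
      (intro bounded_bilinear.has_vector_derivative[OF assms(2)] sm_has_vderiv[OF Suc.prems(1)] sm_has_vderiv[OF Suc.prems(2)])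
qed simp

lemmas sm_mult = sm_bilinear[OF _ bounded_bilinear_mult]
lemmas sm_scaleR = sm_bilinear[OF _ bounded_bilinear_scaleR]
lemmas sm_minus = sm_linear[OF _ bounded_linear_minus[OF bounded_linear_ident]]
lemmas sm_of_real = sm_linear[OF _ bounded_linear_of_real]

lemma sm_diff:
  "open S \<Longrightarrow> sm n S f \<Longrightarrow> sm n S g \<Longrightarrow> sm n S (\<lambda>x. f x - g x)"
  using sm_add[of S n f "\<lambda>x. - g x"] sm_minus[of S n g] by simp

lemma sm_inverse:
  fixes f :: "real \<Rightarrow> real"
  assumes "open S" "sm n S f" "\<And>x. x \<in> S \<Longrightarrow> f x \<noteq> 0" shows "sm n S (\<lambda>x. inverse (f x))"
  using assms(2)
proof (induction n)
  case (Suc n)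
  have "sm n S (\<lambda>x. inverse (f x))" "sm n S (vderiv f)"
    using Suc sm_SucD[OF Suc.prems] by (auto simp: sm_Suc)
  then have "sm n S (\<lambda>x. - (inverse (f x) * vderiv f x * inverse (f x)))"
    by (intro sm_minus sm_mult assms(1))
  moreover have "((\<lambda>x. inverse (f x)) has_vector_derivative - (inverse (f x) * vderiv f x * inverse (f x))) (at x)"
    if "x \<in> S" for x
    using sm_has_vderiv[OF Suc.prems that] assms(3)[OF that]
    by (auto simp: has_real_derivative_iff_has_vector_derivative[symmetric] intro!: derivative_eq_intros)
  ultimately show ?case by (intro sm_SucI[OF assms(1)])
qed simp

text \<open>Bootstrapping: as soon as \<open>f\<close> has \<open>n\<close> derivatives, so has
  \<open>q * f\<close>, which is its derivative. The oscillating factor of the singular sequences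
  becomes smooth in this way, without iterated derivatives of roots and exponentials.\<close>

lemma sm_linear_ode:
  fixes f q :: "real \<Rightarrow> 'b::real_normed_algebra"
  assumes "open S" "sm n S q" "\<And>x. x \<in> S \<Longrightarrow> (f has_vector_derivative q x * f x) (at x)"
  shows "sm n S f"
  using assms(2)
proof (induction n)
  case (Suc n)
  then have "sm n S (\<lambda>x. q x * f x)"
    by (intro sm_mult assms(1)) (auto dest: sm_SucD)
  then show ?case by (intro sm_SucI[OF assms(1,3)])
qed simp

lemma sm_compose:
  assumes "open S" "sm n UNIV f" "sm n S g" shows "sm n S (\<lambda>x. f (g x))"
  using assms(2,3)
proof (induction n arbitrary: f)
  case (Suc n)
  have "sm n S (\<lambda>x. vderiv g x *\<^sub>R vderiv f (g x))"
    using Suc.prems sm_SucD[OF Suc.prems(2)] by (intro sm_scaleR assms(1) Suc.IH) (auto simp: sm_Suc)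
  moreover have "((\<lambda>x. f (g x)) has_vector_derivative vderiv g x *\<^sub>R vderiv f (g x)) (at x)" if "x \<in> S" for x
    using vector_diff_chain_at[OF sm_has_vderiv[OF Suc.prems(2) that] sm_has_vderiv[OF Suc.prems(1)]]
    by (simp add: o_def)
  ultimately show ?case by (intro sm_SucI[OF assms(1)])
qed simp

lemma smooth_onD: "smooth_on S f \<Longrightarrow> sm n S f"
  by (simp add: smooth_on_def)

lemma smooth_on_has_vderiv: "smooth_on S f \<Longrightarrow> x \<in> S \<Longrightarrow> (f has_vector_derivative vderiv f x) (at x)"
  by (rule sm_has_vderiv[OF smooth_onD[of _ _ "Suc 0"]])

lemma smooth_on_vderiv: "smooth_on S f \<Longrightarrow> smooth_on S (vderiv f)"
  by (metis sm_Suc smooth_on_def)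

lemma smooth_on_cong:
  "open S \<Longrightarrow> (\<And>x. x \<in> S \<Longrightarrow> f x = g x) \<Longrightarrow> smooth_on S f \<Longrightarrow> smooth_on S g"
  unfolding smooth_on_def using sm_cong by blast

lemma smooth_onI_deriv:
  assumes "open S" "\<And>x. x \<in> S \<Longrightarrow> (f has_vector_derivative f' x) (at x)" "smooth_on S f'"
  shows "smooth_on S f"
proof -
  have "sm n S f" for n
    using sm_SucI[OF assms(1,2) smooth_onD[OF assms(3)]] by (rule sm_SucD)
  then show ?thesis by (simp add: smooth_on_def)
qed

named_theorems smooth_intros

lemma smooth_on_const [smooth_intros]: "open S \<Longrightarrow> smooth_on S (\<lambda>x. c)"
  and smooth_on_ident [smooth_intros]: "open S \<Longrightarrow> smooth_on S (\<lambda>x. x)"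
  and smooth_on_add [smooth_intros]: "open S \<Longrightarrow> smooth_on S f \<Longrightarrow> smooth_on S g \<Longrightarrow> smooth_on S (\<lambda>x. f x + g x)"
  and smooth_on_diff [smooth_intros]: "open S \<Longrightarrow> smooth_on S f \<Longrightarrow> smooth_on S g \<Longrightarrow> smooth_on S (\<lambda>x. f x - g x)"
  and smooth_on_minus [smooth_intros]: "open S \<Longrightarrow> smooth_on S f \<Longrightarrow> smooth_on S (\<lambda>x. - f x)"
  by (auto simp: smooth_on_def intro: sm_const sm_ident sm_add sm_diff sm_minus)

lemma smooth_on_mult [smooth_intros]:
  fixes f g :: "real \<Rightarrow> 'b::real_normed_algebra"
  shows "open S \<Longrightarrow> smooth_on S f \<Longrightarrow> smooth_on S g \<Longrightarrow> smooth_on S (\<lambda>x. f x * g x)"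
  by (auto simp: smooth_on_def intro: sm_mult)

lemma smooth_on_of_real [smooth_intros]:
  fixes f :: "real \<Rightarrow> real"
  shows "open S \<Longrightarrow> smooth_on S f \<Longrightarrow> smooth_on S (\<lambda>x. of_real (f x) :: 'b::{real_normed_algebra_1})"
  by (auto simp: smooth_on_def intro: sm_of_real)

lemma smooth_on_inverse [smooth_intros]:
  fixes f :: "real \<Rightarrow> real"
  shows "open S \<Longrightarrow> smooth_on S f \<Longrightarrow> (\<And>x. x \<in> S \<Longrightarrow> f x \<noteq> 0) \<Longrightarrow> smooth_on S (\<lambda>x. inverse (f x))"
  by (auto simp: smooth_on_def intro: sm_inverse)

lemma smooth_on_power [smooth_intros]:
  fixes f :: "real \<Rightarrow> 'b::real_normed_algebra_1"
  shows "open S \<Longrightarrow> smooth_on S f \<Longrightarrow> smooth_on S (\<lambda>x. f x ^ m)"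
  by (induction m) (auto intro!: smooth_intros)

lemma smooth_on_compose:
  "open S \<Longrightarrow> smooth_on UNIV f \<Longrightarrow> smooth_on S g \<Longrightarrow> smooth_on S (\<lambda>x. f (g x))"
  by (auto simp: smooth_on_def intro: sm_compose)

lemma smooth_on_linear_ode:
  fixes f q :: "real \<Rightarrow> 'b::real_normed_algebra"
  shows "open S \<Longrightarrow> smooth_on S q \<Longrightarrow> (\<And>x. x \<in> S \<Longrightarrow> (f has_vector_derivative q x * f x) (at x)) \<Longrightarrow> smooth_on S f"
  by (auto simp: smooth_on_def intro: sm_linear_ode)

lemma smooth_on_subset: "smooth_on S f \<Longrightarrow> T \<subseteq> S \<Longrightarrow> smooth_on T f"
  by (auto simp: smooth_on_def intro: sm_subset)

lemma smooth_on_continuous: "smooth_on S f \<Longrightarrow> continuous_on S f"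
  by (auto intro!: continuous_at_imp_continuous_on dest!: smooth_on_has_vderiv has_vector_derivative_continuous)

lemma sm_phi: "sm n UNIV phi01 \<and> sm n UNIV dphi"
proof (induction n)
  case (Suc n)
  have "sm n UNIV (\<lambda>x. - phi01 x * (1 / 2))"
    using Suc by (intro sm_mult sm_minus sm_const) auto
  then have "sm (Suc n) UNIV dphi"
    by (rule sm_SucI[rotated 2]) (auto simp: has_real_derivative_iff_has_vector_derivative[symmetric] intro!: derivative_eq_intros DERIV_dphi)
  moreover have "sm (Suc n) UNIV phi01"
    using Suc by (intro sm_SucI[where f' = dphi]) (auto simp: has_real_derivative_iff_has_vector_derivative[symmetric] intro!: DERIV_phi01)
  ultimately show ?case by simp
qed simp

lemma smooth_on_phi01 [smooth_intros]: "smooth_on S phi01"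
  and smooth_on_dphi [smooth_intros]: "smooth_on S dphi"
  using sm_phi by (auto simp: smooth_on_def intro: sm_subset)

section \<open>Smooth functions vanishing to infinite order\<close>

text \<open>The extra power of \<open>1 / t\<close> makes the family closed under differentiation up
  to linear combinations, so one induction proves smoothness for all \<open>k\<close>
  simultaneously.\<close>

definition flat :: "nat \<Rightarrow> real \<Rightarrow> real" where
  "flat k t = (if t > 0 then exp (- inverse t) * inverse t ^ k else 0)"

lemma flat_tendsto_0: "(flat k \<longlongrightarrow> 0) (at 0)"
proof -
  have "((\<lambda>s::real. s ^ k / exp s) \<longlongrightarrow> 0) at_top"
    by (rule tendsto_power_div_exp_0)
  then have "((\<lambda>t::real. inverse t ^ k / exp (inverse t)) \<longlongrightarrow> 0) (at_right 0)"
    by (rule filterlim_compose[OF _ filterlim_inverse_at_top_right])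
  then have "(flat k \<longlongrightarrow> 0) (at_right 0)"
    by (rule Lim_transform_eventually)
      (auto simp: flat_def exp_minus divide_inverse mult.commute eventually_at_right_field intro!: exI[of _ 1])
  moreover have "(flat k \<longlongrightarrow> 0) (at_left 0)"
    by (rule tendsto_eventually) (auto simp: flat_def eventually_at_left_field intro!: exI[of _ "-1"])
  ultimately show ?thesis by (simp add: filterlim_split_at)
qed

lemma DERIV_flat: "(flat k has_real_derivative flat (k + 2) t - real k * flat (Suc k) t) (at t)"
proof -
  consider "t > 0" | "t < 0" | "t = 0" by linarith
  then show ?thesis
  proof cases
    case 1
    have "((\<lambda>t. exp (- inverse t) * inverse t ^ k) has_real_derivative flat (k + 2) t - real k * flat (Suc k) t) (at t)"
    proof -
      have "((\<lambda>t. exp (- inverse t)) has_real_derivative exp (- inverse t) * (inverse t * inverse t)) (at t)"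
        using 1 by (auto intro!: derivative_eq_intros)
      moreover have "((\<lambda>t. inverse t ^ k) has_real_derivative - real k * inverse t ^ Suc k) (at t)"
        by (rule DERIV_cong[OF DERIV_power[OF DERIV_inverse]]) (use 1 in \<open>simp, cases k, simp_all add: algebra_simps\<close>)
      ultimately show ?thesis
        by (rule DERIV_cong[OF DERIV_mult]) (use 1 in \<open>simp add: flat_def algebra_simps\<close>)
    qed
    moreover have "eventually (\<lambda>s. s \<in> {0<..}) (nhds t)"
      using 1 by (intro eventually_nhds_in_open) auto
    ultimately show ?thesis
      by (subst DERIV_cong_ev[OF refl _ refl]) (auto simp: flat_def elim: eventually_mono)
  next
    case 2
    have "((\<lambda>t. 0) has_real_derivative flat (k + 2) t - real k * flat (Suc k) t) (at t)"
      using 2 by (simp add: flat_def)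
    moreover have "eventually (\<lambda>s. s \<in> {..<0}) (nhds t)"
      using 2 by (intro eventually_nhds_in_open) auto
    ultimately show ?thesis
      by (subst DERIV_cong_ev[OF refl _ refl]) (auto simp: flat_def elim: eventually_mono)
  next
    case 3
    \<comment> \<open>Away from 0, the difference quotient of \<open>flat k\<close> at 0 is
      \<open>flat (Suc k)\<close>.\<close>
    have "((\<lambda>h. (flat k (0 + h) - flat k 0) / h) \<longlongrightarrow> 0) (at 0)"
      by (rule Lim_transform_eventually[OF flat_tendsto_0[of "Suc k"]])
        (auto simp: flat_def eventually_at_filter divide_inverse)
    then show ?thesis using 3 by (simp add: DERIV_def flat_def)
  qed
qed

lemma smooth_on_flat: "smooth_on UNIV (flat k)"
proof -
  have "sm n UNIV (flat k)" for n
  proof (induction n arbitrary: k)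
    case (Suc n)
    have "sm n UNIV (\<lambda>t. flat (k + 2) t - real k * flat (Suc k) t)"
      by (intro sm_diff sm_mult sm_const Suc.IH) auto
    then show ?case
      by (rule sm_SucI[rotated 2]) (auto simp: has_real_derivative_iff_has_vector_derivative[symmetric] intro!: DERIV_flat[simplified])
  qed simp
  then show ?thesis by (simp add: smooth_on_def)
qed

section \<open>Test functions on the interval\<close>

lemma Iphi_interval: "c \<in> Iphi \<Longrightarrow> d \<in> Iphi \<Longrightarrow> {c..d} \<subseteq> Iphi"
  by (auto simp: Iphi_def)

lemma zero_in_Iphi [simp]: "0 \<in> Iphi"
  by (simp add: Iphi_def)

lemma test_functionsE:
  assumes "f \<in> test_functions Iphi"
  obtains c d where "c \<in> Iphi" "d \<in> Iphi" "c \<le> d" "\<And>x. x \<notin> {c..d} \<Longrightarrow> f x = 0" "smooth_on UNIV f"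
proof -
  \<comment> \<open>Inserting 0 keeps \<open>K\<close> nonempty when \<open>f\<close> is the zero
    function.\<close>
  define K where "K = insert 0 (closure {x. f x \<noteq> 0})"
  have K: "compact K" "K \<noteq> {}" "K \<subseteq> Iphi"
    using assms by (auto simp: K_def test_functions_def)
  obtain c where c: "c \<in> K" "\<And>x. x \<in> K \<Longrightarrow> c \<le> x" using compact_attains_inf[OF K(1,2)] by blast
  obtain d where d: "d \<in> K" "\<And>x. x \<in> K \<Longrightarrow> x \<le> d" using compact_attains_sup[OF K(1,2)] by blast
  have "f x = 0" if "x \<notin> {c..d}" for x
    using that c(2)[of x] d(2)[of x] closure_subset[of "{x. f x \<noteq> 0}"] by (auto simp: K_def)
  moreover have "smooth_on UNIV f" using assms by (simp add: test_functions_def smooth_on_def sm_def)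
  ultimately show thesis using c d K(3) by (intro that[of c d]) auto
qed

text \<open>Smoothness needs checking on \<open>Iphi\<close> only: on the open complement of
  \<open>{c..d}\<close> the function is 0, and these two open sets cover the line.\<close>

lemma test_functionsI:
  assumes "smooth_on Iphi f" "c \<in> Iphi" "d \<in> Iphi" "\<And>x. x \<notin> {c..d} \<Longrightarrow> f x = 0"
  shows "f \<in> test_functions Iphi"
proof -
  have "smooth_on (- {c..d}) f"
    using assms(4) by (intro smooth_on_cong[OF _ _ smooth_on_const[of _ 0]]) auto
  moreover have "UNIV = Iphi \<union> - {c..d}" using Iphi_interval[OF assms(2,3)] by auto
  ultimately have sm: "smooth_on UNIV f" using assms(1) by (metis smooth_on_def sm_Un)
  have cl: "closure {x. f x \<noteq> 0} \<subseteq> {c..d}"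
    using assms(4) by (intro closure_minimal subsetI) (blast, simp)
  then have "compact ({c..d} \<inter> closure {x. f x \<noteq> 0})" by (intro compact_Int_closed) auto
  with cl have "compact (closure {x. f x \<noteq> 0})" by (simp add: Int_absorb1)
  moreover have "\<forall>n x. (vderiv ^^ n) f differentiable at x"
    using sm by (auto simp: smooth_on_def sm_def)
  ultimately show ?thesis
    using cl Iphi_interval[OF assms(2,3)] by (auto simp: test_functions_def)
qed

lemma test_smooth: "f \<in> test_functions Iphi \<Longrightarrow> smooth_on UNIV f"
  by (erule test_functionsE)

lemma test_smooth_Iphi: "f \<in> test_functions Iphi \<Longrightarrow> smooth_on Iphi f"
  using test_smooth smooth_on_subset by blast

lemma test_vderiv: "f \<in> test_functions Iphi \<Longrightarrow> (f has_vector_derivative vderiv f x) (at x)"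
  using test_smooth smooth_on_has_vderiv by blast

lemma test_mult:
  assumes "f \<in> test_functions Iphi" "smooth_on Iphi g"
  shows "(\<lambda>x. g x * f x) \<in> test_functions Iphi"
proof -
  obtain c d where "c \<in> Iphi" "d \<in> Iphi" "\<And>x. x \<notin> {c..d} \<Longrightarrow> f x = 0"
    using assms(1) by (rule test_functionsE) blast
  then show ?thesis
    using assms by (intro test_functionsI[of _ c d] smooth_on_mult) (auto intro: test_smooth_Iphi)
qed

lemma test_scale: "f \<in> test_functions Iphi \<Longrightarrow> (\<lambda>x. c * f x) \<in> test_functions Iphi"
  by (intro test_mult smooth_intros) auto

lemma test_zero: "(\<lambda>x. 0) \<in> test_functions Iphi"
  by (rule test_functionsI[of _ 0 0]) (auto intro: smooth_intros)

lemma test_add: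
  assumes "f \<in> test_functions Iphi" "g \<in> test_functions Iphi"
  shows "(\<lambda>x. f x + g x) \<in> test_functions Iphi"
proof -
  obtain c d where 1: "c \<in> Iphi" "d \<in> Iphi" "\<And>x. x \<notin> {c..d} \<Longrightarrow> f x = 0"
    using assms(1) by (rule test_functionsE) blast
  obtain c' d' where 2: "c' \<in> Iphi" "d' \<in> Iphi" "\<And>x. x \<notin> {c'..d'} \<Longrightarrow> g x = 0"
    using assms(2) by (rule test_functionsE) blast
  have "min c c' \<in> Iphi" "max d d' \<in> Iphi" using 1 2 by (auto simp: min_def max_def)
  moreover have "f x + g x = 0" if "x \<notin> {min c c'..max d d'}" for x
  proof -
    have "x \<notin> {c..d}" "x \<notin> {c'..d'}" using that by auto
    from 1(3)[OF this(1)] 2(3)[OF this(2)] show ?thesis by simp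
  qed
  ultimately show ?thesis
    using assms by (intro test_functionsI[of _ "min c c'" "max d d'"] smooth_on_add) (auto intro: test_smooth_Iphi)
qed

lemma test_vderiv_in:
  assumes "f \<in> test_functions Iphi" shows "vderiv f \<in> test_functions Iphi"
proof -
  obtain c d where f: "c \<in> Iphi" "d \<in> Iphi" "\<And>x. x \<notin> {c..d} \<Longrightarrow> f x = 0"
    using assms(1) by (rule test_functionsE) blast
  have "vderiv f x = 0" if x: "x \<notin> {c..d}" for x
  proof (rule vderivI)
    show "(f has_vector_derivative 0) (at x)"
      using x f(3) has_vector_derivative_cong_open[of "- {c..d}" x f "\<lambda>x. 0" 0] by auto
  qed
  then show ?thesis
    using f assms by (intro test_functionsI[of _ c d]) (auto intro: smooth_on_vderiv test_smooth_Iphi)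
qed

lemma cb_compact_support:
  assumes "continuous_on Iphi f" "c \<in> Iphi" "d \<in> Iphi" "\<And>x. x \<notin> {c..d} \<Longrightarrow> f x = 0"
  shows "cb f"
proof -
  have "compact (f ` {c..d})"
    using assms(1) Iphi_interval[OF assms(2,3)]
    by (intro compact_continuous_image) (auto intro: continuous_on_subset)
  then have "bounded (insert 0 (f ` {c..d}))" by (auto dest: compact_imp_bounded)
  moreover have "f ` Iphi \<subseteq> insert 0 (f ` {c..d})" using assms(4) by blast
  ultimately have "bounded (f ` Iphi)" by (rule bounded_subset)
  then show ?thesis using assms(1) by (simp add: cb_def)
qed

lemma cb_test_mult:
  assumes f: "f \<in> test_functions Iphi" and g: "continuous_on Iphi g"
  shows "cb (\<lambda>x. g x * Re (f x))" "cb (\<lambda>x. g x * Im (f x))"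
proof -
  obtain c d where cd: "c \<in> Iphi" "d \<in> Iphi" "\<And>x. x \<notin> {c..d} \<Longrightarrow> f x = 0"
    using f by (rule test_functionsE) blast
  have "continuous_on Iphi f" using f by (intro smooth_on_continuous test_smooth_Iphi)
  then show "cb (\<lambda>x. g x * Re (f x))" "cb (\<lambda>x. g x * Im (f x))"
    using g by (auto intro!: cb_compact_support[OF _ cd(1,2)] continuous_intros simp del: atLeastAtMost_iff simp: cd(3))
qed

lemma cb_test: "f \<in> test_functions Iphi \<Longrightarrow> cb (\<lambda>x. Re (f x))" "f \<in> test_functions Iphi \<Longrightarrow> cb (\<lambda>x. Im (f x))"
  using cb_test_mult[of f "\<lambda>x. 1"] by (auto intro: continuous_intros)

section \<open>The operator on test functions\<close>

text \<open>By \<open>phi'' = - phi / 2\<close> the coefficient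
  \<open>phi phi'' + 2 phi\<^sup>2\<close> of \<open>w\<close> becomes
  \<open>3/2 phi\<^sup>2\<close>.\<close>

lemma L_expr_eq:
  assumes w: "smooth_on S w" and S: "open S" and x: "x \<in> S"
  shows "L_expr phi01 w x = - ((phi01 x * phi01 x) *\<^sub>R vderiv (vderiv w) x
    + (2 * phi01 x * dphi x) *\<^sub>R vderiv w x + (3 / 2 * (phi01 x * phi01 x)) *\<^sub>R w x)"
proof -
  have 1: "vderiv (\<lambda>y. phi01 y *\<^sub>R w y) y = phi01 y *\<^sub>R vderiv w y + dphi y *\<^sub>R w y" if "y \<in> S" for y
    using smooth_on_has_vderiv[OF w that]
    by (intro vderivI has_vector_derivative_scaleR) (auto intro: DERIV_phi01)
  have 2: "vderiv (vderiv (\<lambda>y. phi01 y *\<^sub>R w y)) x =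
      (phi01 x *\<^sub>R vderiv (vderiv w) x + dphi x *\<^sub>R vderiv w x) + (dphi x *\<^sub>R vderiv w x + (- phi01 x / 2) *\<^sub>R w x)"
  proof (rule vderivI)
    have "((\<lambda>y. phi01 y *\<^sub>R vderiv w y + dphi y *\<^sub>R w y) has_vector_derivative
      (phi01 x *\<^sub>R vderiv (vderiv w) x + dphi x *\<^sub>R vderiv w x) + (dphi x *\<^sub>R vderiv w x + (- phi01 x / 2) *\<^sub>R w x)) (at x)"
      by (intro has_vector_derivative_add has_vector_derivative_scaleR smooth_on_has_vderiv[OF w x]
          smooth_on_has_vderiv[OF smooth_on_vderiv[OF w] x] DERIV_phi01 DERIV_dphi)
    then show "(vderiv (\<lambda>y. phi01 y *\<^sub>R w y) has_vector_derivative
      (phi01 x *\<^sub>R vderiv (vderiv w) x + dphi x *\<^sub>R vderiv w x) + (dphi x *\<^sub>R vderiv w x + (- phi01 x / 2) *\<^sub>R w x)) (at x)"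
      using has_vector_derivative_cong_open[of S x "vderiv (\<lambda>y. phi01 y *\<^sub>R w y)", OF S x 1] by blast
  qed
  show ?thesis unfolding L_expr_def 2 by (simp add: scaleR_conv_of_real algebra_simps)
qed

lemma L_expr_test:
  assumes "w \<in> test_functions Iphi"
  shows "L_expr phi01 w \<in> test_functions Iphi"
proof -
  define F where "F x = (- of_real (phi01 x * phi01 x)) * vderiv (vderiv w) x
    + ((- of_real (2 * phi01 x * dphi x)) * vderiv w x + (- of_real (3 / 2 * (phi01 x * phi01 x))) * w x)" for x
  have "F \<in> test_functions Iphi"
    unfolding F_def using assms by (intro test_add test_mult test_vderiv_in smooth_intros) auto
  moreover have "L_expr phi01 w = F"
    using L_expr_eq[OF test_smooth[OF assms]] by (auto simp: F_def scaleR_conv_of_real)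
  ultimately show ?thesis by simp
qed

section \<open>Complex functions through their real and imaginary parts\<close>

text \<open>The coefficients of \<open>L\<close> are real, so \<open>L u = f\<close> splits into two
  real equations, and the real identities and chains apply to each part.\<close>

definition creg :: "(real \<Rightarrow> complex) \<Rightarrow> (real \<Rightarrow> complex) \<Rightarrow> bool" where
  "creg u f \<longleftrightarrow> (\<exists>y. reg (\<lambda>x. Re (u x)) (\<lambda>x. Re (f x)) y) \<and> (\<exists>y. reg (\<lambda>x. Im (u x)) (\<lambda>x. Im (f x)) y)"

lemma reg_test:
  assumes cb: "cb r" "cb r'" "cb f"
    and d: "\<And>x. x \<in> Iphi \<Longrightarrow> (r has_real_derivative r' x) (at x)" "\<And>x. x \<in> Iphi \<Longrightarrow> (r' has_real_derivative r'' x) (at x)"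
    and f: "\<And>x. x \<in> Iphi \<Longrightarrow> f x = - (phi01 x * phi01 x * r'' x + 2 * phi01 x * dphi x * r' x + 3 / 2 * (phi01 x * phi01 x) * r x)"
  shows "reg r f (\<lambda>x. phi01 x * r' x - dphi x * r x)"
proof -
  have "(r has_real_derivative (phi01 x * r' x - dphi x * r x + dphi x * r x) / phi01 x) (at x)" if "x \<in> Iphi" for x
    using d(1)[OF that] by (rule DERIV_cong) (simp add: phi01_nz[OF that])
  moreover have "((\<lambda>x. phi01 x * r' x - dphi x * r x) has_real_derivative
      - (f x + 2 * r x + 2 * dphi x * (phi01 x * r' x - dphi x * r x)) / phi01 x) (at x)" if x: "x \<in> Iphi" for x
  proof -
    have "((\<lambda>x. phi01 x * r' x - dphi x * r x) has_real_derivative phi01 x * r'' x + phi01 x * r x / 2) (at x)"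
      using d x by (auto intro!: derivative_eq_intros DERIV_phi01 DERIV_dphi)
    moreover have "- (f x + 2 * r x + 2 * dphi x * (phi01 x * r' x - dphi x * r x)) =
      (phi01 x * phi01 x) * r'' x + 3 / 2 * (phi01 x * phi01 x) * r x - (2 - 2 * (dphi x * dphi x)) * r x"
      unfolding f[OF x] by (simp add: algebra_simps)
    then have "- (f x + 2 * r x + 2 * dphi x * (phi01 x * r' x - dphi x * r x)) =
      phi01 x * (phi01 x * r'' x + phi01 x * r x / 2)"
      unfolding phi01_dphi[symmetric] by (simp add: algebra_simps)
    ultimately show ?thesis using x by (simp add: phi01_nz)
  qed
  ultimately show ?thesis using cb by (auto simp: reg_def)
qed

lemma creg_test:
  assumes w: "w \<in> test_functions Iphi"
  shows "creg w (L_expr phi01 w)"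
proof -
  note w' = test_vderiv_in[OF w]
  have D: "((\<lambda>x. Re (f x)) has_real_derivative Re (vderiv f x)) (at x)"
    "((\<lambda>x. Im (f x)) has_real_derivative Im (vderiv f x)) (at x)"
    if "f \<in> test_functions Iphi" for f x
    using test_vderiv[OF that, of x] bounded_linear.has_vector_derivative[OF bounded_linear_Re]
      bounded_linear.has_vector_derivative[OF bounded_linear_Im]
    by (auto simp: has_real_derivative_iff_has_vector_derivative)
  note L = L_expr_eq[OF test_smooth[OF w] open_UNIV UNIV_I]
  have "reg (\<lambda>x. Re (w x)) (\<lambda>x. Re (L_expr phi01 w x)) (\<lambda>x. phi01 x * Re (vderiv w x) - dphi x * Re (w x))"
    by (rule reg_test[OF cb_test(1)[OF w] cb_test(1)[OF w'] cb_test(1)[OF L_expr_test[OF w]] D(1)[OF w] D(1)[OF w']])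
      (simp add: L)
  moreover have "reg (\<lambda>x. Im (w x)) (\<lambda>x. Im (L_expr phi01 w x)) (\<lambda>x. phi01 x * Im (vderiv w x) - dphi x * Im (w x))"
    by (rule reg_test[OF cb_test(2)[OF w] cb_test(2)[OF w'] cb_test(2)[OF L_expr_test[OF w]] D(2)[OF w] D(2)[OF w']])
      (simp add: L)
  ultimately show ?thesis by (auto simp: creg_def)
qed

lemma reg_minus: "reg u f y \<Longrightarrow> reg v g z \<Longrightarrow> reg (\<lambda>x. u x - v x) (\<lambda>x. f x - g x) (\<lambda>x. y x - z x)"
  using reg_add[OF _ reg_scale[of v g z "-1"], of u f y] by simp

lemma creg_add: "creg u f \<Longrightarrow> creg v g \<Longrightarrow> creg (\<lambda>x. u x + v x) (\<lambda>x. f x + g x)"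
  unfolding creg_def by (auto intro: reg_add)

lemma creg_scale: "creg u f \<Longrightarrow> creg (\<lambda>x. c * u x) (\<lambda>x. c * f x)"
  unfolding creg_def by (auto intro!: exI reg_add reg_minus reg_scale)

lemma reg_zero: "reg (\<lambda>x. 0) (\<lambda>x. 0) (\<lambda>x. 0)"
  by (auto simp: reg_def)

lemma creg_of_real: "reg u f y \<Longrightarrow> creg (\<lambda>x. of_real (u x)) (\<lambda>x. of_real (f x))"
  unfolding creg_def using reg_zero by auto

lemma creg_phi01: "creg (\<lambda>x. of_real (phi01 x)) (\<lambda>x. - 2 * of_real (phi01 x))"
  using creg_of_real[OF reg_phi01] by simp

lemma creg_dphi: "creg (\<lambda>x. of_real (dphi x)) (\<lambda>x. 0)"
  using creg_of_real[OF reg_dphi] by simp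

definition ccb :: "(real \<Rightarrow> complex) \<Rightarrow> bool" where
  "ccb f \<longleftrightarrow> cb (\<lambda>x. Re (f x)) \<and> cb (\<lambda>x. Im (f x))"

lemma creg_ccb: "creg u f \<Longrightarrow> ccb u \<and> ccb f"
  by (auto simp: creg_def ccb_def reg_def)

lemma ccb_integrable: assumes "ccb f" shows "integrable Mphi f"
proof -
  have "integrable Mphi (\<lambda>x. of_real (Re (f x)) + \<i> * of_real (Im (f x)))"
    using assms by (intro Bochner_Integration.integrable_add integrable_mult_right integrable_of_real cb_integrable)
      (auto simp: ccb_def)
  then show ?thesis by (simp flip: complex_eq)
qed

lemma ccb_L2: assumes "ccb f" shows "f \<in> L2_space Mphi"
proof -
  have "integrable Mphi (\<lambda>x. (Re (f x))\<^sup>2 + (Im (f x))\<^sup>2)"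
    using assms by (intro cb_integrable) (auto simp: ccb_def)
  then show ?thesis using borel_measurable_integrable[OF ccb_integrable[OF assms]] by (simp add: L2_space_def cmod_power2)
qed

lemma L2_inner_ccb:
  assumes f: "ccb f" and g: "ccb g"
  shows "L2_inner Mphi f g = Complex
    ((LINT x|Mphi. Re (f x) * Re (g x)) + (LINT x|Mphi. Im (f x) * Im (g x)))
    ((LINT x|Mphi. Im (f x) * Re (g x)) - (LINT x|Mphi. Re (f x) * Im (g x)))"
proof -
  have [intro]: "cb (\<lambda>x. Re (f x))" "cb (\<lambda>x. Im (f x))" "cb (\<lambda>x. Re (g x))" "cb (\<lambda>x. Im (g x))"
    using f g by (auto simp: ccb_def)
  have i: "integrable Mphi (\<lambda>x. f x * cnj (g x))"
    by (intro L2_inner_integrable ccb_L2 f g)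
  have "Re (L2_inner Mphi f g) = (LINT x|Mphi. Re (f x) * Re (g x) + Im (f x) * Im (g x))"
    "Im (L2_inner Mphi f g) = (LINT x|Mphi. Im (f x) * Re (g x) - Re (f x) * Im (g x))"
    unfolding L2_inner_def by (simp_all add: integral_Re[OF i, symmetric] integral_Im[OF i, symmetric] algebra_simps)
  then show ?thesis
    by (subst (asm) Bochner_Integration.integral_add Bochner_Integration.integral_diff, (auto intro!: cb_integrable)[2],
        subst (asm) Bochner_Integration.integral_diff, auto intro!: cb_integrable complex_eqI)
qed

lemma L2_norm_sq_ccb:
  assumes f: "ccb f"
  shows "(L2_norm Mphi f)\<^sup>2 = (LINT x|Mphi. (Re (f x))\<^sup>2) + (LINT x|Mphi. (Im (f x))\<^sup>2)"
  unfolding L2_norm_sq cmod_power2 using f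
  by (subst Bochner_Integration.integral_add) (auto intro!: cb_integrable simp: ccb_def)

lemma creg_symmetric:
  assumes "creg u f" "creg v g"
  shows "L2_inner Mphi f v = L2_inner Mphi u g"
proof -
  have c: "ccb u" "ccb f" "ccb v" "ccb g" using assms creg_ccb by auto
  obtain y1 y2 z1 z2 where
    "reg (\<lambda>x. Re (u x)) (\<lambda>x. Re (f x)) y1" "reg (\<lambda>x. Im (u x)) (\<lambda>x. Im (f x)) y2"
    "reg (\<lambda>x. Re (v x)) (\<lambda>x. Re (g x)) z1" "reg (\<lambda>x. Im (v x)) (\<lambda>x. Im (g x)) z2"
    using assms unfolding creg_def by blast
  note s = this(1,2)[THEN reg_symmetric, OF this(3)] this(1,2)[THEN reg_symmetric, OF this(4)]
  show ?thesis unfolding L2_inner_ccb[OF c(2,3)] L2_inner_ccb[OF c(1,4)] s ..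
qed

lemma creg_form_lower:
  assumes "creg u f"
  shows "- 2 * (L2_norm Mphi u)\<^sup>2 \<le> Re (L2_inner Mphi f u)"
proof -
  have c: "ccb u" "ccb f" using assms creg_ccb by auto
  obtain y1 y2 where
    "reg (\<lambda>x. Re (u x)) (\<lambda>x. Re (f x)) y1" "reg (\<lambda>x. Im (u x)) (\<lambda>x. Im (f x)) y2"
    using assms unfolding creg_def by blast
  from this[THEN reg_form] show ?thesis
    unfolding L2_inner_ccb[OF c(2,1)] L2_norm_sq_ccb[OF c(1)]
    using cb_int_nonneg[of "\<lambda>x. (y1 x)\<^sup>2"] cb_int_nonneg[of "\<lambda>x. (y2 x)\<^sup>2"] by simp
qed

lemma creg_orth:
  assumes "ccb u" "cb p" "L2_inner Mphi u (\<lambda>x. of_real (p x)) = 0"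
  shows "(LINT x|Mphi. Re (u x) * p x) = 0" "(LINT x|Mphi. Im (u x) * p x) = 0"
proof -
  have "ccb (\<lambda>x. of_real (p x))" using assms by (simp add: ccb_def)
  from L2_inner_ccb[OF assms(1) this]
  show "(LINT x|Mphi. Re (u x) * p x) = 0" "(LINT x|Mphi. Im (u x) * p x) = 0"
    using assms(3) by (simp_all add: complex_eq_iff)
qed

lemma creg_chainE:
  assumes "creg u f" and o: "L2_inner Mphi u (\<lambda>x. of_real (phi01 x)) = 0" "L2_inner Mphi u (\<lambda>x. of_real (dphi x)) = 0"
  obtains y1 g1 h1 y2 g2 h2 where
    "reg (\<lambda>x. Re (u x)) (\<lambda>x. Re (f x)) y1" "chain (\<lambda>x. Re (u x)) g1 h1"
    "reg (\<lambda>x. Im (u x)) (\<lambda>x. Im (f x)) y2" "chain (\<lambda>x. Im (u x)) g2 h2"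
proof -
  have c: "ccb u" "ccb f" using assms creg_ccb by auto
  note o' = creg_orth[OF c(1) cb_phi01 o(1)] creg_orth[OF c(1) cb_dphi o(2)]
  obtain g1 h1 where "chain (\<lambda>x. Re (u x)) g1 h1"
    using o' c by (auto simp: ccb_def intro: chain_exists[of "\<lambda>x. Re (u x)"])
  moreover obtain g2 h2 where "chain (\<lambda>x. Im (u x)) g2 h2"
    using o' c by (auto simp: ccb_def intro: chain_exists[of "\<lambda>x. Im (u x)"])
  ultimately show thesis using assms(1) that unfolding creg_def by blast
qed

lemma creg_gap:
  assumes "creg u f" and o: "L2_inner Mphi u (\<lambda>x. of_real (phi01 x)) = 0" "L2_inner Mphi u (\<lambda>x. of_real (dphi x)) = 0"
  shows "(L2_norm Mphi u)\<^sup>2 \<le> 4 * Re (L2_inner Mphi f u)"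
proof -
  have c: "ccb u" "ccb f" using assms creg_ccb by auto
  from assms obtain y1 g1 h1 y2 g2 h2 where
    "reg (\<lambda>x. Re (u x)) (\<lambda>x. Re (f x)) y1" "chain (\<lambda>x. Re (u x)) g1 h1"
    "reg (\<lambda>x. Im (u x)) (\<lambda>x. Im (f x)) y2" "chain (\<lambda>x. Im (u x)) g2 h2" by (rule creg_chainE)
  from reg_chain_gap[OF this(1,2)] reg_chain_gap[OF this(3,4)] show ?thesis
    unfolding L2_inner_ccb[OF c(2,1)] L2_norm_sq_ccb[OF c(1)] by simp
qed

lemma cb_Cauchy_Schwarz:
  assumes "cb p" "cb q"
  shows "(LINT x|Mphi. p x * q x)\<^sup>2 \<le> (LINT x|Mphi. (p x)\<^sup>2) * (LINT x|Mphi. (q x)\<^sup>2)"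
proof -
  have c: "ccb (\<lambda>x. of_real (p x))" "ccb (\<lambda>x. of_real (q x))" using assms by (simp_all add: ccb_def)
  have "L2_inner Mphi (\<lambda>x. of_real (p x)) (\<lambda>x. of_real (q x)) = of_real (LINT x|Mphi. p x * q x)"
    unfolding L2_inner_ccb[OF c] by (simp add: complex_eq_iff)
  then have "\<bar>LINT x|Mphi. p x * q x\<bar> \<le> L2_norm Mphi (\<lambda>x. of_real (p x)) * L2_norm Mphi (\<lambda>x. of_real (q x))"
    using L2_Cauchy_Schwarz[OF ccb_L2[OF c(1)] ccb_L2[OF c(2)]] by simp
  then have "\<bar>LINT x|Mphi. p x * q x\<bar>\<^sup>2 \<le> (L2_norm Mphi (\<lambda>x. of_real (p x)) * L2_norm Mphi (\<lambda>x. of_real (q x)))\<^sup>2"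
    by (intro power_mono) auto
  then show ?thesis
    unfolding power_mult_distrib L2_norm_sq_ccb[OF c(1)] L2_norm_sq_ccb[OF c(2)] by simp
qed

lemma sum_diff_squares_le: "(p + q)\<^sup>2 + (r - s)\<^sup>2 \<le> 2 * ((p\<^sup>2 + s\<^sup>2) + (r\<^sup>2 + q\<^sup>2))" for p q r s :: real
  using zero_le_power2[of "p - q"] zero_le_power2[of "r + s"] by (simp add: power2_sum power2_diff)

text \<open>Pairing with \<open>v\<close> involves only \<open>phi01 * g\<close>, which the Morawetz
  estimate bounds. The constant is a multiple of the squared norm of \<open>A v / phi01\<close> and
  depends on \<open>v\<close> alone; its uniformity in \<open>u\<close>, \<open>f\<close> and
  \<open>t\<close> is what later permits the passage to limits.\<close>

lemma creg_morawetz: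
  assumes v: "v \<in> test_functions Iphi"
  obtains C where "C \<ge> 0" "\<And>u f t l. creg u f \<Longrightarrow> L2_inner Mphi u (\<lambda>x. of_real (phi01 x)) = 0 \<Longrightarrow>
    L2_inner Mphi u (\<lambda>x. of_real (dphi x)) = 0 \<Longrightarrow> t > 0 \<Longrightarrow>
    (cmod (L2_inner Mphi u v))\<^sup>2 \<le> C * ((L2_norm Mphi (\<lambda>x. f x - of_real l * u x))\<^sup>2 / t + t * (L2_norm Mphi u)\<^sup>2)"
proof -
  define zr where "zr x = Re (vderiv v x) - dphi x * Re (v x) / phi01 x" for x
  define zi where "zi x = Im (vderiv v x) - dphi x * Im (v x) / phi01 x" for x
  have cq: "continuous_on Iphi (\<lambda>x. dphi x / phi01 x)" by (auto intro!: continuous_intros simp: phi01_nz)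
  have z [intro]: "cb zr" "cb zi"
    using cb_test[OF test_vderiv_in[OF v]] cb_test_mult[OF v cq] by (auto simp: zr_def[abs_def] zi_def[abs_def])
  have dv: "((\<lambda>x. Re (v x)) has_real_derivative Re (vderiv v x)) (at x)"
    "((\<lambda>x. Im (v x)) has_real_derivative Im (vderiv v x)) (at x)" for x
    using test_vderiv[OF v, of x] bounded_linear.has_vector_derivative[OF bounded_linear_Re]
      bounded_linear.has_vector_derivative[OF bounded_linear_Im]
    by (auto simp: has_real_derivative_iff_has_vector_derivative)
  have cv: "ccb v" using v by (simp add: ccb_def cb_test)
  define Z where "Z = (LINT x|Mphi. (zr x)\<^sup>2) + (LINT x|Mphi. (zi x)\<^sup>2)"
  have Z: "(LINT x|Mphi. (zr x)\<^sup>2) \<ge> 0" "(LINT x|Mphi. (zi x)\<^sup>2) \<ge> 0" by (auto intro: cb_int_nonneg)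
  have pair: "(LINT x|Mphi. p x * Re (v x))\<^sup>2 + (LINT x|Mphi. p x * Im (v x))\<^sup>2 \<le>
      16/9 * ((LINT x|Mphi. (q x - l * p x)\<^sup>2) / t + t * (LINT x|Mphi. (p x)\<^sup>2)) * Z"
    if r: "reg p q y" and c: "chain p g h" and t: "t > 0" for p q y g h t l
  proof -
    have [intro]: "cb g" using c by (auto simp: chain_def)
    let ?G = "LINT x|Mphi. (phi01 x * g x)\<^sup>2"
    have "(LINT x|Mphi. p x * Re (v x)) = (LINT x|Mphi. (phi01 x * g x) * zr x)"
      unfolding zr_def using z cb_test[OF v]
      by (intro chain_pairing[OF c dv(1)]) (auto simp: zr_def[abs_def])
    then have 1: "(LINT x|Mphi. p x * Re (v x))\<^sup>2 \<le> ?G * (LINT x|Mphi. (zr x)\<^sup>2)"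
      using cb_Cauchy_Schwarz[of "\<lambda>x. phi01 x * g x" zr] by auto
    have "(LINT x|Mphi. p x * Im (v x)) = (LINT x|Mphi. (phi01 x * g x) * zi x)"
      unfolding zi_def using z cb_test[OF v]
      by (intro chain_pairing[OF c dv(2)]) (auto simp: zi_def[abs_def])
    then have 2: "(LINT x|Mphi. p x * Im (v x))\<^sup>2 \<le> ?G * (LINT x|Mphi. (zi x)\<^sup>2)"
      using cb_Cauchy_Schwarz[of "\<lambda>x. phi01 x * g x" zi] by auto
    have "?G * Z \<le> 16/9 * ((LINT x|Mphi. (q x - l * p x)\<^sup>2) / t + t * (LINT x|Mphi. (p x)\<^sup>2)) * Z"
      using reg_chain_morawetz[OF r c t, of l] Z by (intro mult_right_mono) (auto simp: Z_def)
    with 1 2 show ?thesis by (simp add: Z_def distrib_left)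
  qed
  show thesis
  proof (rule that[of "32/9 * Z"])
    show "32/9 * Z \<ge> 0" using Z by (simp add: Z_def)
    fix u f and t l :: real
    assume r: "creg u f" and o: "L2_inner Mphi u (\<lambda>x. of_real (phi01 x)) = 0" "L2_inner Mphi u (\<lambda>x. of_real (dphi x)) = 0"
      and t: "t > 0"
    from r o obtain y1 g1 h1 y2 g2 h2 where
      c: "reg (\<lambda>x. Re (u x)) (\<lambda>x. Re (f x)) y1" "chain (\<lambda>x. Re (u x)) g1 h1"
      "reg (\<lambda>x. Im (u x)) (\<lambda>x. Im (f x)) y2" "chain (\<lambda>x. Im (u x)) g2 h2" by (rule creg_chainE)
    have cu: "ccb u" "ccb f" using r creg_ccb by auto
    then have cf: "ccb (\<lambda>x. f x - of_real l * u x)" by (auto simp: ccb_def)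
    let ?rr = "LINT x|Mphi. Re (u x) * Re (v x)" and ?ri = "LINT x|Mphi. Re (u x) * Im (v x)"
    let ?ir = "LINT x|Mphi. Im (u x) * Re (v x)" and ?ii = "LINT x|Mphi. Im (u x) * Im (v x)"
    have "(cmod (L2_inner Mphi u v))\<^sup>2 = (?rr + ?ii)\<^sup>2 + (?ir - ?ri)\<^sup>2"
      unfolding L2_inner_ccb[OF cu(1) cv] by (simp add: cmod_power2)
    also have "\<dots> \<le> 2 * ((?rr\<^sup>2 + ?ri\<^sup>2) + (?ir\<^sup>2 + ?ii\<^sup>2))"
      by (rule sum_diff_squares_le)
    also have "\<dots> \<le> 2 * (16/9 * ((LINT x|Mphi. (Re (f x) - l * Re (u x))\<^sup>2) / t + t * (LINT x|Mphi. (Re (u x))\<^sup>2)) * Z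
        + 16/9 * ((LINT x|Mphi. (Im (f x) - l * Im (u x))\<^sup>2) / t + t * (LINT x|Mphi. (Im (u x))\<^sup>2)) * Z)"
      by (intro mult_left_mono add_mono pair[OF c(1,2) t] pair[OF c(3,4) t]) simp
    also have "\<dots> = 32/9 * Z * ((L2_norm Mphi (\<lambda>x. f x - of_real l * u x))\<^sup>2 / t + t * (L2_norm Mphi u)\<^sup>2)"
      unfolding L2_norm_sq_ccb[OF cf] L2_norm_sq_ccb[OF cu(1)] by (simp add: algebra_simps add_divide_distrib)
    finally show "(cmod (L2_inner Mphi u v))\<^sup>2 \<le> 32/9 * Z * ((L2_norm Mphi (\<lambda>x. f x - of_real l * u x))\<^sup>2 / t + t * (L2_norm Mphi u)\<^sup>2)" .
  qed
qed

section \<open>The fundamental lemma of the calculus of variations\<close>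

lemma flat_0_bounds: "0 \<le> flat 0 t" "flat 0 t \<le> 1" "flat 0 t = 0 \<longleftrightarrow> t \<le> 0"
  by (auto simp: flat_def)

lemma flat_0_at_top: "(flat 0 \<longlongrightarrow> 1) at_top"
proof -
  have "((\<lambda>t::real. exp (- inverse t)) \<longlongrightarrow> exp (- 0)) at_top"
    by (intro tendsto_intros tendsto_inverse_0_at_top filterlim_ident)
  then have "((\<lambda>t::real. exp (- inverse t)) \<longlongrightarrow> 1) at_top" by simp
  then show ?thesis
    by (rule Lim_transform_eventually) (auto simp: flat_def intro!: eventually_at_top_linorderI[of 1] split: if_splits)
qed

text \<open>The shift by 1 confines the support to \<open>{c + 1/n..d - 1/n}\<close>. Thus even the
  endpoints of \<open>Iphi\<close> are admissible for \<open>c\<close> and \<open>d\<close>, and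
  test functions approximate the indicator of the whole interval.\<close>

definition bump :: "real \<Rightarrow> real \<Rightarrow> nat \<Rightarrow> real \<Rightarrow> real" where
  "bump c d n x = flat 0 (real n * (x - c) - 1) * flat 0 (real n * (d - x) - 1)"

lemma smooth_on_bump: "smooth_on S (bump c d n)"
proof -
  have "smooth_on UNIV (bump c d n)"
    unfolding bump_def by (intro smooth_on_mult smooth_on_compose[OF _ smooth_on_flat] smooth_intros) auto
  then show ?thesis by (rule smooth_on_subset) simp
qed

lemma bump_bounds: "0 \<le> bump c d n x" "bump c d n x \<le> 1"
  using flat_0_bounds by (auto simp: bump_def intro!: mult_nonneg_nonneg mult_le_one)

lemma bump_support: "n > 0 \<Longrightarrow> x \<notin> {c + 1 / n..d - 1 / n} \<Longrightarrow> bump c d n x = 0"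
  by (auto simp: bump_def flat_0_bounds field_simps)

lemma bump_tendsto: "(\<lambda>n. bump c d n x) \<longlonglongrightarrow> indicat_real {c<..<d} x"
proof (cases "c < x \<and> x < d")
  case True
  have *: "filterlim (\<lambda>n. real n * s - 1) at_top sequentially" if "s > 0" for s
  proof -
    have "filterlim (\<lambda>n. - 1 + real n * s) at_top sequentially"
      using that by (intro filterlim_tendsto_add_at_top[OF tendsto_const]
          filterlim_at_top_mult_tendsto_pos[OF tendsto_const] filterlim_real_sequentially)
    then show ?thesis by (simp add: add.commute)
  qed
  have "(\<lambda>n. bump c d n x) \<longlonglongrightarrow> 1 * 1"
    unfolding bump_def using True
    by (intro tendsto_mult filterlim_compose[OF flat_0_at_top *]) auto
  then show ?thesis using True by simp
next
  case False
  have neg: "real n * s - 1 \<le> 0" if "s \<le> 0" for n s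
    using mult_nonneg_nonpos[of "real n" s] that by simp
  have "bump c d n x = 0" for n
    using False neg[of "x - c" n] neg[of "d - x" n] by (auto simp: bump_def flat_0_bounds not_less)
  then show ?thesis using False by simp
qed

lemma bump_test:
  assumes "c < d" "- (pi / sqrt 2) \<le> c" "d \<le> pi / sqrt 2" "1 / real n < (d - c) / 2" "n > 0"
  shows "(\<lambda>x. complex_of_real (bump c d n x)) \<in> test_functions Iphi"
proof (rule test_functionsI[of _ "c + 1 / n" "d - 1 / n"])
  have "1 / real n > 0" using assms by simp
  then have "c + 1 / n \<in> Iphi \<and> d - 1 / n \<in> Iphi"
  proof -
    have "- A < c + e \<and> c + e < A \<and> - A < d - e \<and> d - e < A"
      if "0 < e" "e < (d - c) / 2" "- A \<le> c" "d \<le> A" for e A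
      using that \<open>c < d\<close> by auto
    from this[OF \<open>1 / real n > 0\<close>] show ?thesis
      using assms by (simp add: Iphi_def)
  qed
  then show "c + 1 / n \<in> Iphi" "d - 1 / n \<in> Iphi" by auto
qed (use assms bump_support in \<open>auto intro!: smooth_intros smooth_on_bump simp del: atLeastAtMost_iff\<close>)

lemma borel_eq_open_intervals: "borel = sigma UNIV (range (\<lambda>(c, d). {c<..<d::real}))"
  using borel_eq_box[where 'a = real] by (simp add: box_real)

text \<open>The integral of \<open>f\<close> vanishes over open intervals by dominated convergence
  with bumps, over Borel sets because these intervals are an intersection-stable generator, and over
  Lebesgue sets up to null sets. Uniqueness of densities then applies to the real and imaginary
  parts.\<close>

lemma fundamental_lemma:
  fixes f :: "real \<Rightarrow> complex"
  assumes f: "integrable Mphi f"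
    and test: "\<And>\<psi>. \<psi> \<in> test_functions Iphi \<Longrightarrow> (LINT x|Mphi. f x * \<psi> x) = 0"
  shows "AE x in Mphi. f x = 0"
proof -
  define g where "g x = indicat_real Iphi x *\<^sub>R f x" for x
  have I [simp, measurable]: "Iphi \<in> sets lebesgue" by (simp add: Iphi_def)
  have g: "integrable lebesgue g"
    using f unfolding g_def by (subst (asm) integrable_restrict_space) auto
  have [measurable]: "g \<in> borel_measurable lebesgue" using g by auto
  have test_g: "(LINT x|lebesgue. g x * \<psi> x) = 0" if "\<psi> \<in> test_functions Iphi" for \<psi>
    using test[OF that] by (subst (asm) integral_restrict_space) (auto simp: g_def)
  define P where "P A \<longleftrightarrow> (LINT x:A|lebesgue. g x) = 0" for A
  have interval: "P {c<..<d}" if "c < d" and cd: "- (pi / sqrt 2) \<le> c" "d \<le> pi / sqrt 2" for c d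
  proof -
    have lim: "(\<lambda>n. LINT x|lebesgue. g x * complex_of_real (bump c d n x)) \<longlonglongrightarrow>
        (LINT x|lebesgue. g x * complex_of_real (indicator {c<..<d} x))"
    proof (rule integral_dominated_convergence[where w = "\<lambda>x. cmod (g x)"])
      have "continuous_on UNIV (bump c d n)" for n by (intro smooth_on_continuous smooth_on_bump)
      then have [measurable]: "bump c d n \<in> borel_measurable lebesgue" for n
        by (intro measurable_completion) (simp add: borel_measurable_continuous_onI)
      show "(\<lambda>x. g x * complex_of_real (bump c d n x)) \<in> borel_measurable lebesgue" for n
        by (intro borel_measurable_times measurable_compose[OF _ borel_measurable_of_real]) simp_all
      show "AE x in (lebesgue :: real measure). (\<lambda>n. g x * complex_of_real (bump c d n x)) \<longlonglongrightarrow> g x * complex_of_real (indicator {c<..<d} x)"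
        by (intro AE_I2 tendsto_intros bump_tendsto)
      show "AE x in (lebesgue :: real measure). norm (g x * complex_of_real (bump c d n x)) \<le> cmod (g x)" for n
        using bump_bounds by (intro AE_I2) (auto simp: norm_mult mult_left_le)
    qed (use g in \<open>auto intro!: borel_measurable_times measurable_compose[OF _ borel_measurable_of_real] borel_measurable_indicator\<close>)
    have "(\<lambda>n. 1 / real n) \<longlonglongrightarrow> 0" by (rule lim_1_over_n)
    then have "eventually (\<lambda>n. 1 / real n < (d - c) / 2) sequentially"
      using \<open>c < d\<close> by (intro order_tendstoD) auto
    then have "eventually (\<lambda>n. (LINT x|lebesgue. g x * complex_of_real (bump c d n x)) = 0) sequentially"
      using eventually_gt_at_top[of "0::nat"]
      by eventually_elim (intro test_g bump_test that, auto)
    from tendsto_unique[OF _ lim tendsto_eventually[OF this]]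
    show ?thesis by (simp add: P_def set_lebesgue_integral_def scaleR_conv_of_real mult.commute)
  qed
  have P_I: "P A \<longleftrightarrow> P (A \<inter> Iphi)" for A
    unfolding P_def set_lebesgue_integral_def
    by (intro arg_cong[where f = "\<lambda>z. z = 0"] Bochner_Integration.integral_cong) (auto simp: g_def indicator_def)
  have P_ioo: "P {c<..<d}" for c d
  proof -
    have "{c<..<d} \<inter> Iphi = {max c (- (pi / sqrt 2))<..<min d (pi / sqrt 2)}" by (auto simp: Iphi_def)
    moreover have "P {max c (- (pi / sqrt 2))<..<min d (pi / sqrt 2)}"
    proof (cases "max c (- (pi / sqrt 2)) < min d (pi / sqrt 2)")
      case False
      then have "{max c (- (pi / sqrt 2))<..<min d (pi / sqrt 2)} = {}" by auto
      then show ?thesis by (simp add: P_def set_lebesgue_integral_def)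
    qed (intro interval; simp)
    ultimately show ?thesis using P_I[of "{c<..<d}"] by simp
  qed
  have P_UNIV: "P UNIV" using P_I[of UNIV] P_ioo by (simp add: Iphi_def)
  have P_borel: "P A" if "A \<in> sets borel" for A
  proof -
    let ?G = "range (\<lambda>(c, d). {c<..<d::real})"
    have "Int_stable ?G"
      unfolding Int_stable_def by clarsimp blast
    moreover have "?G \<subseteq> Pow UNIV" by simp
    moreover have sig: "sigma_sets UNIV ?G = sets borel"
      using arg_cong[OF borel_eq_open_intervals, of sets] by simp
    have "A \<in> sigma_sets UNIV ?G" using that by (simp add: sig)
    ultimately have "Int_stable ?G" "?G \<subseteq> Pow UNIV" "A \<in> sigma_sets UNIV ?G" by auto
    then show ?thesis
    proof (induction A rule: sigma_sets_induct_disjoint)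
      case (compl A)
      then have A [measurable]: "A \<in> sets lebesgue" unfolding sig by simp
      have "(LINT x:UNIV|lebesgue. g x) = (LINT x:A|lebesgue. g x) + (LINT x:(UNIV - A)|lebesgue. g x)"
      proof -
        have "set_integrable lebesgue B g" if "B \<in> sets lebesgue" for B
          unfolding set_integrable_def using that g by (rule integrable_mult_indicator)
        moreover have "UNIV - A \<in> sets lebesgue" using A sets.Diff[of UNIV lebesgue A] by simp
        ultimately show ?thesis
          using set_integral_Un[of A "UNIV - A" lebesgue g] A by simp
      qed
      then show ?case using compl P_UNIV by (simp add: P_def)
    next
      case (union A)
      then have A: "A i \<in> sets lebesgue" for i unfolding sig by auto
      have "(LINT x:(\<Union>i. A i)|lebesgue. g x) = (\<Sum>i. (LINT x:(A i)|lebesgue. g x))"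
        using union A g
        by (intro lebesgue_integral_countable_add) (auto simp: disjoint_family_on_def set_integrable_def intro!: integrable_mult_indicator)
      then show ?case using union by (simp add: P_def)
    qed (auto simp: P_ioo, simp add: P_def set_lebesgue_integral_def)
  qed
  have P_leb: "P A" if A: "A \<in> sets lebesgue" for A
  proof -
    obtain S N N' where *: "A = S \<union> N" "N \<subseteq> N'" "N' \<in> null_sets lborel" "S \<in> sets lborel"
      using A by (rule sets_completionE)
    have "AE x in (lebesgue :: real measure). x \<notin> N'" using *(3) by (intro AE_completion AE_not_in)
    then have "AE x in (lebesgue :: real measure). indicat_real A x *\<^sub>R g x = indicat_real S x *\<^sub>R g x"
      by (rule AE_mp) (use * in \<open>auto simp: indicator_def\<close>)
    then have "(LINT x:A|lebesgue. g x) = (LINT x:S|lebesgue. g x)"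
      unfolding set_lebesgue_integral_def using A *(4)
      by (intro integral_cong_AE borel_measurable_scaleR borel_measurable_indicator) auto
    moreover have "P S" using *(4) by (intro P_borel) simp
    ultimately show ?thesis by (simp add: P_def)
  qed
  have part: "AE x in (lebesgue :: real measure). T (g x) = 0" if T: "bounded_linear T" for T :: "complex \<Rightarrow> real"
  proof (rule density_unique_real)
    show "integrable lebesgue (\<lambda>x. T (g x))" by (rule integrable_bounded_linear[OF T g])
    fix A :: "real set" assume A: "A \<in> sets lebesgue"
    have "(LINT x|(lebesgue :: real measure). T (indicat_real A x *\<^sub>R g x)) = T (LINT x|lebesgue. indicat_real A x *\<^sub>R g x)"
      using A g by (intro integral_bounded_linear[OF T] integrable_mult_indicator)
    then show "(LINT x:A|lebesgue. T (g x)) = (LINT x:A|(lebesgue::real measure). 0)"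
      using P_leb[OF A] bounded_linear.linear[OF T]
      by (simp add: P_def set_lebesgue_integral_def linear_scale linear_0)
  qed simp
  have "AE x in (lebesgue :: real measure). g x = 0"
    using part[OF bounded_linear_Re] part[OF bounded_linear_Im] by eventually_elim (simp add: complex_eq_iff)
  then show ?thesis
    by (subst AE_restrict_space_iff) (auto simp: g_def elim: AE_mp)
qed

text \<open>The zero mean makes the antiderivative vanish again to the right of the support, so it
  is a test function itself.\<close>

lemma test_antiderivative:
  assumes \<psi>: "\<psi> \<in> test_functions Iphi" and z: "(LINT x|Mphi. \<psi> x) = 0"
  obtains \<Psi> where "\<Psi> \<in> test_functions Iphi" "\<And>x. (\<Psi> has_vector_derivative \<psi> x) (at x)"
proof -
  obtain c d where cd: "c \<in> Iphi" "d \<in> Iphi" "c \<le> d" "\<And>x. x \<notin> {c..d} \<Longrightarrow> \<psi> x = 0" and sm: "smooth_on UNIV \<psi>"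
    using \<psi> by (rule test_functionsE) blast
  have cont: "continuous_on S \<psi>" for S
    using smooth_on_continuous[OF sm] continuous_on_subset by blast
  have ccb: "ccb \<psi>" using \<psi> by (simp add: ccb_def cb_test)
  \<comment> \<open>A base point outside \<open>Iphi\<close>, strictly to the left of the support,
    so that every \<open>x \<ge> c\<close> is interior to \<open>{e..x + 1}\<close>.\<close>
  define e where "e = - (pi / sqrt 2) - 1"
  define \<Psi> where "\<Psi> x = integral {e..x} \<psi>" for x
  have e: "e < c" using cd by (auto simp: e_def Iphi_def)
  have "(\<psi> has_integral 0) Iphi"
    using has_integral_integral_lebesgue_on[OF ccb_integrable[OF ccb]] z by (simp add: Iphi_def)
  moreover have \<psi>_cut: "(\<lambda>x. if x \<in> {c..d} then \<psi> x else 0) = \<psi>" using cd(4) by auto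
  ultimately have "(\<psi> has_integral 0) {c..d}"
    using has_integral_restrict[OF Iphi_interval[OF cd(1,2)], of \<psi> 0] by simp
  then have "(\<psi> has_integral 0) {e..d}"
    using has_integral_restrict[of "{c..d}" "{e..d}" \<psi> 0] e \<psi>_cut by simp
  then have z': "integral {e..d} \<psi> = 0" by (rule integral_unique)
  have left: "\<Psi> x = 0" if "x < c" for x
  proof -
    have "\<Psi> x = integral {e..x} (\<lambda>x. 0)"
      unfolding \<Psi>_def using that cd(4) by (intro Henstock_Kurzweil_Integration.integral_cong) auto
    then show ?thesis by simp
  qed
  have right: "\<Psi> x = 0" if "x > d" for x
  proof -
    have "\<Psi> x = integral {e..d} \<psi> + integral {d..x} \<psi>"
      unfolding \<Psi>_def using that e cd(3)
      by (intro Henstock_Kurzweil_Integration.integral_combine[symmetric] integrable_continuous_real cont) auto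
    also have "integral {d..x} \<psi> = integral {d..x} (\<lambda>x. 0)"
      using cd(4) by (intro integral_spike[of "{d}"]) auto
    finally show ?thesis using z' by simp
  qed
  have deriv: "(\<Psi> has_vector_derivative \<psi> x) (at x)" for x
  proof (cases "x < c")
    case True
    then show ?thesis
      using has_vector_derivative_cong_open[of "{..<c}" x \<Psi> "\<lambda>x. 0" 0] left cd(4)[of x] by auto
  next
    case False
    then have x: "x \<in> {e<..<x + 1}" using e by auto
    have "(\<Psi> has_vector_derivative \<psi> x) (at x within {e..x + 1})"
      unfolding \<Psi>_def using x by (intro integral_has_vector_derivative cont) auto
    then show ?thesis using x by (subst (asm) at_within_interior) auto
  qed
  have "\<Psi> \<in> test_functions Iphi"
    using left right by (intro test_functionsI[OF smooth_onI_deriv[OF _ deriv] cd(1,2)] test_smooth_Iphi[OF \<psi>])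
      (auto simp: not_le)
  with deriv show thesis by (rule that[rotated])
qed

section \<open>Behaviour at the endpoints\<close>

text \<open>An antiderivative of \<open>1 / phi01\<^sup>2\<close> is \<open>- dphi / phi01\<close>,
  because \<open>phi\<^sup>2 / 2 + dphi\<^sup>2 = 1\<close>. It is unbounded at both endpoints, so
  growth like \<open>r / phi01\<close> up to an endpoint contradicts square integrability.\<close>

lemma L2_bound_phi01:
  assumes u: "u \<in> L2_space (lebesgue_on {c<..<d})" and pq: "c < p" "p \<le> q" "q < d" "p \<in> Iphi" "q \<in> Iphi"
    and le: "\<And>x. x \<in> {p..q} \<Longrightarrow> r / phi01 x \<le> cmod (u x)" and r: "r > 0"
  shows "r\<^sup>2 * (dphi p / phi01 p - dphi q / phi01 q) \<le> (LINT x|lebesgue_on {c<..<d}. (cmod (u x))\<^sup>2)"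
proof -
  note sub = Iphi_interval[OF pq(4,5)]
  have "((\<lambda>x. (cmod (u x))\<^sup>2) has_integral (LINT x|lebesgue_on {c<..<d}. (cmod (u x))\<^sup>2)) {c<..<d}"
    using L2_sq_integrable[OF u] by (intro has_integral_integral_lebesgue_on) auto
  moreover from this have "(\<lambda>x. (cmod (u x))\<^sup>2) integrable_on {p..q}"
    using pq by (intro integrable_on_subinterval[of _ "{c<..<d}"]) auto
  then have i: "((\<lambda>x. (cmod (u x))\<^sup>2) has_integral integral {p..q} (\<lambda>x. (cmod (u x))\<^sup>2)) {p..q}"
    by (rule integrable_integral)
  ultimately have "integral {p..q} (\<lambda>x. (cmod (u x))\<^sup>2) \<le> (LINT x|lebesgue_on {c<..<d}. (cmod (u x))\<^sup>2)"
    using pq by (intro has_integral_subset_le[OF _ i]) auto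
  moreover have "((\<lambda>x. r\<^sup>2 / (phi01 x * phi01 x)) has_integral
      (- (r\<^sup>2 * (dphi q / phi01 q)) - - (r\<^sup>2 * (dphi p / phi01 p)))) {p..q}"
  proof (rule fundamental_theorem_of_calculus[OF pq(2)])
    fix x assume "x \<in> {p..q}"
    then have x: "phi01 x \<noteq> 0" using sub by (intro phi01_nz) auto
    have "((\<lambda>x. - (r\<^sup>2 * (dphi x / phi01 x))) has_real_derivative r\<^sup>2 / (phi01 x * phi01 x)) (at x within {p..q})"
    proof -
      have "- phi01 x / 2 * phi01 x - dphi x * dphi x = - 1"
        using phi01_dphi[of x] by (simp add: diff_divide_distrib)
      then show ?thesis
        using DERIV_minus[OF DERIV_cmult[OF DERIV_divide[OF DERIV_dphi DERIV_phi01 x]], of "r\<^sup>2" "{p..q}"] by simp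
    qed
    then show "((\<lambda>x. - (r\<^sup>2 * (dphi x / phi01 x))) has_vector_derivative r\<^sup>2 / (phi01 x * phi01 x)) (at x within {p..q})"
      by (simp add: has_real_derivative_iff_has_vector_derivative)
  qed
  then have "- (r\<^sup>2 * (dphi q / phi01 q)) - - (r\<^sup>2 * (dphi p / phi01 p)) \<le> integral {p..q} (\<lambda>x. (cmod (u x))\<^sup>2)"
  proof (rule has_integral_le[OF _ i])
    fix x assume x: "x \<in> {p..q}"
    then have "phi01 x > 0" using sub by (intro phi01_pos) auto
    then have "(r / phi01 x)\<^sup>2 \<le> (cmod (u x))\<^sup>2" using le[OF x] r by (intro power_mono) auto
    then show "r\<^sup>2 / (phi01 x * phi01 x) \<le> (cmod (u x))\<^sup>2" by (simp add: power_divide power2_eq_square)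
  qed
  ultimately show ?thesis by (simp add: right_diff_distrib)
qed

lemma phi01_limits:
  "(phi01 \<longlongrightarrow> 0) (at_left (pi / sqrt 2))" "(phi01 \<longlongrightarrow> 0) (at_right (- (pi / sqrt 2)))"
  "(dphi \<longlongrightarrow> - 1) (at_left (pi / sqrt 2))" "(dphi \<longlongrightarrow> 1) (at_right (- (pi / sqrt 2)))"
  "filterlim (\<lambda>x. - (dphi x / phi01 x)) at_top (at_left (pi / sqrt 2))"
  "filterlim (\<lambda>x. dphi x / phi01 x) at_top (at_right (- (pi / sqrt 2)))"
proof -
  have c: "isCont phi01 x" "isCont dphi x" for x
    using DERIV_phi01[of x UNIV] DERIV_dphi[of x UNIV] by (auto intro: DERIV_isCont)
  have v: "dphi (pi / sqrt 2) = - 1" "dphi (- (pi / sqrt 2)) = 1" by (simp_all add: dphi_def)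
  show 1: "(phi01 \<longlongrightarrow> 0) (at_left (pi / sqrt 2))" "(phi01 \<longlongrightarrow> 0) (at_right (- (pi / sqrt 2)))"
    "(dphi \<longlongrightarrow> - 1) (at_left (pi / sqrt 2))" "(dphi \<longlongrightarrow> 1) (at_right (- (pi / sqrt 2)))"
    using c[of "pi / sqrt 2"] c[of "- (pi / sqrt 2)"] phi01_endpoint v
    by (auto simp: isCont_def intro: filterlim_mono[OF _ order_refl at_le])
  have pos: "eventually (\<lambda>x. phi01 x > 0) (at_left (pi / sqrt 2))"
    "eventually (\<lambda>x. phi01 x > 0) (at_right (- (pi / sqrt 2)))"
    by (auto simp: eventually_at_left_field eventually_at_right_field Iphi_def intro!: exI[of _ 0] phi01_pos)
  have "filterlim (\<lambda>x. - dphi x * inverse (phi01 x)) at_top (at_left (pi / sqrt 2))"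
    using tendsto_minus[OF 1(3)] 1(1) pos
    by (intro filterlim_tendsto_pos_mult_at_top[of _ 1] filterlim_inverse_at_top) auto
  then show "filterlim (\<lambda>x. - (dphi x / phi01 x)) at_top (at_left (pi / sqrt 2))"
    by (simp add: divide_inverse)
  have "filterlim (\<lambda>x. dphi x * inverse (phi01 x)) at_top (at_right (- (pi / sqrt 2)))"
    using 1(4,2) pos by (intro filterlim_tendsto_pos_mult_at_top[of _ 1] filterlim_inverse_at_top) auto
  then show "filterlim (\<lambda>x. dphi x / phi01 x) at_top (at_right (- (pi / sqrt 2)))"
    by (simp add: divide_inverse)
qed

text \<open>If \<open>k\<close> were nonzero at the endpoint, \<open>u\<close> would dominate a
  multiple of \<open>1 / phi01\<close> near it, and the integral of \<open>1 / phi01\<^sup>2\<close>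
  diverges there. The value of \<open>c\<close> may be the opposite endpoint, which covers square
  integrability on all of \<open>Iphi\<close>.\<close>

lemma L2_end_right:
  assumes k: "isCont k (pi / sqrt 2)" and c: "- (pi / sqrt 2) \<le> c" "c < pi / sqrt 2"
    and u: "u \<in> L2_space (lebesgue_on {c<..<pi / sqrt 2})"
    and eq: "\<And>x. x \<in> {c<..<pi / sqrt 2} \<Longrightarrow> u x = k x / of_real (phi01 x)"
  shows "k (pi / sqrt 2) = 0"
proof (rule ccontr)
  assume "k (pi / sqrt 2) \<noteq> 0"
  define b where "b = pi / sqrt 2"
  define r where "r = cmod (k b) / 2"
  have r: "r > 0" "r < cmod (k b)" using \<open>k (pi / sqrt 2) \<noteq> 0\<close> by (auto simp: r_def b_def)
  have "((\<lambda>x. cmod (k x)) \<longlongrightarrow> cmod (k b)) (at_left b)"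
    using k by (intro tendsto_norm) (auto simp: isCont_def b_def intro: filterlim_mono[OF _ order_refl at_le])
  then have "eventually (\<lambda>x. r < cmod (k x)) (at_left b)" using r by (intro order_tendstoD)
  then obtain e where e: "e < b" "\<And>x. e < x \<Longrightarrow> x < b \<Longrightarrow> r < cmod (k x)"
    by (auto simp: eventually_at_left_field)
  have Ib: "Iphi = {- b<..<b}" "- b \<le> c" "c < b" using c by (auto simp: b_def Iphi_def)
  obtain m where m: "c \<le> m" "e \<le> m" "m < b" using Ib(3) e(1) that[of "max c e"] by auto
  define p where "p = (m + b) / 2"
  have "c < p" unfolding p_def using m by simp
  moreover have "e < p" unfolding p_def using m by simp
  moreover have "p < b" unfolding p_def using m by simp
  ultimately have p: "c < p" "e < p" "p < b" by auto
  have "p \<in> Iphi" unfolding Ib(1) using p Ib(2) by simp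
  note p = p this
  define K where "K = (LINT x|lebesgue_on {c<..<b}. (cmod (u x))\<^sup>2)"
  have bound: "r\<^sup>2 * (dphi p / phi01 p - dphi q / phi01 q) \<le> K" if q: "p \<le> q" "q < b" for q
    unfolding K_def
  proof (rule L2_bound_phi01)
    fix x assume x: "x \<in> {p..q}"
    then have "phi01 x > 0" using p q Ib(2) by (intro phi01_pos) (auto simp: Ib(1))
    moreover have "r \<le> cmod (k x)" using e(2)[of x] x p q by auto
    moreover have "u x = k x / of_real (phi01 x)" using x p q by (intro eq) (auto simp: b_def)
    ultimately show "r / phi01 x \<le> cmod (u x)" by (simp add: norm_divide divide_right_mono)
  qed (use p q r u Ib(2) in \<open>auto simp: Ib(1) simp flip: b_def\<close>)
  have "eventually (\<lambda>q. K / r\<^sup>2 - dphi p / phi01 p < - (dphi q / phi01 q)) (at_left b)"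
    using phi01_limits(5) unfolding b_def filterlim_at_top_dense by blast
  moreover have "eventually (\<lambda>q. p < q \<and> q < b) (at_left b)"
    using p by (auto simp: eventually_at_left_field)
  ultimately have "eventually (\<lambda>q. False) (at_left b)"
  proof eventually_elim
    case (elim q)
    then have "r\<^sup>2 * (K / r\<^sup>2) < r\<^sup>2 * (dphi p / phi01 p - dphi q / phi01 q)" using r by (intro mult_strict_left_mono) auto
    also have "\<dots> \<le> K" using elim by (intro bound) auto
    finally show False using r by simp
  qed
  then show False by (simp add: trivial_limit_at_left_real)
qed

lemma L2_end_left:
  assumes k: "isCont k (- (pi / sqrt 2))" and c: "- (pi / sqrt 2) < c" "c \<le> pi / sqrt 2"
    and u: "u \<in> L2_space (lebesgue_on {- (pi / sqrt 2)<..<c})"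
    and eq: "\<And>x. x \<in> {- (pi / sqrt 2)<..<c} \<Longrightarrow> u x = k x / of_real (phi01 x)"
  shows "k (- (pi / sqrt 2)) = 0"
proof (rule ccontr)
  assume "k (- (pi / sqrt 2)) \<noteq> 0"
  define a where "a = - (pi / sqrt 2)"
  define r where "r = cmod (k a) / 2"
  have r: "r > 0" "r < cmod (k a)" using \<open>k (- (pi / sqrt 2)) \<noteq> 0\<close> by (auto simp: r_def a_def)
  have "((\<lambda>x. cmod (k x)) \<longlongrightarrow> cmod (k a)) (at_right a)"
    using k by (intro tendsto_norm) (auto simp: isCont_def a_def intro: filterlim_mono[OF _ order_refl at_le])
  then have "eventually (\<lambda>x. r < cmod (k x)) (at_right a)" using r by (intro order_tendstoD)
  then obtain e where e: "a < e" "\<And>x. a < x \<Longrightarrow> x < e \<Longrightarrow> r < cmod (k x)"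
    by (auto simp: eventually_at_right_field)
  have Ia: "Iphi = {a<..<- a}" "a < c" "c \<le> - a" using c by (auto simp: a_def Iphi_def)
  obtain m where m: "m \<le> c" "m \<le> e" "a < m" using Ia(2) e(1) that[of "min c e"] by auto
  define q where "q = (m + a) / 2"
  have "q < c" unfolding q_def using m by simp
  moreover have "q < e" unfolding q_def using m by simp
  moreover have "a < q" unfolding q_def using m by simp
  ultimately have q: "q < c" "q < e" "a < q" by auto
  have "q \<in> Iphi" unfolding Ia(1) using q Ia(3) by simp
  note q = q this
  define K where "K = (LINT x|lebesgue_on {a<..<c}. (cmod (u x))\<^sup>2)"
  have bound: "r\<^sup>2 * (dphi p / phi01 p - dphi q / phi01 q) \<le> K" if p: "p \<le> q" "a < p" for p
    unfolding K_def
  proof (rule L2_bound_phi01)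
    fix x assume x: "x \<in> {p..q}"
    then have "phi01 x > 0" using p q Ia(3) by (intro phi01_pos) (auto simp: Ia(1))
    moreover have "r \<le> cmod (k x)" using e(2)[of x] x p q by auto
    moreover have "u x = k x / of_real (phi01 x)" using x p q by (intro eq) (auto simp: a_def)
    ultimately show "r / phi01 x \<le> cmod (u x)" by (simp add: norm_divide divide_right_mono)
  qed (use p q r u Ia(3) in \<open>auto simp: Ia(1) simp flip: a_def\<close>)
  have "eventually (\<lambda>p. K / r\<^sup>2 + dphi q / phi01 q < dphi p / phi01 p) (at_right a)"
    using phi01_limits(6) unfolding a_def filterlim_at_top_dense by blast
  moreover have "eventually (\<lambda>p. a < p \<and> p < q) (at_right a)"
    using q by (auto simp: eventually_at_right_field)
  ultimately have "eventually (\<lambda>p. False) (at_right a)"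
  proof eventually_elim
    case (elim p)
    then have "r\<^sup>2 * (K / r\<^sup>2) < r\<^sup>2 * (dphi p / phi01 p - dphi q / phi01 q)" using r by (intro mult_strict_left_mono) auto
    also have "\<dots> \<le> K" using elim by (intro bound) auto
    finally show False using r by simp
  qed
  then show False by (simp add: trivial_limit_at_right_real)
qed

lemma L_exprI:
  assumes S: "open S" "x \<in> S" and eq: "\<And>y. y \<in> S \<Longrightarrow> phi01 y *\<^sub>R w y = k y"
    and k: "\<And>y. y \<in> S \<Longrightarrow> (k has_vector_derivative k1 y) (at y)" "(k1 has_vector_derivative k2) (at x)"
  shows "L_expr phi01 w x = - (phi01 x *\<^sub>R (k2 + 2 * k x))"
    and "(\<lambda>y. phi01 y *\<^sub>R w y) differentiable (at x)" "vderiv (\<lambda>y. phi01 y *\<^sub>R w y) differentiable (at x)"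
proof -
  have 1: "((\<lambda>y. phi01 y *\<^sub>R w y) has_vector_derivative k1 y) (at y)" if "y \<in> S" for y
    using has_vector_derivative_cong_open[of S y "\<lambda>y. phi01 y *\<^sub>R w y" k, OF S(1) that eq] k(1)[OF that] by blast
  have 2: "(vderiv (\<lambda>y. phi01 y *\<^sub>R w y) has_vector_derivative k2) (at x)"
    using has_vector_derivative_cong_open[of S x "vderiv (\<lambda>y. phi01 y *\<^sub>R w y)" k1, OF S vderivI[OF 1]] k(2) by blast
  show "L_expr phi01 w x = - (phi01 x *\<^sub>R (k2 + 2 * k x))"
    unfolding L_expr_def vderivI[OF 2] eq[OF S(2)] ..
  show "(\<lambda>y. phi01 y *\<^sub>R w y) differentiable (at x)" "vderiv (\<lambda>y. phi01 y *\<^sub>R w y) differentiable (at x)"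
    using 1[OF S(2)] 2 by (auto simp: differentiable_vector)
qed

text \<open>At \<open>\<mu> = 0\<close> one solution is \<open>cos (sqrt 2 x) / \<phi>\<close>.\<close>

lemma limit_point_phi01:
  "limit_point_left phi01 (- (pi / sqrt 2)) (pi / sqrt 2)" "limit_point_right phi01 (- (pi / sqrt 2)) (pi / sqrt 2)"
proof -
  define k :: "real \<Rightarrow> complex" where "k x = of_real (cos (sqrt 2 * x))" for x
  define u where "u x = k x / of_real (phi01 x)" for x
  have k1: "(k has_vector_derivative of_real (- (sqrt 2 * sin (sqrt 2 * x)))) (at x)" for x
    unfolding k_def
    by (intro has_vector_derivative_of_real) (auto intro!: derivative_eq_intros simp: has_real_derivative_iff_has_vector_derivative[symmetric])
  have k2: "((\<lambda>x. of_real (- (sqrt 2 * sin (sqrt 2 * x)))) has_vector_derivative - 2 * k x) (at x)" for x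
  proof -
    have "((\<lambda>x. of_real (- (sqrt 2 * sin (sqrt 2 * x))) :: complex) has_vector_derivative of_real (- 2 * cos (sqrt 2 * x))) (at x)"
      by (intro has_vector_derivative_of_real) (auto intro!: derivative_eq_intros simp: has_real_derivative_iff_has_vector_derivative[symmetric])
    then show ?thesis by (simp add: k_def)
  qed
  have eq: "phi01 y *\<^sub>R u y = k y" if "y \<in> Iphi" for y
    using phi01_nz[OF that] by (simp add: u_def scaleR_conv_of_real)
  have "L_solution phi01 Iphi 0 u"
    unfolding L_solution_def using L_exprI[OF open_Iphi _ eq k1 k2] by auto
  then have sol: "L_solution phi01 {- (pi / sqrt 2)<..<pi / sqrt 2} 0 u" by (simp add: Iphi_def)
  \<comment> \<open>At both endpoints the argument of the cosine is \<open>pi\<close> up to sign, so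
    \<open>k\<close> equals -1 there and \<open>k / phi01\<close> is not square integrable at either
    end.\<close>
  have "sqrt 2 * (pi / sqrt 2) = pi" by simp
  then have end_k: "k (pi / sqrt 2) \<noteq> 0" "k (- (pi / sqrt 2)) \<noteq> 0" by (simp_all add: k_def)
  have cont: "isCont k x" for x using k1 by (rule has_vector_derivative_continuous)
  show "limit_point_left phi01 (- (pi / sqrt 2)) (pi / sqrt 2)"
    unfolding limit_point_left_def using sol end_k(2) L2_end_left[OF cont, of _ u]
    by (intro exI[of _ 0] notI) (fastforce simp: u_def)
  show "limit_point_right phi01 (- (pi / sqrt 2)) (pi / sqrt 2)"
    unfolding limit_point_right_def using sol end_k(1) L2_end_right[OF cont, of _ u]
    by (intro exI[of _ 0] notI) (fastforce simp: u_def)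
qed

section \<open>The du Bois-Reymond lemma with one and with two constraints\<close>

lemma test_L2: "f \<in> test_functions Iphi \<Longrightarrow> f \<in> L2_space Mphi"
  by (intro ccb_L2) (simp add: ccb_def cb_test)

lemma test_integrable: "f \<in> test_functions Iphi \<Longrightarrow> integrable Mphi f"
  by (intro L2_integrable test_L2) simp

lemma cont_test_integrable:
  assumes "f \<in> L2_space Mphi" "\<psi> \<in> test_functions Iphi"
  shows "integrable Mphi (\<lambda>x. f x * \<psi> x)"
proof -
  have "(\<lambda>x. cnj (\<psi> x)) \<in> L2_space Mphi" using test_L2[OF assms(2)] by (auto simp: L2_space_def)
  from L2_inner_integrable[OF assms(1) this] show ?thesis by simp
qed

text \<open>Write \<open>f\<close> as \<open>phi01\<close> times \<open>f / phi01\<close>; compact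
  support keeps the quotient bounded, so the statement becomes an instance of
  \<open>integral_phi_mult_deriv\<close>.\<close>

lemma integral_test_deriv:
  assumes "f \<in> test_functions Iphi" shows "(LINT x|Mphi. vderiv f x) = 0"
proof -
  note f' = test_vderiv_in[OF assms]
  have cq: "continuous_on Iphi (\<lambda>x. 1 / phi01 x)" by (auto intro!: continuous_intros simp: phi01_nz)
  have *: "(LINT x|Mphi. T (vderiv f x)) = 0" if T: "bounded_linear T" and
    cb: "cb (\<lambda>x. T (vderiv f x))" "cb (\<lambda>x. 1 / phi01 x * T (f x))" for T :: "complex \<Rightarrow> real"
  proof (rule integral_phi_mult_deriv[OF _ _ cb(2,1)])
    fix x assume x: "x \<in> Iphi"
    have "((\<lambda>x. T (f x)) has_real_derivative T (vderiv f x)) (at x)"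
      using bounded_linear.has_vector_derivative[OF T test_vderiv[OF assms]]
      by (simp add: has_real_derivative_iff_has_vector_derivative)
    then show "((\<lambda>x. 1 / phi01 x * T (f x)) has_real_derivative
        (T (vderiv f x) - dphi x * (1 / phi01 x * T (f x))) / phi01 x) (at x)"
      using x by (auto intro!: derivative_eq_intros DERIV_phi01 simp: phi01_nz field_simps)
    show "T (vderiv f x) = dphi x * (1 / phi01 x * T (f x)) +
      phi01 x * ((T (vderiv f x) - dphi x * (1 / phi01 x * T (f x))) / phi01 x)"
      using x by (simp add: phi01_nz)
  qed
  show ?thesis
    using *[OF bounded_linear_Re cb_test(1)[OF f'] cb_test_mult(1)[OF assms cq]]
      *[OF bounded_linear_Im cb_test(2)[OF f'] cb_test_mult(2)[OF assms cq]] test_integrable[OF f']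
    by (simp add: complex_eq_iff)
qed

lemma not_AE_Mphi_False: "\<not> (AE x in Mphi. False)"
proof
  assume "AE x in Mphi. False"
  then have "emeasure Mphi (space Mphi) = 0" by (simp add: AE_iff_null null_sets_def)
  moreover have "emeasure Mphi (space Mphi) = ennreal (2 * (pi / sqrt 2))"
    by (simp add: emeasure_restrict_space Iphi_def)
  ultimately show False by simp
qed

text \<open>Subtracting a multiple of a fixed \<open>e\<close> with nonzero mean turns any test
  function into one of mean zero, and testing with \<open>e\<close> forces the value of
  \<open>c\<close>. Such an \<open>e\<close> exists, since otherwise the fundamental lemma would
  make the constant 1 vanish almost everywhere.\<close>

lemma dubois_reymond:
  assumes f: "f \<in> L2_space Mphi"
    and z: "\<And>\<psi>. \<psi> \<in> test_functions Iphi \<Longrightarrow> (LINT x|Mphi. \<psi> x) = 0 \<Longrightarrow> (LINT x|Mphi. f x * \<psi> x) = 0"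
  obtains c where "AE x in Mphi. f x = c"
proof -
  have "\<exists>e\<in>test_functions Iphi. (LINT x|Mphi. e x) \<noteq> 0"
  proof (rule ccontr)
    assume "\<not> ?thesis"
    then have "AE x in Mphi. (1::complex) = 0" by (intro fundamental_lemma) (auto simp: finite_measure.integrable_const)
    then show False using not_AE_Mphi_False by simp
  qed
  then obtain e where e: "e \<in> test_functions Iphi" "(LINT x|Mphi. e x) \<noteq> 0" by blast
  define c where "c = (LINT x|Mphi. f x * e x) / (LINT x|Mphi. e x)"
  have "AE x in Mphi. f x - c = 0"
  proof (rule fundamental_lemma)
    show "integrable Mphi (\<lambda>x. f x - c)"
      by (intro Bochner_Integration.integrable_diff L2_integrable f finite_measure.integrable_const) auto
    fix \<psi> assume \<psi>: "\<psi> \<in> test_functions Iphi"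
    define s where "s = (LINT x|Mphi. \<psi> x) / (LINT x|Mphi. e x)"
    have t: "(\<lambda>x. \<psi> x + (- s) * e x) \<in> test_functions Iphi" by (intro test_add test_scale \<psi> e)
    have "(LINT x|Mphi. \<psi> x + (- s) * e x) = 0"
      using e \<psi> test_integrable by (simp add: s_def)
    from z[OF t this] have "(LINT x|Mphi. f x * \<psi> x + (- s) * (f x * e x)) = 0" by (simp add: algebra_simps)
    then have "(LINT x|Mphi. f x * \<psi> x) = s * (LINT x|Mphi. f x * e x)"
      using cont_test_integrable[OF f \<psi>] cont_test_integrable[OF f e(1)] by simp
    also have "\<dots> = c * (LINT x|Mphi. \<psi> x)" by (simp add: s_def c_def)
    finally show "(LINT x|Mphi. (f x - c) * \<psi> x) = 0"
      using cont_test_integrable[OF f \<psi>] test_integrable[OF \<psi>] by (simp add: left_diff_distrib)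
  qed
  then show thesis by (intro that[of c]) simp
qed

text \<open>The same elimination with a second functional: \<open>e\<close> has mean zero but is not
  annihilated by \<open>Y\<close>. If no such \<open>e\<close> exists, the second constraint follows
  from the first and \<open>d = 0\<close> works.\<close>

lemma dubois_reymond2:
  assumes f: "f \<in> L2_space Mphi" and Y: "Y \<in> L2_space Mphi"
    and z: "\<And>\<psi>. \<psi> \<in> test_functions Iphi \<Longrightarrow> (LINT x|Mphi. \<psi> x) = 0 \<Longrightarrow> (LINT x|Mphi. Y x * \<psi> x) = 0 \<Longrightarrow>
      (LINT x|Mphi. f x * \<psi> x) = 0"
  obtains c d where "AE x in Mphi. f x = c + d * Y x"
proof (cases "\<exists>e\<in>test_functions Iphi. (LINT x|Mphi. e x) = 0 \<and> (LINT x|Mphi. Y x * e x) \<noteq> 0")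
  case False
  then obtain c where "AE x in Mphi. f x = c" using dubois_reymond[OF f] z by metis
  then show thesis by (intro that[of c 0]) simp
next
  case True
  then obtain e where e: "e \<in> test_functions Iphi" "(LINT x|Mphi. e x) = 0" "(LINT x|Mphi. Y x * e x) \<noteq> 0" by blast
  define d where "d = (LINT x|Mphi. f x * e x) / (LINT x|Mphi. Y x * e x)"
  have "(LINT x|Mphi. (f x - d * Y x) * \<psi> x) = 0" if \<psi>: "\<psi> \<in> test_functions Iphi" "(LINT x|Mphi. \<psi> x) = 0" for \<psi>
  proof -
    define s where "s = (LINT x|Mphi. Y x * \<psi> x) / (LINT x|Mphi. Y x * e x)"
    note int = cont_test_integrable[OF f \<psi>(1)] cont_test_integrable[OF f e(1)]
      cont_test_integrable[OF Y \<psi>(1)] cont_test_integrable[OF Y e(1)]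
    have t: "(\<lambda>x. \<psi> x + (- s) * e x) \<in> test_functions Iphi" by (intro test_add test_scale \<psi> e)
    have 1: "(LINT x|Mphi. \<psi> x + (- s) * e x) = 0"
      using e \<psi> test_integrable by simp
    have "(LINT x|Mphi. Y x * \<psi> x + (- s) * (Y x * e x)) = 0"
      using int e(3) by (simp add: s_def)
    then have 2: "(LINT x|Mphi. Y x * (\<psi> x + (- s) * e x)) = 0" by (simp add: algebra_simps)
    from z[OF t 1 2] have "(LINT x|Mphi. f x * \<psi> x + (- s) * (f x * e x)) = 0" by (simp add: algebra_simps)
    then have "(LINT x|Mphi. f x * \<psi> x) = s * (LINT x|Mphi. f x * e x)" using int by simp
    also have "\<dots> = d * (LINT x|Mphi. Y x * \<psi> x)" by (simp add: s_def d_def)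
    finally show ?thesis using int by (simp add: left_diff_distrib mult.assoc)
  qed
  then obtain c where "AE x in Mphi. f x - d * Y x = c"
    using dubois_reymond[OF L2_diff[OF f L2_scale[OF Y]]] by metis
  then have "AE x in Mphi. f x = c + d * Y x" by eventually_elim (simp add: algebra_simps)
  then show thesis by (rule that)
qed

section \<open>Essential self-adjointness\<close>

text \<open>\<open>L + 6 = - \<phi>\<^sup>3 \<partial> \<phi>\<^sup>-\<^sup>4 \<partial> \<phi>\<^sup>3\<close>, so \<open>(L + 6) u = 0\<close> has the solutions \<open>\<phi>\<^sup>-\<^sup>3 (c + d Y)\<close>.\<close>

definition Yphi :: "real \<Rightarrow> real" where
  "Yphi x = 3 / 2 * (x - phi01 x * dphi x) - 1 / 2 * (phi01 x ^ 3 * dphi x)"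

lemma DERIV_Yphi: "(Yphi has_real_derivative phi01 x ^ 4) (at x within S)"
proof -
  have "(Yphi has_real_derivative 3 / 2 * (1 - (dphi x * dphi x - (phi01 x * phi01 x) / 2))
      - 1 / 2 * (3 * (phi01 x * phi01 x) * (dphi x * dphi x) - (phi01 x * phi01 x) * (phi01 x * phi01 x) / 2)) (at x within S)"
    unfolding Yphi_def[abs_def]
    by (auto intro!: derivative_eq_intros DERIV_phi01 DERIV_dphi simp: field_simps power2_eq_square power3_eq_cube)
  moreover have "dphi x * dphi x = 1 - (phi01 x * phi01 x) / 2" using phi01_dphi[of x] by (simp add: field_simps)
  ultimately show ?thesis by (simp add: algebra_simps power4_eq_xxxx)
qed

lemma smooth_on_Yphi: "smooth_on S Yphi"
proof -
  have "smooth_on UNIV Yphi" unfolding Yphi_def by (intro smooth_intros) auto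
  then show ?thesis by (rule smooth_on_subset) simp
qed

lemma Yphi_endpoint: "Yphi (pi / sqrt 2) = 3 / 2 * (pi / sqrt 2)" "Yphi (- (pi / sqrt 2)) = - 3 / 2 * (pi / sqrt 2)"
  by (simp_all add: Yphi_def phi01_endpoint)

lemma test_integral_by_parts:
  assumes f: "f \<in> test_functions Iphi" and p: "\<And>x. (p has_real_derivative p' x) (at x)" "smooth_on Iphi p"
    and p': "smooth_on Iphi p'"
  shows "(LINT x|Mphi. of_real (p x) * vderiv f x) = - (LINT x|Mphi. of_real (p' x) * f x)"
proof -
  have t: "(\<lambda>x. of_real (p x) * f x) \<in> test_functions Iphi"
    by (intro test_mult[OF f] smooth_on_of_real p open_Iphi)
  have "vderiv (\<lambda>x. of_real (p x) * f x) x = of_real (p x) * vderiv f x + of_real (p' x) * f x" for x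
    using p(1) by (intro vderivI has_vector_derivative_mult has_vector_derivative_of_real test_vderiv[OF f])
      (simp add: has_real_derivative_iff_has_vector_derivative)
  then have "(LINT x|Mphi. of_real (p x) * vderiv f x + of_real (p' x) * f x) = 0"
    using integral_test_deriv[OF t] by simp
  moreover have "integrable Mphi (\<lambda>x. of_real (p x) * vderiv f x)" "integrable Mphi (\<lambda>x. of_real (p' x) * f x)"
    by (intro test_integrable test_mult[OF f] test_mult[OF test_vderiv_in[OF f]] smooth_on_of_real p p' open_Iphi)+
  ultimately show ?thesis by (simp add: eq_neg_iff_add_eq_0)
qed

text \<open>The factors of \<open>L + 6\<close> are inverted one at a time:
  \<open>\<Psi>' = \<psi>\<close>, then \<open>\<rho>' = phi\<^sup>4 \<Psi>\<close>, then
  \<open>v = phi\<^sup>-\<^sup>3 \<rho>\<close>. The two conditions make \<open>\<Psi>\<close> and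
  \<open>\<rho>\<close> test functions, the second one after integration by parts with
  \<open>Yphi' = phi\<^sup>4\<close>.\<close>

lemma L6_range:
  assumes \<psi>: "\<psi> \<in> test_functions Iphi" and z: "(LINT x|Mphi. \<psi> x) = 0" "(LINT x|Mphi. of_real (Yphi x) * \<psi> x) = 0"
  obtains v where "v \<in> test_functions Iphi"
    "\<And>x. x \<in> Iphi \<Longrightarrow> L_expr phi01 v x + 6 * v x = - (of_real (phi01 x ^ 3) * \<psi> x)"
proof -
  obtain \<Psi> where \<Psi>: "\<Psi> \<in> test_functions Iphi" "\<And>x. (\<Psi> has_vector_derivative \<psi> x) (at x)"
    using test_antiderivative[OF \<psi> z(1)] by blast
  have s4: "smooth_on Iphi (\<lambda>x. phi01 x ^ 4)" by (intro smooth_intros) simp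
  have "(LINT x|Mphi. of_real (Yphi x) * vderiv \<Psi> x) = - (LINT x|Mphi. of_real (phi01 x ^ 4) * \<Psi> x)"
    by (rule test_integral_by_parts[OF \<Psi>(1) DERIV_Yphi smooth_on_Yphi s4])
  moreover have "vderiv \<Psi> x = \<psi> x" for x using \<Psi>(2) by (rule vderivI)
  ultimately have "(LINT x|Mphi. of_real (phi01 x ^ 4) * \<Psi> x) = 0" using z(2) by simp
  moreover have "(\<lambda>x. of_real (phi01 x ^ 4) * \<Psi> x) \<in> test_functions Iphi"
    by (intro test_mult \<Psi> smooth_on_of_real s4 open_Iphi)
  ultimately obtain \<rho> where \<rho>: "\<rho> \<in> test_functions Iphi"
    "\<And>x. (\<rho> has_vector_derivative of_real (phi01 x ^ 4) * \<Psi> x) (at x)"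
    using test_antiderivative by blast
  define v where "v x = of_real (inverse (phi01 x ^ 3)) * \<rho> x" for x
  define k where "k x = inverse (phi01 x ^ 2) *\<^sub>R \<rho> x" for x
  define k1 where "k1 x = (phi01 x ^ 2) *\<^sub>R \<Psi> x + (- 2 * dphi x * inverse (phi01 x ^ 3)) *\<^sub>R \<rho> x" for x
  have v: "v \<in> test_functions Iphi" unfolding v_def
    by (intro test_mult \<rho> smooth_intros) (auto simp: phi01_nz)
  have "L_expr phi01 v x + 6 * v x = - (of_real (phi01 x ^ 3) * \<psi> x)" if x: "x \<in> Iphi" for x
  proof -
    have eq: "phi01 y *\<^sub>R v y = k y" if "y \<in> Iphi" for y
      using phi01_nz[OF that] by (simp add: v_def k_def scaleR_conv_of_real power2_eq_square power3_eq_cube)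
    have d1: "(k has_vector_derivative k1 y) (at y)" if y: "y \<in> Iphi" for y
    proof -
      have "((\<lambda>x. inverse (phi01 x ^ 2)) has_real_derivative - 2 * dphi y * inverse (phi01 y ^ 3)) (at y)"
        using phi01_nz[OF y] by (auto intro!: derivative_eq_intros DERIV_phi01 simp: field_simps power2_eq_square power3_eq_cube)
      from has_vector_derivative_scaleR[OF this \<rho>(2)[of y]]
      show ?thesis unfolding k_def[abs_def] k1_def
      proof (rule has_vector_derivative_eq_rhs)
        show "inverse (phi01 y ^ 2) *\<^sub>R (of_real (phi01 y ^ 4) * \<Psi> y) + (- 2 * dphi y * inverse (phi01 y ^ 3)) *\<^sub>R \<rho> y
            = phi01 y ^ 2 *\<^sub>R \<Psi> y + (- 2 * dphi y * inverse (phi01 y ^ 3)) *\<^sub>R \<rho> y"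
          using phi01_nz[OF y] by (simp add: scaleR_conv_of_real field_simps power2_eq_square power4_eq_xxxx)
      qed
    qed
    let ?k2 = "((phi01 x ^ 2) *\<^sub>R \<psi> x + (2 * phi01 x * dphi x) *\<^sub>R \<Psi> x) +
       ((- 2 * dphi x * inverse (phi01 x ^ 3)) *\<^sub>R (of_real (phi01 x ^ 4) * \<Psi> x) + ((6 - 2 * phi01 x ^ 2) * inverse (phi01 x ^ 4)) *\<^sub>R \<rho> x)"
    have d2: "(k1 has_vector_derivative ?k2) (at x)"
    proof -
      have 1: "((\<lambda>x. phi01 x ^ 2) has_real_derivative 2 * phi01 x * dphi x) (at x)"
        by (auto intro!: derivative_eq_intros DERIV_phi01)
      have 2: "((\<lambda>x. - 2 * dphi x * inverse (phi01 x ^ 3)) has_real_derivative (6 - 2 * phi01 x ^ 2) * inverse (phi01 x ^ 4)) (at x)"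
      proof -
        have "((\<lambda>x. - 2 * dphi x * inverse (phi01 x ^ 3)) has_real_derivative
          (phi01 x * phi01 x + 6 * (dphi x * dphi x)) * inverse (phi01 x ^ 4)) (at x)"
          using phi01_nz[OF x] by (auto intro!: derivative_eq_intros DERIV_phi01 DERIV_dphi
              simp: field_simps power2_eq_square power3_eq_cube power4_eq_xxxx)
        moreover have "phi01 x * phi01 x + 6 * (dphi x * dphi x) = 6 - 2 * phi01 x ^ 2"
          using phi01_dphi[of x] by (simp add: power2_eq_square)
        ultimately show ?thesis by simp
      qed
      show ?thesis unfolding k1_def[abs_def]
        by (intro has_vector_derivative_add has_vector_derivative_scaleR 1 2 \<Psi>(2) \<rho>(2))
    qed
    have "L_expr phi01 v x = - (phi01 x *\<^sub>R (?k2 + 2 * k x))"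
      by (rule L_exprI(1)[OF open_Iphi x eq d1 d2])
    also have "\<dots> = - (of_real (phi01 x ^ 3) * \<psi> x) - 6 * v x"
      using phi01_nz[OF x] by (simp add: k_def v_def scaleR_conv_of_real field_simps power2_eq_square power3_eq_cube power4_eq_xxxx)
    finally show ?thesis by simp
  qed
  with v show thesis by (rule that)
qed

text \<open>A function orthogonal to the range solves \<open>(L + 6) y = 0\<close> weakly, so du
  Bois-Reymond gives \<open>phi\<^sup>3 cnj y = c + d Yphi\<close>. Square integrability forces the
  right side to vanish at both endpoints, where \<open>Yphi\<close> takes opposite nonzero values;
  hence \<open>c = d = 0\<close>.\<close>

lemma L6_kernel_trivial:
  assumes y: "y \<in> L2_space Mphi"
    and z: "\<And>w. w \<in> test_functions Iphi \<Longrightarrow> L2_inner Mphi (\<lambda>x. L_expr phi01 w x + 6 * w x) y = 0"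
  shows "AE x in Mphi. y x = 0"
proof -
  define f where "f x = of_real (phi01 x ^ 3) * cnj (y x)" for x
  have phi3: "continuous_on Iphi (\<lambda>x. phi01 x ^ 3)" "\<And>x. \<bar>phi01 x\<bar> \<le> 2"
  proof -
    show "continuous_on Iphi (\<lambda>x. phi01 x ^ 3)" by (intro continuous_intros)
    have "(phi01 x)\<^sup>2 \<le> 2\<^sup>2" for x
      using phi01_dphi[of x] zero_le_square[of "dphi x"] unfolding power2_eq_square by linarith
    then show "\<bar>phi01 x\<bar> \<le> 2" for x using abs_le_square_iff[of "phi01 x" 2] by simp
  qed
  have mult: "(\<lambda>x. of_real (phi01 x ^ m) * g x) \<in> L2_space Mphi" if g: "g \<in> L2_space Mphi" for g m
  proof -
    have c: "cb (\<lambda>x. phi01 x ^ m)" by (induction m) auto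
    have [measurable]: "g \<in> borel_measurable Mphi" using g by (rule L2_measurable)
    have [measurable]: "(\<lambda>x. complex_of_real (phi01 x ^ m)) \<in> borel_measurable Mphi"
      by (intro borel_measurable_integrable ccb_integrable) (simp add: ccb_def c)
    have "integrable Mphi (\<lambda>x. (2 ^ m)\<^sup>2 * (cmod (g x))\<^sup>2)"
      using L2_sq_integrable[OF g] by simp
    then have "integrable Mphi (\<lambda>x. (cmod (of_real (phi01 x ^ m) * g x))\<^sup>2)"
    proof (rule Bochner_Integration.integrable_bound)
      show "AE x in Mphi. norm ((cmod (of_real (phi01 x ^ m) * g x))\<^sup>2) \<le> norm ((2 ^ m)\<^sup>2 * (cmod (g x))\<^sup>2)"
        using phi3(2) by (intro AE_I2) (auto simp: norm_mult norm_power power_mult_distrib intro!: mult_right_mono power_mono)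
    qed measurable
    moreover have "(\<lambda>x. of_real (phi01 x ^ m) * g x) \<in> borel_measurable Mphi" by measurable
    ultimately show ?thesis unfolding L2_space_def by blast
  qed
  have cy: "(\<lambda>x. cnj (y x)) \<in> L2_space Mphi" using y by (auto simp: L2_space_def)
  have f: "f \<in> L2_space Mphi" unfolding f_def by (rule mult[OF cy])
  have Y: "(\<lambda>x. complex_of_real (Yphi x)) \<in> L2_space Mphi"
  proof (intro ccb_L2)
    have "cb (\<lambda>x. x)" by (rule cbI[of _ "pi / sqrt 2"]) (auto simp: Iphi_def intro: continuous_intros)
    moreover have "cb (\<lambda>x. phi01 x ^ 3)" unfolding power3_eq_cube by auto
    ultimately have "cb Yphi" unfolding Yphi_def[abs_def] by auto
    then show "ccb (\<lambda>x. complex_of_real (Yphi x))" by (simp add: ccb_def)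
  qed
  obtain c d where cd: "AE x in Mphi. f x = c + d * of_real (Yphi x)"
  proof (rule dubois_reymond2[OF f Y])
    fix \<psi> assume \<psi>: "\<psi> \<in> test_functions Iphi" "(LINT x|Mphi. \<psi> x) = 0" "(LINT x|Mphi. of_real (Yphi x) * \<psi> x) = 0"
    obtain v where v: "v \<in> test_functions Iphi"
      "\<And>x. x \<in> Iphi \<Longrightarrow> L_expr phi01 v x + 6 * v x = - (of_real (phi01 x ^ 3) * \<psi> x)"
      using L6_range[OF \<psi>] by blast
    have "(LINT x|Mphi. f x * \<psi> x) = (LINT x|Mphi. - ((L_expr phi01 v x + 6 * v x) * cnj (y x)))"
      using v(2) by (intro Bochner_Integration.integral_cong) (auto simp: f_def)
    also have "\<dots> = - L2_inner Mphi (\<lambda>x. L_expr phi01 v x + 6 * v x) y"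
      by (simp add: L2_inner_def)
    finally show "(LINT x|Mphi. f x * \<psi> x) = 0" using z[OF v(1)] by simp
  qed
  define k where "k x = c + d * of_real (Yphi x)" for x
  have contk: "isCont k x" for x
    unfolding k_def using DERIV_isCont[OF DERIV_Yphi[of x UNIV]] by (intro continuous_intros)
  \<comment> \<open>Keeping two of the three powers of \<open>phi01\<close> on \<open>y\<close>
    leaves the singularity \<open>k / phi01\<close> that the endpoint lemmas treat.\<close>
  define u where "u x = k x / of_real (phi01 x)" for x
  have ae: "AE x in Mphi. of_real (phi01 x ^ 2) * cnj (y x) = u x"
  proof (rule AE_mp[OF cd], intro AE_I2 impI)
    fix x assume x: "x \<in> space Mphi" and "f x = c + d * of_real (Yphi x)"
    then have "of_real (phi01 x ^ 3) * cnj (y x) = k x" by (simp add: f_def k_def)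
    then show "of_real (phi01 x ^ 2) * cnj (y x) = u x"
      using phi01_nz[of x] x by (simp add: u_def field_simps power2_eq_square power3_eq_cube)
  qed
  have yL: "(\<lambda>x. of_real (phi01 x ^ 2) * cnj (y x)) \<in> L2_space Mphi" by (rule mult[OF cy])
  have [measurable]: "u \<in> borel_measurable Mphi"
  proof -
    have "continuous_on Iphi u" unfolding u_def
      using contk by (intro continuous_intros continuous_at_imp_continuous_on ballI) (auto simp: phi01_nz)
    then show ?thesis by (intro continuous_imp_measurable_on_sets_lebesgue) (auto simp: Iphi_def)
  qed
  have "integrable Mphi (\<lambda>x. (cmod (u x))\<^sup>2)"
  proof (rule integrable_cong_AE_imp[OF L2_sq_integrable[OF yL]])
    show "AE x in Mphi. (cmod (of_real (phi01 x ^ 2) * cnj (y x)))\<^sup>2 = (cmod (u x))\<^sup>2"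
      using ae by eventually_elim (simp only:)
  qed measurable
  then have u: "u \<in> L2_space Mphi" by (simp add: L2_space_def)
  have "k (pi / sqrt 2) = 0"
    using u by (intro L2_end_right[OF contk, of "- (pi / sqrt 2)" u]) (auto simp: u_def Iphi_def)
  moreover have "k (- (pi / sqrt 2)) = 0"
    using u by (intro L2_end_left[OF contk, of "pi / sqrt 2" u]) (auto simp: u_def Iphi_def)
  ultimately have k: "c + d * of_real (3 / 2 * (pi / sqrt 2)) = 0" "c - d * of_real (3 / 2 * (pi / sqrt 2)) = 0"
    unfolding k_def Yphi_endpoint by simp_all
  define K where "K = complex_of_real (3 / 2 * (pi / sqrt 2))"
  have "(c + d * K) + (c - d * K) = 0" using k by (simp only: K_def) simp
  then have c0: "c = 0" by simp
  have "K \<noteq> 0" by (simp add: K_def)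
  then have d0: "d = 0" using k(1) c0 by (simp flip: K_def)
  with cd show ?thesis
  proof (elim AE_mp, intro AE_I2 impI)
    fix x assume "x \<in> space Mphi" "f x = c + d * of_real (Yphi x)"
    then show "y x = 0" using phi01_nz[of x] c0 d0 by (simp add: f_def)
  qed
qed

lemma L_expr_add:
  assumes "w \<in> test_functions Iphi" "v \<in> test_functions Iphi"
  shows "L_expr phi01 (\<lambda>x. w x + v x) x = L_expr phi01 w x + L_expr phi01 v x"
proof -
  have 1: "vderiv (\<lambda>x. w x + v x) = (\<lambda>x. vderiv w x + vderiv v x)"
    using assms by (intro ext vderivI has_vector_derivative_add test_vderiv)
  have 2: "vderiv (\<lambda>x. vderiv w x + vderiv v x) = (\<lambda>x. vderiv (vderiv w) x + vderiv (vderiv v) x)"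
    using assms by (intro ext vderivI has_vector_derivative_add test_vderiv test_vderiv_in)
  show ?thesis
    unfolding L_expr_eq[OF test_smooth[OF test_add[OF assms]] open_UNIV UNIV_I]
      L_expr_eq[OF test_smooth[OF assms(1)] open_UNIV UNIV_I] L_expr_eq[OF test_smooth[OF assms(2)] open_UNIV UNIV_I] 1 2
    by (simp add: algebra_simps)
qed

lemma L_expr_scale:
  assumes "w \<in> test_functions Iphi"
  shows "L_expr phi01 (\<lambda>x. c * w x) x = c * L_expr phi01 w x"
proof -
  have 1: "vderiv (\<lambda>x. c * w x) = (\<lambda>x. c * vderiv w x)"
    using assms by (intro ext vderivI has_vector_derivative_mult_right test_vderiv)
  have 2: "vderiv (\<lambda>x. c * vderiv w x) = (\<lambda>x. c * vderiv (vderiv w) x)"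
    using assms by (intro ext vderivI has_vector_derivative_mult_right test_vderiv test_vderiv_in)
  show ?thesis
    unfolding L_expr_eq[OF test_smooth[OF test_scale[OF assms]] open_UNIV UNIV_I]
      L_expr_eq[OF test_smooth[OF assms(1)] open_UNIV UNIV_I] 1 2
    by (simp add: algebra_simps scaleR_conv_of_real)
qed

lemma adjoint_iff:
  "(u, f) \<in> adjoint_op Mphi (L_min phi01 Iphi) \<longleftrightarrow> u \<in> L2_space Mphi \<and> f \<in> L2_space Mphi \<and>
    (\<forall>v\<in>test_functions Iphi. L2_inner Mphi (L_expr phi01 v) u = L2_inner Mphi v f)"
  by (auto simp: adjoint_op_def L_min_def)

text \<open>The form of \<open>L\<close> is bounded below by -2, so that of \<open>L + 6\<close> is
  at least 4; Cauchy-Schwarz turns this into a norm estimate.\<close>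

lemma L6_coercive:
  assumes "w \<in> test_functions Iphi"
  shows "4 * L2_norm Mphi w \<le> L2_norm Mphi (\<lambda>x. L_expr phi01 w x + 6 * w x)"
proof (cases "L2_norm Mphi w = 0")
  case False
  then have n: "L2_norm Mphi w > 0" using L2_norm_nonneg[of Mphi w] by linarith
  note L2 = test_L2[OF assms] test_L2[OF L_expr_test[OF assms]]
  have "Re (L2_inner Mphi (\<lambda>x. L_expr phi01 w x + 6 * w x) w) = Re (L2_inner Mphi (L_expr phi01 w) w) + 6 * (L2_norm Mphi w)\<^sup>2"
    using L2 by (simp add: L2_inner_add_left L2_scale L2_inner_scale_left L2_inner_self del: of_real_power)
  then have "4 * (L2_norm Mphi w)\<^sup>2 \<le> Re (L2_inner Mphi (\<lambda>x. L_expr phi01 w x + 6 * w x) w)"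
    using creg_form_lower[OF creg_test[OF assms]] by simp
  also have "\<dots> \<le> L2_norm Mphi (\<lambda>x. L_expr phi01 w x + 6 * w x) * L2_norm Mphi w"
    using L2 by (intro order_trans[OF complex_Re_le_cmod] L2_Cauchy_Schwarz L2_add L2_scale)
  finally have "(4 * L2_norm Mphi w) * L2_norm Mphi w \<le> L2_norm Mphi (\<lambda>x. L_expr phi01 w x + 6 * w x) * L2_norm Mphi w"
    by (simp add: power2_eq_square)
  then show ?thesis using n by (rule mult_right_le_imp_le)
qed simp

text \<open>Essential self-adjointness: \<open>L + 6 \<ge> 4\<close> on test functions and its range is dense.\<close>

lemma adjoint_core:
  assumes uf: "(u, f) \<in> adjoint_op Mphi (L_min phi01 Iphi)"
  obtains w where "\<And>n::nat. w n \<in> test_functions Iphi" "(\<lambda>n. L2_norm Mphi (\<lambda>x. w n x - u x)) \<longlonglongrightarrow> 0"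
    "(\<lambda>n. L2_norm Mphi (\<lambda>x. L_expr phi01 (w n) x - f x)) \<longlonglongrightarrow> 0"
proof -
  define S where "S = (\<lambda>w x. L_expr phi01 w x + 6 * w x) ` test_functions Iphi"
  have uL: "u \<in> L2_space Mphi" and fL: "f \<in> L2_space Mphi"
    and adj: "\<And>v. v \<in> test_functions Iphi \<Longrightarrow> L2_inner Mphi (L_expr phi01 v) u = L2_inner Mphi v f"
    using uf by (auto simp: adjoint_iff)
  define F where "F x = f x + 6 * u x" for x
  have F: "F \<in> L2_space Mphi" unfolding F_def by (intro L2_add L2_scale uL fL)
  have L6: "(\<lambda>x. L_expr phi01 w x + 6 * w x) \<in> L2_space Mphi" if "w \<in> test_functions Iphi" for w
    using that by (intro L2_add L2_scale test_L2 L_expr_test)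
  have "\<exists>w\<in>test_functions Iphi. L2_norm Mphi (\<lambda>x. (L_expr phi01 w x + 6 * w x) - F x) < 1 / real (Suc n)" for n
  proof -
    have "\<exists>s\<in>S. L2_norm Mphi (\<lambda>x. s x - F x) < 1 / real (Suc n)"
    proof (rule L2_dense[of Mphi S F "1 / real (Suc n)"])
      show "S \<noteq> {}" unfolding S_def using test_zero by blast
      show "(\<lambda>x. p x + q x) \<in> S" if pq: "p \<in> S" "q \<in> S" for p q
      proof -
        obtain w v where "w \<in> test_functions Iphi" "v \<in> test_functions Iphi"
          "p = (\<lambda>x. L_expr phi01 w x + 6 * w x)" "q = (\<lambda>x. L_expr phi01 v x + 6 * v x)"
          using pq by (auto simp: S_def)
        then show ?thesis unfolding S_def
          by (intro image_eqI[of _ _ "\<lambda>x. w x + v x"] test_add) (auto simp: L_expr_add algebra_simps)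
      qed
      show "(\<lambda>x. c * p x) \<in> S" if pS: "p \<in> S" for c p
      proof -
        obtain w where "w \<in> test_functions Iphi" "p = (\<lambda>x. L_expr phi01 w x + 6 * w x)"
          using pS by (auto simp: S_def)
        then show ?thesis unfolding S_def
          by (intro image_eqI[of _ _ "\<lambda>x. c * w x"] test_scale) (auto simp: L_expr_scale algebra_simps)
      qed
      show "AE x in Mphi. y x = 0" if "y \<in> L2_space Mphi" "\<And>s. s \<in> S \<Longrightarrow> L2_inner Mphi s y = 0" for y
        using that by (intro L6_kernel_trivial) (auto simp: S_def)
    qed (use L6 F in \<open>auto simp: S_def\<close>)
    then show ?thesis by (auto simp: S_def)
  qed
  then obtain w where w: "\<And>n. w n \<in> test_functions Iphi"
    and wF: "\<And>n. L2_norm Mphi (\<lambda>x. (L_expr phi01 (w n) x + 6 * w n x) - F x) < 1 / real (Suc n)" by metis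
  have wL: "w n \<in> L2_space Mphi" for n by (intro test_L2 w)
  have lim_F: "(\<lambda>n. L2_norm Mphi (\<lambda>x. (L_expr phi01 (w n) x + 6 * w n x) - F x)) \<longlonglongrightarrow> 0"
    using wF by (intro Lim_null_comparison[OF _ LIMSEQ_Suc[OF lim_1_over_n]]) (auto intro!: always_eventually less_imp_le)
  \<comment> \<open>Coercivity turns convergence of the images under \<open>L + 6\<close> into
    convergence of the \<open>w n\<close>.\<close>
  have cauchy: "4 * L2_norm Mphi (\<lambda>x. w m x - w n x) \<le> 1 / real (Suc m) + 1 / real (Suc n)" for m n
  proof -
    have t: "(\<lambda>x. w m x + (-1) * w n x) \<in> test_functions Iphi" by (intro test_add test_scale w)
    have "4 * L2_norm Mphi (\<lambda>x. w m x + (-1) * w n x) \<le>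
        L2_norm Mphi (\<lambda>x. L_expr phi01 (\<lambda>x. w m x + (-1) * w n x) x + 6 * (w m x + (-1) * w n x))"
      by (rule L6_coercive[OF t])
    also have "(\<lambda>x. L_expr phi01 (\<lambda>x. w m x + (-1) * w n x) x + 6 * (w m x + (-1) * w n x)) =
        (\<lambda>x. ((L_expr phi01 (w m) x + 6 * w m x) - F x) - ((L_expr phi01 (w n) x + 6 * w n x) - F x))"
      using L_expr_add[OF w test_scale[OF w, of "-1"]] L_expr_scale[OF w, of "-1"] by (auto simp: algebra_simps)
    also have "L2_norm Mphi \<dots> \<le> L2_norm Mphi (\<lambda>x. (L_expr phi01 (w m) x + 6 * w m x) - F x)
        + L2_norm Mphi (\<lambda>x. (L_expr phi01 (w n) x + 6 * w n x) - F x)"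
      by (intro L2_norm_triangle_diff L2_diff L6 w F)
    also have "\<dots> \<le> 1 / real (Suc m) + 1 / real (Suc n)"
      using wF[of m] wF[of n] by (intro add_mono less_imp_le)
    finally show ?thesis by simp
  qed
  obtain u' where u': "u' \<in> L2_space Mphi" and lim': "(\<lambda>n. L2_norm Mphi (\<lambda>x. w n x - u' x)) \<longlonglongrightarrow> 0"
  proof (rule L2_complete[OF _ wL])
    fix e :: real assume e: "e > 0"
    obtain N where N: "N > 0" "inverse (real N) < e" using ex_inverse_of_nat_less[OF e] by auto
    show "\<exists>N. \<forall>m\<ge>N. \<forall>n\<ge>N. L2_norm Mphi (\<lambda>x. w m x - w n x) < e"
    proof (intro exI allI impI)
      fix m n assume "N \<le> m" "N \<le> n"
      then have "1 / real (Suc m) \<le> 1 / real N" "1 / real (Suc n) \<le> 1 / real N"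
        using N by (auto simp: frac_le)
      then show "L2_norm Mphi (\<lambda>x. w m x - w n x) < e"
        using cauchy[of m n] N e unfolding inverse_eq_divide by linarith
    qed
  qed simp
  \<comment> \<open>Both \<open>u\<close> and \<open>u'\<close> solve \<open>(L + 6) u = F\<close>
    weakly, so their difference is orthogonal to the range of \<open>L + 6\<close>.\<close>
  have "AE x in Mphi. u x - u' x = 0"
  proof (rule L6_kernel_trivial)
    show d: "(\<lambda>x. u x - u' x) \<in> L2_space Mphi" by (intro L2_diff uL u')
    fix v assume v: "v \<in> test_functions Iphi"
    let ?v = "\<lambda>x. L_expr phi01 v x + 6 * v x"
    have sym: "L2_inner Mphi ?v (w n) = L2_inner Mphi v (\<lambda>x. L_expr phi01 (w n) x + 6 * w n x)" for n
      using creg_symmetric[OF creg_test[OF v] creg_test[OF w]] v w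
      by (simp add: L2_inner_add_left L2_inner_add_right L2_scale test_L2 L_expr_test L2_inner_scale_left L2_inner_scale_right)
    have "(\<lambda>n. L2_inner Mphi ?v (w n)) \<longlonglongrightarrow> L2_inner Mphi ?v u'"
      by (rule L2_inner_tendsto_const(2)[OF wL u' lim' L6[OF v]])
    moreover have "(\<lambda>n. L2_inner Mphi ?v (w n)) \<longlonglongrightarrow> L2_inner Mphi v F"
      unfolding sym by (rule L2_inner_tendsto_const(2)[OF L6[OF w] F lim_F test_L2[OF v]])
    ultimately have "L2_inner Mphi ?v u' = L2_inner Mphi v F" by (rule LIMSEQ_unique)
    also have "\<dots> = L2_inner Mphi ?v u"
      using adj[OF v] v uL fL unfolding F_def
      by (simp add: L2_inner_add_left L2_inner_add_right L2_scale test_L2 L_expr_test L2_inner_scale_left L2_inner_scale_right)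
    finally show "L2_inner Mphi ?v (\<lambda>x. u x - u' x) = 0"
      using L6[OF v] uL u' by (simp add: L2_inner_diff_right)
  qed
  then have eq: "L2_norm Mphi (\<lambda>x. w n x - u x) = L2_norm Mphi (\<lambda>x. w n x - u' x)" for n
    by (intro L2_norm_cong_AE L2_measurable L2_diff wL uL u') (auto elim: AE_mp)
  have lim_u: "(\<lambda>n. L2_norm Mphi (\<lambda>x. w n x - u x)) \<longlonglongrightarrow> 0" using lim' by (simp add: eq)
  have "(\<lambda>n. L2_norm Mphi (\<lambda>x. L_expr phi01 (w n) x - f x)) \<longlonglongrightarrow> 0"
  proof (rule Lim_null_comparison)
    show "(\<lambda>n. L2_norm Mphi (\<lambda>x. (L_expr phi01 (w n) x + 6 * w n x) - F x) + 6 * L2_norm Mphi (\<lambda>x. w n x - u x)) \<longlonglongrightarrow> 0"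
      using tendsto_add[OF lim_F tendsto_mult_left[OF lim_u, of 6]] by simp
    have "L2_norm Mphi (\<lambda>x. L_expr phi01 (w n) x - f x) \<le>
        L2_norm Mphi (\<lambda>x. (L_expr phi01 (w n) x + 6 * w n x) - F x) + 6 * L2_norm Mphi (\<lambda>x. w n x - u x)" for n
    proof -
      have "(\<lambda>x. L_expr phi01 (w n) x - f x) = (\<lambda>x. ((L_expr phi01 (w n) x + 6 * w n x) - F x) - 6 * (w n x - u x))"
        by (auto simp: F_def algebra_simps)
      then show ?thesis
        using L2_norm_triangle_diff[OF L2_diff[OF L6[OF w] F] L2_scale[OF L2_diff[OF wL uL], of 6], of n n]
        by (simp only: L2_norm_scale norm_numeral)
    qed
    then show "\<forall>\<^sub>F n in sequentially. norm (L2_norm Mphi (\<lambda>x. L_expr phi01 (w n) x - f x)) \<le>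
        L2_norm Mphi (\<lambda>x. (L_expr phi01 (w n) x + 6 * w n x) - F x) + 6 * L2_norm Mphi (\<lambda>x. w n x - u x)"
      by simp
  qed
  with w lim_u show thesis by (rule that)
qed

lemma L2_norm_Cauchy:
  assumes "\<And>n. v n \<in> L2_space M" "u \<in> L2_space M" "(\<lambda>n. L2_norm M (\<lambda>x. v n x - u x)) \<longlonglongrightarrow> 0" "e > 0"
  obtains N where "\<And>m n. N \<le> m \<Longrightarrow> N \<le> n \<Longrightarrow> L2_norm M (\<lambda>x. v m x - v n x) < e"
proof -
  obtain N where N: "\<And>n. N \<le> n \<Longrightarrow> L2_norm M (\<lambda>x. v n x - u x) < e / 2"
    using order_tendstoD(2)[OF assms(3), of "e / 2"] assms(4) by (auto simp: eventually_sequentially)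
  have "L2_norm M (\<lambda>x. v m x - v n x) < e" if "N \<le> m" "N \<le> n" for m n
    using L2_norm_triangle3[OF assms(1)[of m] assms(2) assms(1)[of n]] N[OF that(1)] N[OF that(2)]
      L2_norm_minus_commute[of M u "v n"] by simp
  then show thesis by (rule that)
qed

text \<open>Elements of the adjoint are limits of test functions in the graph norm. By
  Cauchy-Schwarz the form of the differences then tends to 0, so the limits lie in the form domain
  and the Friedrichs restriction removes nothing.\<close>

lemma L_op_eq: "L_op phi01 Iphi = adjoint_op Mphi (L_min phi01 Iphi)"
proof -
  have "u \<in> form_domain Mphi (L_min phi01 Iphi)" if uf: "(u, f) \<in> adjoint_op Mphi (L_min phi01 Iphi)" for u f
  proof -
    have L2: "u \<in> L2_space Mphi" "f \<in> L2_space Mphi" using uf by (auto simp: adjoint_iff)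
    obtain w where w: "\<And>n::nat. w n \<in> test_functions Iphi" and lim: "(\<lambda>n. L2_norm Mphi (\<lambda>x. w n x - u x)) \<longlonglongrightarrow> 0"
      "(\<lambda>n. L2_norm Mphi (\<lambda>x. L_expr phi01 (w n) x - f x)) \<longlonglongrightarrow> 0"
      using uf by (rule adjoint_core) blast
    have wL: "w n \<in> L2_space Mphi" "L_expr phi01 (w n) \<in> L2_space Mphi" for n
      using w by (auto intro: test_L2 L_expr_test)
    have "\<exists>N. \<forall>m\<ge>N. \<forall>n\<ge>N. cmod (L2_inner Mphi (\<lambda>x. L_expr phi01 (w m) x - L_expr phi01 (w n) x) (\<lambda>x. w m x - w n x)) < e"
      if e: "e > 0" for e
    proof -
      obtain N1 where N1: "\<And>m n. N1 \<le> m \<Longrightarrow> N1 \<le> n \<Longrightarrow> L2_norm Mphi (\<lambda>x. w m x - w n x) < 1"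
        using L2_norm_Cauchy[OF wL(1) L2(1) lim(1), of 1] by auto
      obtain N2 where N2: "\<And>m n. N2 \<le> m \<Longrightarrow> N2 \<le> n \<Longrightarrow> L2_norm Mphi (\<lambda>x. L_expr phi01 (w m) x - L_expr phi01 (w n) x) < e"
        using L2_norm_Cauchy[OF wL(2) L2(2) lim(2) e] by auto
      show ?thesis
      proof (intro exI[of _ "max N1 N2"] allI impI)
        fix m n assume mn: "max N1 N2 \<le> m" "max N1 N2 \<le> n"
        have "cmod (L2_inner Mphi (\<lambda>x. L_expr phi01 (w m) x - L_expr phi01 (w n) x) (\<lambda>x. w m x - w n x)) \<le>
            L2_norm Mphi (\<lambda>x. L_expr phi01 (w m) x - L_expr phi01 (w n) x) * L2_norm Mphi (\<lambda>x. w m x - w n x)"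
          by (intro L2_Cauchy_Schwarz L2_diff wL)
        also have "\<dots> \<le> L2_norm Mphi (\<lambda>x. L_expr phi01 (w m) x - L_expr phi01 (w n) x) * 1"
          using N1[of m n] mn by (intro mult_left_mono) auto
        also have "\<dots> < e" using N2[of m n] mn by simp
        finally show "cmod (L2_inner Mphi (\<lambda>x. L_expr phi01 (w m) x - L_expr phi01 (w n) x) (\<lambda>x. w m x - w n x)) < e" .
      qed
    qed
    moreover have "\<forall>n. (w n, L_expr phi01 (w n)) \<in> L_min phi01 Iphi" using w by (auto simp: L_min_def)
    ultimately have "\<exists>v g. (\<forall>n. (v n, g n) \<in> L_min phi01 Iphi) \<and> (\<lambda>n. L2_norm Mphi (\<lambda>x. v n x - u x)) \<longlonglongrightarrow> 0 \<and>
      (\<forall>e>0. \<exists>N. \<forall>m\<ge>N. \<forall>n\<ge>N. cmod (L2_inner Mphi (\<lambda>x. g m x - g n x) (\<lambda>x. v m x - v n x)) < e)"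
      using lim(1) by - (rule exI[of _ w], rule exI[of _ "\<lambda>n. L_expr phi01 (w n)"], simp)
    then show ?thesis using L2(1) by (simp add: form_domain_def)
  qed
  then show ?thesis by (auto simp: L_op_def friedrichs_extension_def)
qed

section \<open>Eigenvalues and resolvent\<close>

abbreviation (input) Lphi :: "real op_graph" where "Lphi \<equiv> L_op phi01 Iphi"
abbreviation (input) P0 :: "real \<Rightarrow> complex" where "P0 \<equiv> \<lambda>x. of_real (phi01 x)"
abbreviation (input) P1 :: "real \<Rightarrow> complex" where "P1 \<equiv> \<lambda>x. of_real (dphi x)"

lemma Lphi_iff:
  "(u, f) \<in> Lphi \<longleftrightarrow> u \<in> L2_space Mphi \<and> f \<in> L2_space Mphi \<and>
    (\<forall>v\<in>test_functions Iphi. L2_inner Mphi (L_expr phi01 v) u = L2_inner Mphi v f)"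
  unfolding L_op_eq adjoint_iff ..

lemma Lphi_L2: "(u, f) \<in> Lphi \<Longrightarrow> u \<in> L2_space Mphi" "(u, f) \<in> Lphi \<Longrightarrow> f \<in> L2_space Mphi"
  by (simp_all add: Lphi_iff)

lemma Lphi_add: "(u, f) \<in> Lphi \<Longrightarrow> (v, g) \<in> Lphi \<Longrightarrow> (\<lambda>x. u x + v x, \<lambda>x. f x + g x) \<in> Lphi"
  by (simp add: Lphi_iff L2_add L2_inner_add_right test_L2 L_expr_test)

lemma Lphi_scale: "(u, f) \<in> Lphi \<Longrightarrow> (\<lambda>x. c * u x, \<lambda>x. c * f x) \<in> Lphi"
  by (simp add: Lphi_iff L2_scale L2_inner_scale_right)

lemma Lphi_diff: "(u, f) \<in> Lphi \<Longrightarrow> (v, g) \<in> Lphi \<Longrightarrow> (\<lambda>x. u x - v x, \<lambda>x. f x - g x) \<in> Lphi"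
  using Lphi_add[OF _ Lphi_scale[of v g "-1"], of u f] by simp

lemma creg_Lphi: assumes "creg u f" shows "(u, f) \<in> Lphi"
  using creg_symmetric[OF creg_test assms] creg_ccb[OF assms] by (auto simp: Lphi_iff intro: ccb_L2)

lemma Lphi_test: "w \<in> test_functions Iphi \<Longrightarrow> (w, L_expr phi01 w) \<in> Lphi"
  by (intro creg_Lphi creg_test)

lemma Lphi_P0: "(P0, \<lambda>x. - 2 * P0 x) \<in> Lphi" and Lphi_P1: "(P1, \<lambda>x. 0) \<in> Lphi"
  by (intro creg_Lphi creg_phi01 creg_dphi)+

lemma Lphi_coreE:
  assumes "(u, f) \<in> Lphi"
  obtains w where "\<And>n::nat. w n \<in> test_functions Iphi" "(\<lambda>n. L2_norm Mphi (\<lambda>x. w n x - u x)) \<longlonglongrightarrow> 0"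
    "(\<lambda>n. L2_norm Mphi (\<lambda>x. L_expr phi01 (w n) x - f x)) \<longlonglongrightarrow> 0"
  using assms unfolding L_op_eq by (rule adjoint_core) blast

lemma Lphi_symmetric:
  assumes uf: "(u, f) \<in> Lphi" and vg: "(v, g) \<in> Lphi"
  shows "L2_inner Mphi f v = L2_inner Mphi u g"
proof -
  note L2 = Lphi_L2[OF uf] Lphi_L2[OF vg]
  obtain w where w: "\<And>n::nat. w n \<in> test_functions Iphi" "(\<lambda>n. L2_norm Mphi (\<lambda>x. w n x - u x)) \<longlonglongrightarrow> 0"
    "(\<lambda>n. L2_norm Mphi (\<lambda>x. L_expr phi01 (w n) x - f x)) \<longlonglongrightarrow> 0"
    using uf by (rule Lphi_coreE) blast
  have "(\<lambda>n. L2_inner Mphi (L_expr phi01 (w n)) v) \<longlonglongrightarrow> L2_inner Mphi f v"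
    using w L2 by (intro L2_inner_tendsto_const) (auto intro: test_L2 L_expr_test)
  moreover have "(\<lambda>n. L2_inner Mphi (w n) g) \<longlonglongrightarrow> L2_inner Mphi u g"
    using w L2 by (intro L2_inner_tendsto_const) (auto intro: test_L2)
  moreover have "L2_inner Mphi (L_expr phi01 (w n)) v = L2_inner Mphi (w n) g" for n
    using vg w(1) by (simp add: Lphi_iff)
  ultimately show ?thesis by (simp add: LIMSEQ_unique)
qed

lemma Lphi_closed:
  assumes un: "\<And>n::nat. (u n, f n) \<in> Lphi" and u: "u' \<in> L2_space Mphi" "(\<lambda>n. L2_norm Mphi (\<lambda>x. u n x - u' x)) \<longlonglongrightarrow> 0"
    and f: "f' \<in> L2_space Mphi" "(\<lambda>n. L2_norm Mphi (\<lambda>x. f n x - f' x)) \<longlonglongrightarrow> 0"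
  shows "(u', f') \<in> Lphi"
proof -
  have "L2_inner Mphi (L_expr phi01 v) u' = L2_inner Mphi v f'" if v: "v \<in> test_functions Iphi" for v
  proof (rule LIMSEQ_unique)
    show "(\<lambda>n. L2_inner Mphi (L_expr phi01 v) (u n)) \<longlonglongrightarrow> L2_inner Mphi (L_expr phi01 v) u'"
      by (rule L2_inner_tendsto_const(2)[OF Lphi_L2(1)[OF un] u test_L2[OF L_expr_test[OF v]]])
    have "L2_inner Mphi (L_expr phi01 v) (u n) = L2_inner Mphi v (f n)" for n
      using un v by (simp add: Lphi_iff)
    then show "(\<lambda>n. L2_inner Mphi (L_expr phi01 v) (u n)) \<longlonglongrightarrow> L2_inner Mphi v f'"
      using L2_inner_tendsto_const(2)[OF Lphi_L2(2)[OF un] f test_L2[OF v]] by simp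
  qed
  then show ?thesis using u f by (simp add: Lphi_iff)
qed

lemma Lphi_selfadjoint:
  assumes "y \<in> L2_space Mphi" "z \<in> L2_space Mphi" "\<And>u f. (u, f) \<in> Lphi \<Longrightarrow> L2_inner Mphi f y = L2_inner Mphi u z"
  shows "(y, z) \<in> Lphi"
  using assms Lphi_test by (auto simp: Lphi_iff)

lemma norm_P_pos: "L2_norm Mphi P0 > 0" "L2_norm Mphi P1 > 0"
proof -
  have *: "L2_norm Mphi u > 0" if "u \<in> L2_space Mphi" "\<And>x. x \<in> Iphi \<Longrightarrow> x \<noteq> 0 \<Longrightarrow> u x \<noteq> 0" for u
  proof (rule ccontr)
    assume "\<not> L2_norm Mphi u > 0"
    then have "L2_norm Mphi u = 0" using L2_norm_nonneg[of Mphi u] by linarith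
    then have "AE x in Mphi. u x = 0" using L2_norm_eq_0[OF that(1)] by simp
    moreover have "AE x in Mphi. x \<noteq> 0"
    proof (subst AE_restrict_space_iff)
      have "AE x in lebesgue. x \<noteq> (0::real)" by (intro AE_completion AE_lborel_singleton)
      then show "AE x in lebesgue. x \<in> Iphi \<longrightarrow> x \<noteq> 0" by eventually_elim simp
    qed (simp add: Iphi_def)
    ultimately have "AE x in Mphi. False"
      using AE_space[of Mphi] by eventually_elim (use that(2) in auto)
    then show False using not_AE_Mphi_False by simp
  qed
  show "L2_norm Mphi P0 > 0" by (rule *[OF Lphi_L2(1)[OF Lphi_P0]]) (simp add: phi01_nz)
  show "L2_norm Mphi P1 > 0"
  proof (rule *[OF Lphi_L2(1)[OF Lphi_P1]])
    fix x assume x: "x \<in> Iphi" "x \<noteq> 0"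
    have "sin (x / sqrt 2) \<noteq> 0"
      using sin_gt_zero[of "x / sqrt 2"] sin_gt_zero[of "- (x / sqrt 2)"] Iphi_angle[OF x(1)] x(2) pi_gt_zero
      by (cases "x > 0") (auto simp: divide_less_0_iff zero_less_divide_iff not_less order_le_less)
    then show "P1 x \<noteq> 0" by (simp add: dphi_def)
  qed
qed

lemma P0_P1_orth: "L2_inner Mphi P0 P1 = 0" "L2_inner Mphi P1 P0 = 0"
proof -
  have "L2_inner Mphi (\<lambda>x. - 2 * P0 x) P1 = L2_inner Mphi P0 (\<lambda>x. 0)"
    by (rule Lphi_symmetric[OF Lphi_P0 Lphi_P1])
  then have "- 2 * L2_inner Mphi P0 P1 = 0"
    by (simp only: L2_inner_scale_left) (simp add: L2_inner_def)
  then show "L2_inner Mphi P0 P1 = 0" by simp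
  then show "L2_inner Mphi P1 P0 = 0" by (simp add: L2_inner_commute[of Mphi P0 P1])
qed

section \<open>Splitting off the two eigenfunctions\<close>

definition coef0 :: "(real \<Rightarrow> complex) \<Rightarrow> complex" where
  "coef0 u = L2_inner Mphi u P0 / of_real ((L2_norm Mphi P0)\<^sup>2)"

definition coef1 :: "(real \<Rightarrow> complex) \<Rightarrow> complex" where
  "coef1 u = L2_inner Mphi u P1 / of_real ((L2_norm Mphi P1)\<^sup>2)"

abbreviation (input) perp :: "(real \<Rightarrow> complex) \<Rightarrow> real \<Rightarrow> complex" where
  "perp u \<equiv> \<lambda>x. u x - (coef0 u * P0 x + coef1 u * P1 x)"

lemmas P0_L2 = Lphi_L2(1)[OF Lphi_P0]
lemmas P1_L2 = Lphi_L2(1)[OF Lphi_P1]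

lemma perp_L2: "u \<in> L2_space Mphi \<Longrightarrow> perp u \<in> L2_space Mphi"
  by (intro L2_diff L2_add L2_scale P0_L2 P1_L2)

lemma perp_orth:
  assumes u: "u \<in> L2_space Mphi"
  shows "L2_inner Mphi (perp u) P0 = 0" "L2_inner Mphi (perp u) P1 = 0"
proof -
  have e: "L2_inner Mphi (perp u) h = L2_inner Mphi u h - (coef0 u * L2_inner Mphi P0 h + coef1 u * L2_inner Mphi P1 h)"
    if "h \<in> L2_space Mphi" for h
    using u that
    by (simp add: L2_inner_diff_left L2_inner_add_left L2_add L2_scale P0_L2 P1_L2 L2_inner_scale_left)
  show "L2_inner Mphi (perp u) P0 = 0" unfolding e[OF P0_L2] L2_inner_self P0_P1_orth
    using norm_P_pos by (simp add: coef0_def)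
  show "L2_inner Mphi (perp u) P1 = 0" unfolding e[OF P1_L2] L2_inner_self P0_P1_orth
    using norm_P_pos by (simp add: coef1_def)
qed

lemma perp_creg:
  assumes "creg u f" shows "creg (perp u) (\<lambda>x. f x + 2 * coef0 u * P0 x)"
proof -
  have "creg (\<lambda>x. u x + ((- coef0 u) * P0 x + (- coef1 u) * P1 x))
      (\<lambda>x. f x + ((- coef0 u) * (- 2 * P0 x) + (- coef1 u) * 0))"
    by (intro creg_add creg_scale creg_phi01 creg_dphi assms)
  moreover have "(\<lambda>x. u x + ((- coef0 u) * P0 x + (- coef1 u) * P1 x)) = perp u" by auto
  moreover have "(\<lambda>x. f x + ((- coef0 u) * (- 2 * P0 x) + (- coef1 u) * 0)) = (\<lambda>x. f x + 2 * coef0 u * P0 x)" by auto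
  ultimately show ?thesis by simp
qed

lemma perp_Lphi:
  assumes "(u, f) \<in> Lphi" shows "(perp u, \<lambda>x. f x + 2 * coef0 u * P0 x) \<in> Lphi"
  using Lphi_diff[OF assms Lphi_add[OF Lphi_scale[OF Lphi_P0, of "coef0 u"] Lphi_scale[OF Lphi_P1, of "coef1 u"]]]
  by (simp add: algebra_simps)

text \<open>The approximating test functions are projected onto the orthogonal complement. This
  destroys compact support but stays within \<open>creg\<close>, and the corrections disappear in
  the limit because their coefficients converge to those of \<open>u\<close>, which are 0.\<close>

lemma Lphi_orth_coreE:
  assumes uf: "(u, f) \<in> Lphi" and o: "L2_inner Mphi u P0 = 0" "L2_inner Mphi u P1 = 0"
  obtains w F where "\<And>n::nat. creg (w n) (F n)" "\<And>n. L2_inner Mphi (w n) P0 = 0" "\<And>n. L2_inner Mphi (w n) P1 = 0"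
    "(\<lambda>n. L2_norm Mphi (\<lambda>x. w n x - u x)) \<longlonglongrightarrow> 0" "(\<lambda>n. L2_norm Mphi (\<lambda>x. F n x - f x)) \<longlonglongrightarrow> 0"
proof -
  note L2 = Lphi_L2[OF uf]
  obtain w where w: "\<And>n::nat. w n \<in> test_functions Iphi" and lim: "(\<lambda>n. L2_norm Mphi (\<lambda>x. w n x - u x)) \<longlonglongrightarrow> 0"
    "(\<lambda>n. L2_norm Mphi (\<lambda>x. L_expr phi01 (w n) x - f x)) \<longlonglongrightarrow> 0"
    using uf by (rule Lphi_coreE) blast
  have wL: "w n \<in> L2_space Mphi" "L_expr phi01 (w n) \<in> L2_space Mphi" for n
    using w by (auto intro: test_L2 L_expr_test)
  have "(\<lambda>n. coef0 (w n)) \<longlonglongrightarrow> coef0 u" "(\<lambda>n. coef1 (w n)) \<longlonglongrightarrow> coef1 u"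
    unfolding coef0_def coef1_def using norm_P_pos
    by (intro tendsto_divide tendsto_const L2_inner_tendsto_const(1)[OF wL(1) L2(1) lim(1)] P0_L2 P1_L2; simp)+
  then have c: "(\<lambda>n. cmod (coef0 (w n))) \<longlonglongrightarrow> 0" "(\<lambda>n. cmod (coef1 (w n))) \<longlonglongrightarrow> 0"
    using o by (auto simp: coef0_def coef1_def intro: tendsto_norm_zero)
  let ?F = "\<lambda>n x. L_expr phi01 (w n) x + 2 * coef0 (w n) * P0 x"
  show thesis
  proof (rule that[of "\<lambda>n. perp (w n)" ?F])
    show "creg (perp (w n)) (?F n)" for n by (intro perp_creg creg_test w)
    show "L2_inner Mphi (perp (w n)) P0 = 0" "L2_inner Mphi (perp (w n)) P1 = 0" for n
      by (intro perp_orth wL)+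
    show "(\<lambda>n. L2_norm Mphi (\<lambda>x. perp (w n) x - u x)) \<longlonglongrightarrow> 0"
    proof (rule Lim_null_comparison)
      show "(\<lambda>n. L2_norm Mphi (\<lambda>x. w n x - u x) +
        (cmod (coef0 (w n)) * L2_norm Mphi P0 + cmod (coef1 (w n)) * L2_norm Mphi P1)) \<longlonglongrightarrow> 0"
        using tendsto_add[OF lim(1) tendsto_add[OF tendsto_mult_right[OF c(1), of "L2_norm Mphi P0"] tendsto_mult_right[OF c(2), of "L2_norm Mphi P1"]]]
        by simp
      have "L2_norm Mphi (\<lambda>x. perp (w n) x - u x) \<le> L2_norm Mphi (\<lambda>x. w n x - u x) +
        (cmod (coef0 (w n)) * L2_norm Mphi P0 + cmod (coef1 (w n)) * L2_norm Mphi P1)" for n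
      proof -
        have "(\<lambda>x. perp (w n) x - u x) = (\<lambda>x. (w n x - u x) - (coef0 (w n) * P0 x + coef1 (w n) * P1 x))" by auto
        then have "L2_norm Mphi (\<lambda>x. perp (w n) x - u x) \<le>
            L2_norm Mphi (\<lambda>x. w n x - u x) + L2_norm Mphi (\<lambda>x. coef0 (w n) * P0 x + coef1 (w n) * P1 x)"
          using L2_norm_triangle_diff[OF L2_diff[OF wL(1)[of n] L2(1)] L2_add[OF L2_scale[OF P0_L2] L2_scale[OF P1_L2]]] by simp
        also have "L2_norm Mphi (\<lambda>x. coef0 (w n) * P0 x + coef1 (w n) * P1 x) \<le>
            cmod (coef0 (w n)) * L2_norm Mphi P0 + cmod (coef1 (w n)) * L2_norm Mphi P1"
          using L2_norm_triangle[OF L2_scale[OF P0_L2, of "coef0 (w n)"] L2_scale[OF P1_L2, of "coef1 (w n)"]]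
          by (simp only: L2_norm_scale)
        finally show ?thesis by simp
      qed
      then show "\<forall>\<^sub>F n in sequentially. norm (L2_norm Mphi (\<lambda>x. perp (w n) x - u x)) \<le> L2_norm Mphi (\<lambda>x. w n x - u x) +
        (cmod (coef0 (w n)) * L2_norm Mphi P0 + cmod (coef1 (w n)) * L2_norm Mphi P1)" by simp
    qed
    show "(\<lambda>n. L2_norm Mphi (\<lambda>x. ?F n x - f x)) \<longlonglongrightarrow> 0"
    proof (rule Lim_null_comparison)
      show "(\<lambda>n. L2_norm Mphi (\<lambda>x. L_expr phi01 (w n) x - f x) + 2 * cmod (coef0 (w n)) * L2_norm Mphi P0) \<longlonglongrightarrow> 0"
        using tendsto_add[OF lim(2) tendsto_mult_right[OF tendsto_mult_left[OF c(1), of 2], of "L2_norm Mphi P0"]] by simp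
      have "L2_norm Mphi (\<lambda>x. ?F n x - f x) \<le> L2_norm Mphi (\<lambda>x. L_expr phi01 (w n) x - f x) + 2 * cmod (coef0 (w n)) * L2_norm Mphi P0" for n
      proof -
        have "(\<lambda>x. ?F n x - f x) = (\<lambda>x. (L_expr phi01 (w n) x - f x) + (2 * coef0 (w n)) * P0 x)" by auto
        then show ?thesis
          using L2_norm_triangle[OF L2_diff[OF wL(2)[of n] L2(2)] L2_scale[OF P0_L2, of "2 * coef0 (w n)"]]
          by (simp only: L2_norm_scale norm_mult) simp
      qed
      then show "\<forall>\<^sub>F n in sequentially. norm (L2_norm Mphi (\<lambda>x. ?F n x - f x)) \<le>
        L2_norm Mphi (\<lambda>x. L_expr phi01 (w n) x - f x) + 2 * cmod (coef0 (w n)) * L2_norm Mphi P0" by simp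
    qed
  qed
qed

lemma Lphi_gap:
  assumes uf: "(u, f) \<in> Lphi" and o: "L2_inner Mphi u P0 = 0" "L2_inner Mphi u P1 = 0"
  shows "(L2_norm Mphi u)\<^sup>2 \<le> 4 * Re (L2_inner Mphi f u)"
proof -
  note L2 = Lphi_L2[OF uf]
  obtain w F where w: "\<And>n::nat. creg (w n) (F n)" "\<And>n. L2_inner Mphi (w n) P0 = 0" "\<And>n. L2_inner Mphi (w n) P1 = 0"
    and lim: "(\<lambda>n. L2_norm Mphi (\<lambda>x. w n x - u x)) \<longlonglongrightarrow> 0" "(\<lambda>n. L2_norm Mphi (\<lambda>x. F n x - f x)) \<longlonglongrightarrow> 0"
    using uf o by (rule Lphi_orth_coreE) blast
  have wL: "w n \<in> L2_space Mphi" "F n \<in> L2_space Mphi" for n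
    using creg_ccb[OF w(1)] by (auto intro: ccb_L2)
  show ?thesis
  proof (rule LIMSEQ_le)
    show "(\<lambda>n. (L2_norm Mphi (w n))\<^sup>2) \<longlonglongrightarrow> (L2_norm Mphi u)\<^sup>2"
      by (intro tendsto_power L2_norm_tendsto wL L2 lim)
    show "(\<lambda>n. 4 * Re (L2_inner Mphi (F n) (w n))) \<longlonglongrightarrow> 4 * Re (L2_inner Mphi f u)"
      by (intro tendsto_intros L2_inner_tendsto wL L2 lim)
    show "\<exists>N. \<forall>n\<ge>N. (L2_norm Mphi (w n))\<^sup>2 \<le> 4 * Re (L2_inner Mphi (F n) (w n))"
      using creg_gap[OF w] by blast
  qed
qed

lemma test_cnj: assumes "f \<in> test_functions Iphi" shows "(\<lambda>x. cnj (f x)) \<in> test_functions Iphi"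
proof -
  obtain c d where cd: "c \<in> Iphi" "d \<in> Iphi" "\<And>x. x \<notin> {c..d} \<Longrightarrow> f x = 0"
    using assms by (rule test_functionsE) blast
  have "smooth_on Iphi (\<lambda>x. cnj (f x))"
    using test_smooth_Iphi[OF assms] by (auto simp: smooth_on_def intro: sm_linear[OF _ bounded_linear_cnj])
  then show ?thesis by (rule test_functionsI[OF _ cd(1,2)]) (drule cd(3), simp)
qed

text \<open>The Morawetz estimate is applied to regular approximants, since \<open>u\<close> is only
  a weak solution. For fixed \<open>t\<close> their residuals tend to 0, which leaves
  \<open>t\<close> times a constant; letting \<open>t\<close> tend to 0 makes \<open>u\<close>
  orthogonal to all test functions.\<close>

lemma Lphi_no_eigenvector:
  assumes uf: "(u, \<lambda>x. of_real l * u x) \<in> Lphi" and o: "L2_inner Mphi u P0 = 0" "L2_inner Mphi u P1 = 0"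
  shows "AE x in Mphi. u x = 0"
proof -
  note L2 = Lphi_L2[OF uf]
  obtain w F where w: "\<And>n::nat. creg (w n) (F n)" "\<And>n. L2_inner Mphi (w n) P0 = 0" "\<And>n. L2_inner Mphi (w n) P1 = 0"
    and lim: "(\<lambda>n. L2_norm Mphi (\<lambda>x. w n x - u x)) \<longlonglongrightarrow> 0" "(\<lambda>n. L2_norm Mphi (\<lambda>x. F n x - of_real l * u x)) \<longlonglongrightarrow> 0"
    using uf o by (rule Lphi_orth_coreE) blast
  have wL: "w n \<in> L2_space Mphi" "F n \<in> L2_space Mphi" for n
    using creg_ccb[OF w(1)] by (auto intro: ccb_L2)
  have lim0: "(\<lambda>n. L2_norm Mphi (\<lambda>x. F n x - of_real l * w n x)) \<longlonglongrightarrow> 0"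
  proof (rule Lim_null_comparison)
    show "(\<lambda>n. L2_norm Mphi (\<lambda>x. F n x - of_real l * u x) + \<bar>l\<bar> * L2_norm Mphi (\<lambda>x. w n x - u x)) \<longlonglongrightarrow> 0"
      using tendsto_add[OF lim(2) tendsto_mult_left[OF lim(1), of "\<bar>l\<bar>"]] by simp
    have "L2_norm Mphi (\<lambda>x. F n x - of_real l * w n x) \<le> L2_norm Mphi (\<lambda>x. F n x - of_real l * u x) + \<bar>l\<bar> * L2_norm Mphi (\<lambda>x. w n x - u x)" for n
    proof -
      have "(\<lambda>x. F n x - of_real l * w n x) = (\<lambda>x. (F n x - of_real l * u x) - of_real l * (w n x - u x))"
        by (auto simp: algebra_simps)
      then show ?thesis
        using L2_norm_triangle_diff[OF L2_diff[OF wL(2)[of n] L2(2)] L2_scale[OF L2_diff[OF wL(1)[of n] L2(1)], of "of_real l"]]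
        by (simp only: L2_norm_scale norm_of_real)
    qed
    then show "\<forall>\<^sub>F n in sequentially. norm (L2_norm Mphi (\<lambda>x. F n x - of_real l * w n x)) \<le>
        L2_norm Mphi (\<lambda>x. F n x - of_real l * u x) + \<bar>l\<bar> * L2_norm Mphi (\<lambda>x. w n x - u x)" by simp
  qed
  have inner0: "L2_inner Mphi u v = 0" if v: "v \<in> test_functions Iphi" for v
  proof -
    obtain C where C: "C \<ge> 0" "\<And>u f t l. creg u f \<Longrightarrow> L2_inner Mphi u P0 = 0 \<Longrightarrow> L2_inner Mphi u P1 = 0 \<Longrightarrow> t > 0 \<Longrightarrow>
      (cmod (L2_inner Mphi u v))\<^sup>2 \<le> C * ((L2_norm Mphi (\<lambda>x. f x - of_real l * u x))\<^sup>2 / t + t * (L2_norm Mphi u)\<^sup>2)"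
      using creg_morawetz[OF v] by blast
    have le: "(cmod (L2_inner Mphi u v))\<^sup>2 \<le> t * (C * (L2_norm Mphi u)\<^sup>2)" if t: "t > 0" for t
    proof (rule LIMSEQ_le)
      show "(\<lambda>n. (cmod (L2_inner Mphi (w n) v))\<^sup>2) \<longlonglongrightarrow> (cmod (L2_inner Mphi u v))\<^sup>2"
        by (intro tendsto_intros L2_inner_tendsto_const wL L2 lim test_L2 v)
      have "(\<lambda>n. C * ((L2_norm Mphi (\<lambda>x. F n x - of_real l * w n x))\<^sup>2 / t + t * (L2_norm Mphi (w n))\<^sup>2)) \<longlonglongrightarrow>
          C * (0\<^sup>2 / t + t * (L2_norm Mphi u)\<^sup>2)"
        using t by (intro tendsto_intros lim0 L2_norm_tendsto wL L2 lim) auto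
      then show "(\<lambda>n. C * ((L2_norm Mphi (\<lambda>x. F n x - of_real l * w n x))\<^sup>2 / t + t * (L2_norm Mphi (w n))\<^sup>2)) \<longlonglongrightarrow>
          t * (C * (L2_norm Mphi u)\<^sup>2)" by (simp add: mult.left_commute)
      show "\<exists>N. \<forall>n\<ge>N. (cmod (L2_inner Mphi (w n) v))\<^sup>2 \<le>
          C * ((L2_norm Mphi (\<lambda>x. F n x - of_real l * w n x))\<^sup>2 / t + t * (L2_norm Mphi (w n))\<^sup>2)"
        using C(2)[OF w t] by blast
    qed
    have "(cmod (L2_inner Mphi u v))\<^sup>2 \<le> 0"
    proof (rule tendsto_lowerbound)
      show "((\<lambda>t. t * (C * (L2_norm Mphi u)\<^sup>2)) \<longlongrightarrow> 0) (at_right 0)"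
        by (auto intro!: tendsto_eq_intros)
      show "eventually (\<lambda>t. (cmod (L2_inner Mphi u v))\<^sup>2 \<le> t * (C * (L2_norm Mphi u)\<^sup>2)) (at_right 0)"
        using le by (auto simp: eventually_at_right_field intro!: exI[of _ 1])
    qed (simp add: trivial_limit_at_right_real)
    then show ?thesis by simp
  qed
  show ?thesis
  proof (rule fundamental_lemma)
    show "integrable Mphi u" by (intro L2_integrable L2) simp
    fix \<psi> assume "\<psi> \<in> test_functions Iphi"
    from inner0[OF test_cnj[OF this]] show "(LINT x|Mphi. u x * \<psi> x) = 0" by (simp add: L2_inner_def)
  qed
qed

section \<open>Point spectrum\<close>

lemma eigenfunction_real:
  assumes "eigenfunction Mphi Lphi \<mu> u" obtains l where "\<mu> = of_real l"
proof -
  have u: "(u, \<lambda>x. \<mu> * u x) \<in> Lphi" "\<not> (AE x in Mphi. u x = 0)" using assms by (auto simp: eigenfunction_def)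
  have "L2_norm Mphi u \<noteq> 0" using u L2_norm_eq_0[OF Lphi_L2(1)[OF u(1)]] by simp
  moreover have "\<mu> * L2_inner Mphi u u = cnj \<mu> * L2_inner Mphi u u"
    using Lphi_symmetric[OF u(1) u(1)] by (simp only: L2_inner_scale_left L2_inner_scale_right)
  ultimately have "\<mu> = cnj \<mu>" by (simp add: L2_inner_self)
  then have "\<mu> = of_real (Re \<mu>)" by (simp add: complex_eq_iff)
  then show thesis by (rule that)
qed

lemma eigen_orth:
  assumes u: "(u, \<lambda>x. of_real l * u x) \<in> Lphi"
  shows "l \<noteq> - 2 \<Longrightarrow> L2_inner Mphi u P0 = 0" "l \<noteq> 0 \<Longrightarrow> L2_inner Mphi u P1 = 0"
proof -
  have "of_real l * L2_inner Mphi u P0 = - 2 * L2_inner Mphi u P0"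
    using Lphi_symmetric[OF u Lphi_P0] by (simp only: L2_inner_scale_left L2_inner_scale_right) simp
  then have "of_real (l + 2) * L2_inner Mphi u P0 = 0" by (simp add: algebra_simps)
  moreover have "complex_of_real (l + 2) \<noteq> 0" if "l \<noteq> - 2"
    using that by (subst of_real_eq_0_iff) linarith
  ultimately show "l \<noteq> - 2 \<Longrightarrow> L2_inner Mphi u P0 = 0" by (metis mult_eq_0_iff)
  have "of_real l * L2_inner Mphi u P1 = 0"
    using Lphi_symmetric[OF u Lphi_P1] by (simp only: L2_inner_scale_left) (simp add: L2_inner_def)
  then show "l \<noteq> 0 \<Longrightarrow> L2_inner Mphi u P1 = 0" by simp
qed

text \<open>For any other real value, symmetry makes an eigenfunction orthogonal to both known ones,
  and \<open>Lphi_no_eigenvector\<close> excludes this.\<close>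

lemma eigenvalue_cases:
  assumes "eigenfunction Mphi Lphi \<mu> u" shows "\<mu> = - 2 \<or> \<mu> = 0"
proof -
  obtain l where l: "\<mu> = of_real l" using assms by (rule eigenfunction_real)
  have u: "(u, \<lambda>x. of_real l * u x) \<in> Lphi" "\<not> (AE x in Mphi. u x = 0)" using assms by (auto simp: eigenfunction_def l)
  have "l = - 2 \<or> l = 0"
    using eigen_orth[OF u(1)] Lphi_no_eigenvector[OF u(1)] u(2) by blast
  then show ?thesis by (auto simp: l)
qed

text \<open>At the value -2 the component along \<open>P1\<close> is 0 by symmetry; removing the one
  along \<open>P0\<close> leaves a solution orthogonal to both eigenfunctions, hence 0.\<close>

lemma ground_state_unique:
  assumes "eigenfunction Mphi Lphi (- 2) u" shows "\<exists>c. AE x in Mphi. u x = c * P0 x"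
proof -
  have u: "(u, \<lambda>x. of_real (- 2) * u x) \<in> Lphi" using assms by (simp add: eigenfunction_def)
  have "coef1 u = 0" using eigen_orth(2)[OF u] by (simp add: coef1_def)
  have "(perp u, \<lambda>x. of_real (- 2) * u x + 2 * coef0 u * P0 x) \<in> Lphi" by (rule perp_Lphi[OF u])
  also have "(\<lambda>x. of_real (- 2) * u x + 2 * coef0 u * P0 x) = (\<lambda>x. of_real (- 2) * perp u x)"
    by (auto simp: \<open>coef1 u = 0\<close> algebra_simps)
  finally have "AE x in Mphi. perp u x = 0"
    by (rule Lphi_no_eigenvector[OF _ perp_orth[OF Lphi_L2(1)[OF u]]])
  then have "AE x in Mphi. u x = coef0 u * P0 x" by eventually_elim (simp add: \<open>coef1 u = 0\<close>)
  then show ?thesis by blast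
qed

lemma eigenfunction_P: "eigenfunction Mphi Lphi (- 2) P0" "eigenfunction Mphi Lphi 0 P1"
  using Lphi_P0 Lphi_P1 norm_P_pos L2_norm_eq_0[OF P0_L2] L2_norm_eq_0[OF P1_L2]
  by (auto simp: eigenfunction_def)

section \<open>Dense range and the resolvent set\<close>

text \<open>By self-adjointness the orthogonal complement of the range of \<open>L - \<mu>\<close>
  is the kernel of \<open>L - cnj \<mu>\<close>.\<close>

lemma Lphi_range_dense:
  assumes "\<not> (\<exists>y. eigenfunction Mphi Lphi (cnj \<mu>) y)" and f: "f \<in> L2_space Mphi" and e: "e > 0"
  obtains u g where "(u, g) \<in> Lphi" "L2_norm Mphi (\<lambda>x. g x - \<mu> * u x - f x) < e"
proof -
  define S where "S = (\<lambda>(u, g) x. g x - \<mu> * u x) ` Lphi"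
  obtain s where "s \<in> S" "L2_norm Mphi (\<lambda>x. s x - f x) < e"
  proof (rule L2_dense[OF finite_measure_Mphi _ _ _ _ _ f e])
    show "h \<in> L2_space Mphi" if "h \<in> S" for h
    proof -
      obtain u g where "(u, g) \<in> Lphi" "h = (\<lambda>x. g x - \<mu> * u x)" using \<open>h \<in> S\<close> by (auto simp: S_def)
      then show ?thesis by (simp add: L2_diff L2_scale Lphi_L2)
    qed
    show "S \<noteq> {}" unfolding S_def using Lphi_P0 by blast
    show "(\<lambda>x. p x + q x) \<in> S" if pq: "p \<in> S" "q \<in> S" for p q
    proof -
      obtain u g v h where uv: "(u, g) \<in> Lphi" "(v, h) \<in> Lphi" "p = (\<lambda>x. g x - \<mu> * u x)" "q = (\<lambda>x. h x - \<mu> * v x)"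
        using pq by (auto simp: S_def)
      then show ?thesis unfolding S_def
        by (intro image_eqI[OF _ Lphi_add[OF uv(1,2)]]) (auto simp: algebra_simps)
    qed
    show "(\<lambda>x. c * p x) \<in> S" if p: "p \<in> S" for c p
    proof -
      obtain u g where u: "(u, g) \<in> Lphi" "p = (\<lambda>x. g x - \<mu> * u x)" using p by (auto simp: S_def)
      then show ?thesis unfolding S_def
        by (intro image_eqI[OF _ Lphi_scale[OF u(1), of c]]) (auto simp: algebra_simps)
    qed
    show "AE x in Mphi. y x = 0" if y: "y \<in> L2_space Mphi" "\<And>s. s \<in> S \<Longrightarrow> L2_inner Mphi s y = 0" for y
    proof -
      have "(y, \<lambda>x. cnj \<mu> * y x) \<in> Lphi"
      proof (rule Lphi_selfadjoint[OF y(1) L2_scale[OF y(1)]])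
        fix u g assume ug: "(u, g) \<in> Lphi"
        have "L2_inner Mphi (\<lambda>x. g x - \<mu> * u x) y = 0" using ug by (intro y(2)) (auto simp: S_def)
        then show "L2_inner Mphi g y = L2_inner Mphi u (\<lambda>x. cnj \<mu> * y x)"
          using Lphi_L2[OF ug] y(1) by (simp add: L2_inner_diff_left L2_scale L2_inner_scale_left L2_inner_scale_right)
      qed
      then show ?thesis using assms(1) by (auto simp: eigenfunction_def)
    qed
  qed blast
  then show thesis using that by (auto simp: S_def)
qed

text \<open>The a priori bound makes approximate preimages a Cauchy sequence, and closedness of the
  operator identifies the limit, so the dense range is all of \<open>L2\<close>.\<close>

lemma Lphi_resolventI:
  assumes ne: "\<not> (\<exists>y. eigenfunction Mphi Lphi (cnj \<mu>) y)"
    and C: "\<And>u g. (u, g) \<in> Lphi \<Longrightarrow> L2_norm Mphi u \<le> C * L2_norm Mphi (\<lambda>x. g x - \<mu> * u x)"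
  shows "\<mu> \<in> resolvent_set Mphi Lphi"
proof -
  have "\<exists>u. (u, \<lambda>x. \<mu> * u x + f x) \<in> Lphi" if f: "f \<in> L2_space Mphi" for f
  proof -
    have "\<exists>u g. (u, g) \<in> Lphi \<and> L2_norm Mphi (\<lambda>x. g x - \<mu> * u x - f x) < 1 / real (Suc n)" for n
      by (rule Lphi_range_dense[OF ne f, of "1 / real (Suc n)"]) (simp, blast)
    then obtain u g where ug: "\<And>n. (u n, g n) \<in> Lphi"
      and lt: "\<And>n. L2_norm Mphi (\<lambda>x. g n x - \<mu> * u n x - f x) < 1 / real (Suc n)" by metis
    note L2 = Lphi_L2[OF ug]
    have r: "(\<lambda>x. g n x - \<mu> * u n x) \<in> L2_space Mphi" for n by (intro L2_diff L2_scale L2)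
    have lim: "(\<lambda>n. L2_norm Mphi (\<lambda>x. (g n x - \<mu> * u n x) - f x)) \<longlonglongrightarrow> 0"
      using lt by (intro Lim_null_comparison[OF _ LIMSEQ_Suc[OF lim_1_over_n]]) (auto intro!: always_eventually less_imp_le)
    obtain u' where u': "u' \<in> L2_space Mphi" "(\<lambda>n. L2_norm Mphi (\<lambda>x. u n x - u' x)) \<longlonglongrightarrow> 0"
    proof (rule L2_complete[OF finite_measure_Mphi L2(1)])
      fix e :: real assume e: "e > 0"
      have C1: "\<bar>C\<bar> + 1 > 0" by simp
      obtain N where N: "\<And>m n. N \<le> m \<Longrightarrow> N \<le> n \<Longrightarrow>
          L2_norm Mphi (\<lambda>x. (g m x - \<mu> * u m x) - (g n x - \<mu> * u n x)) < e / (\<bar>C\<bar> + 1)"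
        using L2_norm_Cauchy[OF r f lim, of "e / (\<bar>C\<bar> + 1)"] e C1 by (auto simp: divide_pos_pos)
      show "\<exists>N. \<forall>m\<ge>N. \<forall>n\<ge>N. L2_norm Mphi (\<lambda>x. u m x - u n x) < e"
      proof (intro exI allI impI)
        fix m n assume mn: "N \<le> m" "N \<le> n"
        let ?d = "L2_norm Mphi (\<lambda>x. (g m x - \<mu> * u m x) - (g n x - \<mu> * u n x))"
        have "L2_norm Mphi (\<lambda>x. u m x - u n x) \<le> C * L2_norm Mphi (\<lambda>x. (g m x - g n x) - \<mu> * (u m x - u n x))"
          by (intro C Lphi_diff ug)
        also have "(\<lambda>x. (g m x - g n x) - \<mu> * (u m x - u n x)) = (\<lambda>x. (g m x - \<mu> * u m x) - (g n x - \<mu> * u n x))"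
          by (auto simp: algebra_simps)
        also have "C * ?d \<le> (\<bar>C\<bar> + 1) * ?d" by (intro mult_right_mono) auto
        also have "\<dots> < e" using N[OF mn] C1 by (simp add: pos_less_divide_eq mult.commute)
        finally show "L2_norm Mphi (\<lambda>x. u m x - u n x) < e" .
      qed
    qed
    have "(u', \<lambda>x. \<mu> * u' x + f x) \<in> Lphi"
    proof (rule Lphi_closed[OF ug u'])
      show F: "(\<lambda>x. \<mu> * u' x + f x) \<in> L2_space Mphi" by (intro L2_add L2_scale u' f)
      show "(\<lambda>n. L2_norm Mphi (\<lambda>x. g n x - (\<mu> * u' x + f x))) \<longlonglongrightarrow> 0"
      proof (rule Lim_null_comparison)
        show "(\<lambda>n. L2_norm Mphi (\<lambda>x. (g n x - \<mu> * u n x) - f x) + cmod \<mu> * L2_norm Mphi (\<lambda>x. u n x - u' x)) \<longlonglongrightarrow> 0"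
          using tendsto_add[OF lim tendsto_mult_left[OF u'(2), of "cmod \<mu>"]] by simp
        have "L2_norm Mphi (\<lambda>x. g n x - (\<mu> * u' x + f x)) \<le>
          L2_norm Mphi (\<lambda>x. (g n x - \<mu> * u n x) - f x) + cmod \<mu> * L2_norm Mphi (\<lambda>x. u n x - u' x)" for n
        proof -
          have "(\<lambda>x. g n x - (\<mu> * u' x + f x)) = (\<lambda>x. ((g n x - \<mu> * u n x) - f x) + \<mu> * (u n x - u' x))"
            by (auto simp: algebra_simps)
          then show ?thesis
            using L2_norm_triangle[OF L2_diff[OF r[of n] f] L2_scale[OF L2_diff[OF L2(1)[of n] u'(1)], of \<mu>]]
            by (simp only: L2_norm_scale)
        qed
        then show "\<forall>\<^sub>F n in sequentially. norm (L2_norm Mphi (\<lambda>x. g n x - (\<mu> * u' x + f x))) \<le>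
          L2_norm Mphi (\<lambda>x. (g n x - \<mu> * u n x) - f x) + cmod \<mu> * L2_norm Mphi (\<lambda>x. u n x - u' x)" by simp
      qed
    qed
    then show ?thesis by blast
  qed
  then show ?thesis using C unfolding resolvent_set_def by fast
qed

text \<open>Since \<open><g, u>\<close> is real, the imaginary part of
  \<open><g - \<mu> u, u>\<close> is \<open>- Im \<mu>\<close> times the squared norm of
  \<open>u\<close>.\<close>

lemma resolvent_nonreal:
  assumes "Im \<mu> \<noteq> 0" shows "\<mu> \<in> resolvent_set Mphi Lphi"
proof (rule Lphi_resolventI[where C = "1 / \<bar>Im \<mu>\<bar>"])
  show "\<not> (\<exists>y. eigenfunction Mphi Lphi (cnj \<mu>) y)"
    using assms by (auto elim!: eigenfunction_real simp: complex_eq_iff)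
  fix u g assume ug: "(u, g) \<in> Lphi"
  note L2 = Lphi_L2[OF ug]
  have "Im (L2_inner Mphi g u) = 0"
    using Lphi_symmetric[OF ug ug] L2_inner_commute[of Mphi u g] by (simp add: complex_eq_iff)
  then have "Im (L2_inner Mphi (\<lambda>x. g x - \<mu> * u x) u) = - Im \<mu> * (L2_norm Mphi u)\<^sup>2"
    using L2 by (simp add: L2_inner_diff_left L2_scale L2_inner_scale_left L2_inner_self del: of_real_power)
  then have "\<bar>Im \<mu>\<bar> * (L2_norm Mphi u)\<^sup>2 = \<bar>Im (L2_inner Mphi (\<lambda>x. g x - \<mu> * u x) u)\<bar>" by (simp add: abs_mult)
  also have "\<dots> \<le> L2_norm Mphi (\<lambda>x. g x - \<mu> * u x) * L2_norm Mphi u"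
    using L2 by (intro order_trans[OF abs_Im_le_cmod] L2_Cauchy_Schwarz L2_diff L2_scale)
  finally have le: "(\<bar>Im \<mu>\<bar> * L2_norm Mphi u) * L2_norm Mphi u \<le> L2_norm Mphi (\<lambda>x. g x - \<mu> * u x) * L2_norm Mphi u"
    by (simp add: power2_eq_square)
  show "L2_norm Mphi u \<le> 1 / \<bar>Im \<mu>\<bar> * L2_norm Mphi (\<lambda>x. g x - \<mu> * u x)"
  proof (cases "L2_norm Mphi u = 0")
    case False
    then have "L2_norm Mphi u > 0" using L2_norm_nonneg[of Mphi u] by linarith
    with le have "\<bar>Im \<mu>\<bar> * L2_norm Mphi u \<le> L2_norm Mphi (\<lambda>x. g x - \<mu> * u x)" by (rule mult_right_le_imp_le)
    then show ?thesis using assms by (simp add: field_simps)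
  qed simp
qed

text \<open>Along \<open>P0\<close> and \<open>P1\<close> the operator acts as -2 and 0, which gives
  the first two summands of \<open>C\<close>; on the complement the gap \<open>1/4 - l\<close> gives
  the third. Its factor 3 arises from the triangle inequality: the residual of \<open>perp u\<close>
  is the sum of \<open>r\<close> and its two corrections, each of norm at most
  \<open>R\<close>.\<close>

lemma resolvent_real:
  assumes l: "l < 1 / 4" "l \<noteq> - 2" "l \<noteq> 0" shows "of_real l \<in> resolvent_set Mphi Lphi"
proof -
  define p0 where "p0 = L2_norm Mphi P0"
  define p1 where "p1 = L2_norm Mphi P1"
  have p: "p0 > 0" "p1 > 0" using norm_P_pos by (auto simp: p0_def p1_def)
  define C where "C = 1 / \<bar>l + 2\<bar> + 1 / \<bar>l\<bar> + 3 / (1 / 4 - l)"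
  show ?thesis
  proof (rule Lphi_resolventI[where C = C])
    show "\<not> (\<exists>y. eigenfunction Mphi Lphi (cnj (of_real l)) y)"
    proof
      assume "\<exists>y. eigenfunction Mphi Lphi (cnj (of_real l)) y"
      then obtain y where "eigenfunction Mphi Lphi (complex_of_real l) y" by auto
      from eigenvalue_cases[OF this] show False using l by (simp add: complex_eq_iff)
    qed
    fix u g assume ug: "(u, g) \<in> Lphi"
    note L2 = Lphi_L2[OF ug]
    define r where "r x = g x - of_real l * u x" for x
    define R where "R = L2_norm Mphi r"
    have rL: "r \<in> L2_space Mphi" unfolding r_def by (intro L2_diff L2_scale L2)
    have R: "R \<ge> 0" by (simp add: R_def)
    have i0: "L2_inner Mphi r P0 = - of_real (l + 2) * L2_inner Mphi u P0"
    proof -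
      have "L2_inner Mphi g P0 = - 2 * L2_inner Mphi u P0"
        using Lphi_symmetric[OF ug Lphi_P0] by (simp only: L2_inner_scale_right) simp
      then show ?thesis unfolding r_def using L2 P0_L2
        by (simp add: L2_inner_diff_left L2_scale L2_inner_scale_left algebra_simps)
    qed
    have i1: "L2_inner Mphi r P1 = - of_real l * L2_inner Mphi u P1"
    proof -
      have "L2_inner Mphi g P1 = 0"
        using Lphi_symmetric[OF ug Lphi_P1] by (simp add: L2_inner_def)
      then show ?thesis unfolding r_def using L2 P1_L2
        by (simp add: L2_inner_diff_left L2_scale L2_inner_scale_left)
    qed
    have c0: "\<bar>l + 2\<bar> * (cmod (coef0 u) * p0) \<le> R"
    proof -
      have "\<bar>l + 2\<bar> * cmod (L2_inner Mphi u P0) \<le> R * p0"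
        using L2_Cauchy_Schwarz[OF rL P0_L2] unfolding i0 norm_mult norm_minus_cancel norm_of_real by (simp add: R_def p0_def)
      moreover have "cmod (coef0 u) * p0 = cmod (L2_inner Mphi u P0) / p0"
        using p by (simp add: coef0_def norm_divide norm_mult p0_def[symmetric] power2_eq_square)
      ultimately show ?thesis using p by (simp add: pos_divide_le_eq)
    qed
    have c1: "\<bar>l\<bar> * (cmod (coef1 u) * p1) \<le> R"
    proof -
      have "\<bar>l\<bar> * cmod (L2_inner Mphi u P1) \<le> R * p1"
        using L2_Cauchy_Schwarz[OF rL P1_L2] unfolding i1 norm_mult norm_minus_cancel norm_of_real by (simp add: R_def p1_def)
      moreover have "cmod (coef1 u) * p1 = cmod (L2_inner Mphi u P1) / p1"
        using p by (simp add: coef1_def norm_divide norm_mult p1_def[symmetric] power2_eq_square)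
      ultimately show ?thesis using p by (simp add: pos_divide_le_eq)
    qed
    define h where "h x = g x + 2 * coef0 u * P0 x" for x
    have uh: "(perp u, h) \<in> Lphi" unfolding h_def by (rule perp_Lphi[OF ug])
    define U where "U = L2_norm Mphi (perp u)"
    have "L2_norm Mphi (\<lambda>x. h x - of_real l * perp u x) \<le> R + (\<bar>l + 2\<bar> * (cmod (coef0 u) * p0) + \<bar>l\<bar> * (cmod (coef1 u) * p1))"
    proof -
      have "(\<lambda>x. h x - of_real l * perp u x) =
          (\<lambda>x. r x + ((of_real (l + 2) * coef0 u) * P0 x + (of_real l * coef1 u) * P1 x))"
        by (auto simp: h_def r_def algebra_simps)
      moreover have "L2_norm Mphi (\<lambda>x. r x + ((of_real (l + 2) * coef0 u) * P0 x + (of_real l * coef1 u) * P1 x)) \<le>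
          L2_norm Mphi r + (L2_norm Mphi (\<lambda>x. (of_real (l + 2) * coef0 u) * P0 x) + L2_norm Mphi (\<lambda>x. (of_real l * coef1 u) * P1 x))"
        by (intro order_trans[OF L2_norm_triangle] add_left_mono L2_norm_triangle L2_add L2_scale rL P0_L2 P1_L2)
      ultimately show ?thesis
        by (simp only: L2_norm_scale norm_mult norm_of_real R_def p0_def p1_def mult.assoc)
    qed
    then have hU: "L2_norm Mphi (\<lambda>x. h x - of_real l * perp u x) \<le> 3 * R" using c0 c1 by linarith
    have Ub: "U \<le> 3 / (1 / 4 - l) * R"
    proof (cases "U = 0")
      case False
      then have U: "U > 0" using L2_norm_nonneg[of Mphi "perp u"] unfolding U_def by linarith
      have "(1 / 4 - l) * U\<^sup>2 \<le> Re (L2_inner Mphi h (perp u)) - l * U\<^sup>2"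
        using Lphi_gap[OF uh perp_orth[OF L2(1)]] by (simp add: U_def left_diff_distrib)
      also have "\<dots> = Re (L2_inner Mphi (\<lambda>x. h x - of_real l * perp u x) (perp u))"
        unfolding U_def using Lphi_L2[OF uh]
        by (subst L2_inner_diff_left) (simp_all add: L2_scale L2_inner_scale_left L2_inner_self del: of_real_power)
      also have "\<dots> \<le> L2_norm Mphi (\<lambda>x. h x - of_real l * perp u x) * U"
        unfolding U_def using Lphi_L2[OF uh]
        by (intro order_trans[OF complex_Re_le_cmod] L2_Cauchy_Schwarz L2_diff[of h] L2_scale)
      also have "\<dots> \<le> 3 * R * U" using hU U by (intro mult_right_mono) auto
      finally have "((1 / 4 - l) * U) * U \<le> (3 * R) * U" by (simp add: power2_eq_square)
      then have "(1 / 4 - l) * U \<le> 3 * R" using U by (rule mult_right_le_imp_le)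
      then show ?thesis using l(1) by (simp add: field_simps)
    qed (use R l(1) in simp)
    have "L2_norm Mphi u \<le> U + (cmod (coef0 u) * p0 + cmod (coef1 u) * p1)"
    proof -
      have "u = (\<lambda>x. perp u x + (coef0 u * P0 x + coef1 u * P1 x))" by auto
      then have "L2_norm Mphi u = L2_norm Mphi (\<lambda>x. perp u x + (coef0 u * P0 x + coef1 u * P1 x))" by simp
      also have "\<dots> \<le> U + (L2_norm Mphi (\<lambda>x. coef0 u * P0 x) + L2_norm Mphi (\<lambda>x. coef1 u * P1 x))"
        unfolding U_def
        by (intro order_trans[OF L2_norm_triangle] add_left_mono L2_norm_triangle L2_add L2_scale perp_L2 L2 P0_L2 P1_L2)
      finally show ?thesis by (simp only: L2_norm_scale p0_def p1_def)
    qed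
    moreover have "cmod (coef0 u) * p0 \<le> 1 / \<bar>l + 2\<bar> * R" using c0 l by (simp add: field_simps)
    moreover have "cmod (coef1 u) * p1 \<le> 1 / \<bar>l\<bar> * R" using c1 l by (simp add: field_simps)
    ultimately have "L2_norm Mphi u \<le> C * R" using Ub by (simp only: C_def distrib_right)
    then show "L2_norm Mphi u \<le> C * L2_norm Mphi (\<lambda>x. g x - of_real l * u x)" by (simp add: R_def r_def[abs_def])
  qed
qed

section \<open>Singular sequences\<close>

text \<open>The Liouville variable: \<open>zphi' = 1 / \<phi>\<close>.\<close>

definition zphi :: "real \<Rightarrow> real" where "zphi x = artanh (- dphi x)"

lemma dphi_less_1: assumes "x \<in> Iphi" shows "\<bar>dphi x\<bar> < 1"
proof -
  have "dphi x * dphi x < 1" using phi01_dphi[of x] phi01_pos[OF assms] mult_pos_pos[of "phi01 x" "phi01 x"] by linarith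
  then show ?thesis using abs_square_less_1[of "dphi x"] by (simp add: power2_eq_square)
qed

lemma DERIV_zphi: assumes x: "x \<in> Iphi" shows "(zphi has_real_derivative 1 / phi01 x) (at x within S)"
proof -
  have "((\<lambda>x. artanh (- dphi x)) has_real_derivative 1 / (1 - (- dphi x)\<^sup>2) * (phi01 x / 2)) (at x within S)"
    using dphi_less_1[OF x] DERIV_minus[OF DERIV_dphi[of x S]]
    by (intro DERIV_chain2[OF artanh_real_has_field_derivative]) auto
  moreover have "1 - (- dphi x)\<^sup>2 = phi01 x * phi01 x / 2" using phi01_dphi[of x] by (simp add: power2_eq_square)
  ultimately show ?thesis using phi01_nz[OF x] by (simp add: zphi_def[abs_def])
qed

lemma zphi_strict_mono: assumes "x \<in> Iphi" "y \<in> Iphi" "x < y" shows "zphi x < zphi y"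
proof (rule DERIV_pos_imp_increasing[OF assms(3)])
  fix t assume "x \<le> t" "t \<le> y"
  then have "t \<in> Iphi" using Iphi_interval[OF assms(1,2)] by auto
  then show "\<exists>d. (zphi has_real_derivative d) (at t) \<and> d > 0"
    using DERIV_zphi phi01_pos by (intro exI[of _ "1 / phi01 t"]) auto
qed

lemma zphi_le_iff: "x \<in> Iphi \<Longrightarrow> y \<in> Iphi \<Longrightarrow> zphi x \<le> zphi y \<longleftrightarrow> x \<le> y"
  using zphi_strict_mono[of x y] zphi_strict_mono[of y x] by (cases x y rule: linorder_cases) auto

text \<open>A scaled Gudermannian function. It inverts \<open>zphi\<close>, because
  \<open>tanh (zphi x) = sin (x / sqrt 2)\<close>.\<close>

definition xphi :: "real \<Rightarrow> real" where "xphi t = sqrt 2 * arcsin (tanh t)"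

lemma xphi: "xphi t \<in> Iphi" "zphi (xphi t) = t"
proof -
  have t: "- 1 < tanh t" "tanh t < 1" using tanh_real_bounds[of t] by auto
  have "- (pi / 2) < arcsin (tanh t)" "arcsin (tanh t) < pi / 2"
    using arcsin_lt_bounded[OF t] by auto
  then have "sqrt 2 * - (pi / 2) < xphi t" "xphi t < sqrt 2 * (pi / 2)"
    unfolding xphi_def by (intro mult_strict_left_mono; simp)+
  then show "xphi t \<in> Iphi" using sqrt2_half[of pi] by (simp add: Iphi_def)
  have "- dphi (xphi t) = tanh t" using t by (simp add: dphi_def xphi_def)
  then show "zphi (xphi t) = t" by (simp add: zphi_def artanh_tanh_real)
qed

text \<open>With \<open>T = tanh z\<close> one has \<open>phi\<^sup>2 = 2 (1 - T\<^sup>2)\<close>,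
  which in fact decays exponentially. A bound by \<open>1 / z\<close> suffices, as the errors from
  the cutoff are estimated by multiples of \<open>1 / N\<close> too.\<close>

lemma phi01_decay: assumes x: "x \<in> Iphi" and z: "zphi x > 0" shows "phi01 x * phi01 x \<le> 4 / zphi x"
proof -
  define T where "T = - dphi x"
  have T: "- 1 < T" "T < 1" using dphi_less_1[OF x] by (auto simp: T_def)
  have "exp (2 * zphi x) = (1 + T) / (1 - T)" using T by (simp add: zphi_def T_def[symmetric] artanh_def)
  then have "exp (2 * zphi x) * (1 - T) = 1 + T" using T by simp
  moreover have "(1 + 2 * zphi x) * (1 - T) \<le> exp (2 * zphi x) * (1 - T)"
    using T exp_ge_add_one_self[of "2 * zphi x"] by (intro mult_right_mono) auto
  moreover have "2 * zphi x * (1 - T) \<le> (1 + 2 * zphi x) * (1 - T)" using T by (intro mult_right_mono) auto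
  ultimately have "2 * zphi x * (1 - T) \<le> 2" using T by linarith
  then have "1 - T \<le> 1 / zphi x" using z by (simp add: field_simps)
  have "phi01 x * phi01 x = (2 * (1 - T)) * (1 + T)" unfolding phi01_dphi T_def by (simp add: algebra_simps)
  also have "\<dots> \<le> (2 * (1 - T)) * 2" using T by (intro mult_left_mono) auto
  also have "\<dots> = 4 * (1 - T)" by simp
  also have "\<dots> \<le> 4 * (1 / zphi x)" using \<open>1 - T \<le> 1 / zphi x\<close> by (intro mult_left_mono) auto
  finally show ?thesis by simp
qed

lemma integral_inverse_phi01:
  assumes "p \<in> Iphi" "q \<in> Iphi" "p \<le> q"
  shows "((\<lambda>x. r / phi01 x) has_integral r * (zphi q - zphi p)) {p..q}"
proof -
  have "((\<lambda>x. 1 / phi01 x) has_integral zphi q - zphi p) {p..q}"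
    using assms Iphi_interval[OF assms(1,2)] DERIV_zphi
    by (intro fundamental_theorem_of_calculus) (auto simp: has_real_derivative_iff_has_vector_derivative[symmetric])
  from has_integral_mult_right[OF this, of r] show ?thesis by simp
qed

text \<open>Because \<open>dx / phi01 = dz\<close>, a squared modulus of size
  \<open>r / phi01\<close> contributes \<open>r\<close> per unit of length in
  \<open>z\<close>.\<close>

lemma L2_norm_le_zphi:
  assumes f: "f \<in> L2_space Mphi" and pq: "p \<in> Iphi" "q \<in> Iphi" "p \<le> q"
    and le: "\<And>x. x \<in> {p..q} \<Longrightarrow> (cmod (f x))\<^sup>2 \<le> r / phi01 x" and z: "\<And>x. x \<in> Iphi \<Longrightarrow> x \<notin> {p..q} \<Longrightarrow> f x = 0"
  shows "(L2_norm Mphi f)\<^sup>2 \<le> r * (zphi q - zphi p)"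
proof -
  have "((\<lambda>x. (cmod (f x))\<^sup>2) has_integral (L2_norm Mphi f)\<^sup>2) Iphi"
    unfolding L2_norm_sq using L2_sq_integrable[OF f] by (intro has_integral_integral_lebesgue_on) (auto simp: Iphi_def)
  then have "((\<lambda>x. if x \<in> {p..q} then (cmod (f x))\<^sup>2 else 0) has_integral (L2_norm Mphi f)\<^sup>2) Iphi"
    by (rule has_integral_eq[rotated]) (use z in auto)
  then have "((\<lambda>x. (cmod (f x))\<^sup>2) has_integral (L2_norm Mphi f)\<^sup>2) {p..q}"
    using has_integral_restrict[OF Iphi_interval[OF pq(1,2)], of "\<lambda>x. (cmod (f x))\<^sup>2"] by simp
  then show ?thesis by (rule has_integral_le[OF _ integral_inverse_phi01[OF pq]]) (rule le)
qed

lemma L2_norm_ge_zphi: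
  assumes f: "f \<in> L2_space Mphi" and pq: "p \<in> Iphi" "q \<in> Iphi" "p \<le> q"
    and le: "\<And>x. x \<in> {p..q} \<Longrightarrow> r / phi01 x \<le> (cmod (f x))\<^sup>2"
  shows "r * (zphi q - zphi p) \<le> (L2_norm Mphi f)\<^sup>2"
proof -
  have h: "((\<lambda>x. (cmod (f x))\<^sup>2) has_integral (L2_norm Mphi f)\<^sup>2) Iphi"
    unfolding L2_norm_sq using L2_sq_integrable[OF f] by (intro has_integral_integral_lebesgue_on) (auto simp: Iphi_def)
  then have "(\<lambda>x. (cmod (f x))\<^sup>2) integrable_on {p..q}"
    using Iphi_interval[OF pq(1,2)] by (intro integrable_on_subinterval[of _ Iphi]) auto
  then have i: "((\<lambda>x. (cmod (f x))\<^sup>2) has_integral integral {p..q} (\<lambda>x. (cmod (f x))\<^sup>2)) {p..q}"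
    by (rule integrable_integral)
  have "r * (zphi q - zphi p) \<le> integral {p..q} (\<lambda>x. (cmod (f x))\<^sup>2)"
    by (rule has_integral_le[OF integral_inverse_phi01[OF pq] i]) (rule le)
  also have "\<dots> \<le> (L2_norm Mphi f)\<^sup>2"
    by (rule has_integral_subset_le[OF Iphi_interval[OF pq(1,2)] i h]) simp
  finally show ?thesis .
qed

text \<open>The passage of \<open>L\<close> to the Liouville variable. Here \<open>W\<close> stands
  for \<open>\<i> \<omega>\<close>, \<open>Q\<close> is the logarithmic derivative of
  \<open>phi\<^sup>1\<^sup>/\<^sup>2 exp (W z)\<close>, and \<open>c0\<close>, \<open>c1\<close>,
  \<open>c2\<close> are the cutoff and its derivatives at scale \<open>n\<close>. On the right,
  \<open>15/8 p\<^sup>2\<close> is the decaying potential; the other two terms come from the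
  cutoff.\<close>

lemma weyl_algebra:
  fixes p d W c0 c1 c2 n :: complex
  assumes "p \<noteq> 0" "n \<noteq> 0" and pd: "p * p = 2 - 2 * (d * d)"
  defines "Q \<equiv> (W + d / 2) / p"
  shows "p * p * (Q * (Q * c0 + c1 / (n * p)) + ((- 1 / 4 - (W + d / 2) * d / (p * p)) * c0 + Q * (c1 / (n * p))
      + (c2 / (n * p) / (n * p) - c1 * d / (n * (p * p)))) + 2 * c0) + (1 / 4 - W * W) * c0
    = 15 / 8 * (p * p) * c0 + 2 * W * c1 / n + c2 / (n * n)"
proof -
  have "p * p * (Q * (Q * c0 + c1 / (n * p)) + ((- 1 / 4 - (W + d / 2) * d / (p * p)) * c0 + Q * (c1 / (n * p))
      + (c2 / (n * p) / (n * p) - c1 * d / (n * (p * p)))) + 2 * c0)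
    = (W + d / 2) * (W + d / 2) * c0 + 2 * (W + d / 2) * c1 / n - p * p * c0 / 4 - (W + d / 2) * d * c0
      + c2 / (n * n) - c1 * d / n + 2 * (p * p) * c0"
    unfolding Q_def using assms(1,2) by (simp add: field_simps)
  also have "\<dots> = W * W * c0 - d * d / 4 * c0 + 2 * W * c1 / n + 7 / 4 * (p * p) * c0 + c2 / (n * n)"
    using assms(2) by (simp add: field_simps)
  also have "d * d = 1 - p * p / 2" using pd by (simp add: field_simps)
  also have "W * W * c0 - (1 - p * p / 2) / 4 * c0 + 2 * W * c1 / n + 7 / 4 * (p * p) * c0 + c2 / (n * n)
    = 15 / 8 * (p * p) * c0 + 2 * W * c1 / n + c2 / (n * n) - (1 / 4 - W * W) * c0"
    using assms(2) by (simp add: field_simps)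
  finally show ?thesis by (simp only: diff_add_cancel)
qed

text \<open>The squared norm of \<open>w\<close> is at least of order \<open>N\<close>, and that of
  the residual at most of order \<open>1 / N\<close>, so the quotient of the norms decays like
  \<open>1 / N\<close> and beats any given \<open>C\<close>.\<close>

lemma weyl_sequence:
  fixes \<omega> C :: real
  assumes \<omega>: "\<omega> \<ge> 0" and C: "C \<ge> 0"
  obtains w where "w \<in> test_functions Iphi"
    "C * L2_norm Mphi (\<lambda>x. L_expr phi01 w x - of_real (1 / 4 + \<omega>\<^sup>2) * w x) < L2_norm Mphi w"
proof -
  \<comment> \<open>This bump vanishes outside \<open>{1..3}\<close>, so \<open>chi (z / N)\<close>
    lives on \<open>N \<le> z \<le> 3 N\<close>, far enough out for
    \<open>phi\<^sup>2 \<le> 4 / N\<close>.\<close>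
  define chi where "chi s = complex_of_real (bump 0 4 1 s)" for s
  define chi1 where "chi1 = vderiv chi"
  define chi2 where "chi2 = vderiv chi1"
  have sm: "smooth_on UNIV chi" unfolding chi_def by (intro smooth_intros smooth_on_bump) simp
  have sm1: "smooth_on UNIV chi1" unfolding chi1_def by (rule smooth_on_vderiv[OF sm])
  have sm2: "smooth_on UNIV chi2" unfolding chi2_def by (rule smooth_on_vderiv[OF sm1])
  have d: "(chi has_vector_derivative chi1 s) (at s)" "(chi1 has_vector_derivative chi2 s) (at s)" for s
    unfolding chi1_def chi2_def using smooth_on_has_vderiv[OF sm] smooth_on_has_vderiv[OF sm1, unfolded chi1_def] by auto
  have vz: "vderiv g s = 0" if "\<And>s. s \<notin> {1..3} \<Longrightarrow> g s = 0" "s \<notin> {1..3}" for g :: "real \<Rightarrow> complex" and s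
  proof (rule vderivI)
    have "open (- {1..3::real})" by (simp add: open_Compl)
    then show "(g has_vector_derivative 0) (at s)"
      using that has_vector_derivative_cong_open[of "- {1..3}" s g "\<lambda>x. 0" 0] by auto
  qed
  have c0: "chi s = 0" if "s \<notin> {1..3}" for s
    using bump_support[of 1 s 0 4] that by (auto simp: chi_def)
  have c1: "chi1 s = 0" if "s \<notin> {1..3}" for s unfolding chi1_def by (rule vz[OF c0 that])
  have c2: "chi2 s = 0" if "s \<notin> {1..3}" for s unfolding chi2_def by (rule vz[OF c1 that])
  have bdd: "\<exists>M. \<forall>s. cmod (g s) \<le> M" if "smooth_on UNIV g" "\<And>s. s \<notin> {1..3} \<Longrightarrow> g s = 0" for g
  proof -
    have "compact (g ` {1..3})"
      using smooth_on_continuous[OF that(1)] by (intro compact_continuous_image) (auto intro: continuous_on_subset)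
    then have "bounded (g ` {1..3})" by (rule compact_imp_bounded)
    then obtain M where M: "\<And>s. s \<in> {1..3} \<Longrightarrow> cmod (g s) \<le> M" unfolding bounded_iff by blast
    have "cmod (g s) \<le> max M 0" for s using M[of s] that(2)[of s] by (cases "s \<in> {1..3}") auto
    then show ?thesis by blast
  qed
  obtain M1 M2 where M12: "\<And>s. cmod (chi1 s) \<le> M1" "\<And>s. cmod (chi2 s) \<le> M2" using bdd[OF sm1 c1] bdd[OF sm2 c2] by auto
  define M where "M = max M1 M2"
  have M: "cmod (chi1 s) \<le> M" "cmod (chi2 s) \<le> M" for s using M12[of s] by (auto simp: M_def)
  have M0: "M \<ge> 0" using M(1)[of 0] norm_ge_zero[of "chi1 0"] by linarith
  have chi_le: "cmod (chi s) \<le> 1" for s using bump_bounds by (simp add: chi_def)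
  \<comment> \<open>A lower bound for the cutoff on \<open>{3/2..5/2}\<close>, where the arguments
    of both factors are at least 1/2.\<close>
  define m where "m = flat 0 (1/2) * flat 0 (1/2)"
  have m: "m > 0" by (simp add: m_def flat_def)
  have chi_ge: "m \<le> cmod (chi s)" if "s \<in> {3/2..5/2}" for s
  proof -
    have "flat 0 (1/2) \<le> flat 0 (s - 1)" "flat 0 (1/2) \<le> flat 0 (3 - s)"
      using that le_imp_inverse_le[of "1/2" "s - 1"] le_imp_inverse_le[of "1/2" "3 - s"] by (auto simp: flat_def)
    then show ?thesis using bump_bounds(1)[of 0 4 1 s] flat_0_bounds
      by (auto simp: chi_def bump_def m_def norm_mult intro!: mult_mono)
  qed
  \<comment> \<open>The numerators of the three error terms: 15/8 times 4 from the potential, and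
    the bounds for the first and second derivative of the cutoff. The choice of \<open>N\<close>
    makes \<open>m * N\<close> exceed \<open>2 * C * K\<close>.\<close>
  define K where "K = 15 / 2 + 2 * \<omega> * M + M"
  have K: "K > 0" using \<omega> M0 by (simp add: K_def add_pos_nonneg)
  define N where "N = 1 + 2 * C * K / m"
  have N: "N \<ge> 1" "N > 0" "2 * C * K < m * N" using C K m by (auto simp: N_def field_simps add_pos_nonneg)
  \<comment> \<open>This is \<open>phi01\<close> times
    \<open>phi\<^sup>-\<^sup>1\<^sup>/\<^sup>2 exp (\<i> \<omega> z)\<close>, because
    \<open>L_expr\<close> differentiates \<open>phi01 * w\<close>, which equals \<open>F\<close>
    times the cutoff.\<close>
  define F where "F x = of_real (sqrt (phi01 x)) * exp (\<i> * of_real (\<omega> * zphi x))" for x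
  define Q where "Q x = (\<i> * of_real \<omega> + of_real (dphi x) / 2) / complex_of_real (phi01 x)" for x
  have normF: "(cmod (F x))\<^sup>2 = phi01 x" if "x \<in> Iphi" for x
    using phi01_pos[OF that] by (simp add: F_def norm_mult)
  have dF: "(F has_vector_derivative Q x * F x) (at x)" if x: "x \<in> Iphi" for x
  proof -
    have "((\<lambda>x. sqrt (phi01 x)) has_real_derivative dphi x / (2 * sqrt (phi01 x))) (at x)"
      using phi01_pos[OF x] by (auto intro!: derivative_eq_intros DERIV_phi01 simp: field_simps)
    then have 1: "((\<lambda>x. complex_of_real (sqrt (phi01 x))) has_vector_derivative of_real (dphi x / (2 * sqrt (phi01 x)))) (at x)"
      by (intro has_vector_derivative_of_real) (simp add: has_real_derivative_iff_has_vector_derivative)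
    have "((\<lambda>x. \<omega> * zphi x) has_real_derivative \<omega> / phi01 x) (at x)"
      using DERIV_cmult[OF DERIV_zphi[OF x], of \<omega>] by simp
    then have "((\<lambda>x. \<i> * complex_of_real (\<omega> * zphi x)) has_vector_derivative \<i> * of_real (\<omega> / phi01 x)) (at x)"
      by (intro has_vector_derivative_mult_right has_vector_derivative_of_real) (simp add: has_real_derivative_iff_has_vector_derivative)
    from field_vector_diff_chain_at[OF this DERIV_exp]
    have 2: "((\<lambda>x. exp (\<i> * of_real (\<omega> * zphi x))) has_vector_derivative
        (\<i> * of_real (\<omega> / phi01 x)) * exp (\<i> * of_real (\<omega> * zphi x))) (at x)" by (simp add: o_def)
    have "of_real (dphi x / (2 * sqrt (phi01 x))) = of_real (dphi x) / 2 / complex_of_real (phi01 x) * of_real (sqrt (phi01 x))"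
    proof -
      have "dphi x / (2 * sqrt (phi01 x)) = dphi x / 2 / phi01 x * sqrt (phi01 x)"
        using phi01_pos[OF x] real_sqrt_mult_self[of "phi01 x"] by (simp add: field_simps)
      from arg_cong[OF this, of complex_of_real] show ?thesis by simp
    qed
    then show ?thesis
      using has_vector_derivative_mult[OF 1 2] unfolding F_def[abs_def] Q_def
      by (simp add: add_divide_distrib algebra_simps)
  qed
  have smQ: "smooth_on Iphi Q"
  proof -
    have "smooth_on Iphi (\<lambda>x. of_real (inverse (phi01 x)) * (\<i> * of_real \<omega> + of_real (dphi x) * (1 / 2)))"
      by (intro smooth_intros) (auto simp: phi01_nz)
    then show ?thesis by (rule smooth_on_cong[OF open_Iphi, rotated]) (simp add: Q_def field_simps phi01_nz)
  qed
  have smF: "smooth_on Iphi F" by (rule smooth_on_linear_ode[OF open_Iphi smQ dF])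
  have smz: "smooth_on Iphi (\<lambda>x. zphi x / N)"
  proof (rule smooth_onI_deriv[OF open_Iphi])
    show "((\<lambda>x. zphi x / N) has_vector_derivative inverse (phi01 x) * inverse N) (at x)" if "x \<in> Iphi" for x
      using DERIV_cdivide[OF DERIV_zphi[OF that], of N]
      by (simp add: has_real_derivative_iff_has_vector_derivative divide_inverse)
    show "smooth_on Iphi (\<lambda>x. inverse (phi01 x) * inverse N)" by (intro smooth_intros) (auto simp: phi01_nz)
  qed
  have dchi: "((\<lambda>x. g (zphi x / N)) has_vector_derivative g' (zphi x / N) / (of_real N * of_real (phi01 x))) (at x)"
    if x: "x \<in> Iphi" and g: "\<And>s. (g has_vector_derivative g' s) (at s)" for g g' :: "real \<Rightarrow> complex" and x
  proof -
    have "((\<lambda>x. zphi x / N) has_vector_derivative 1 / phi01 x / N) (at x)"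
      using DERIV_cdivide[OF DERIV_zphi[OF x], of N] by (simp add: has_real_derivative_iff_has_vector_derivative)
    from vector_diff_chain_at[OF this g] show ?thesis
      by (simp add: o_def scaleR_conv_of_real mult.commute)
  qed
  define w where "w x = (if x \<in> Iphi then of_real (inverse (phi01 x)) * F x * chi (zphi x / N) else 0)" for x
  define p q where "p = xphi N" and "q = xphi (3 * N)"
  have pq: "p \<in> Iphi" "q \<in> Iphi" "p \<le> q"
    using N(2) xphi zphi_le_iff[of p q] by (auto simp: p_def q_def)
  have supp: "zphi x / N \<notin> {1..3}" if "x \<in> Iphi" "x \<notin> {p..q}" for x
    using that zphi_le_iff[of p x] zphi_le_iff[of x q] pq N(2) xphi
    by (auto simp: p_def q_def field_simps)
  have w: "w \<in> test_functions Iphi"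
  proof (rule test_functionsI[OF _ pq(1,2)])
    have "smooth_on Iphi (\<lambda>x. of_real (inverse (phi01 x)) * F x * chi (zphi x / N))"
      by (intro smooth_on_mult smooth_on_of_real smooth_on_inverse smF smooth_on_compose[OF _ sm smz] smooth_intros open_Iphi)
        (auto simp: phi01_nz)
    then show "smooth_on Iphi w" by (rule smooth_on_cong[OF open_Iphi, rotated]) (simp add: w_def)
    show "w x = 0" if "x \<notin> {p..q}" for x
      using supp[OF _ that] c0 by (auto simp: w_def simp del: atLeastAtMost_iff)
  qed
  define r where "r x = L_expr phi01 w x - of_real (1 / 4 + \<omega>\<^sup>2) * w x" for x
  define e where "e x = 15 / 8 * of_real (phi01 x * phi01 x) * chi (zphi x / N)
      + 2 * (\<i> * of_real \<omega>) * chi1 (zphi x / N) / of_real N + chi2 (zphi x / N) / (of_real N * of_real N)" for x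
  have r_eq: "r x = - (F x / of_real (phi01 x) * e x)" if x: "x \<in> Iphi" for x
  proof -
    let ?P = "\<i> * of_real \<omega> + of_real (dphi x) / 2 :: complex" and ?p = "complex_of_real (phi01 x)" and ?n = "complex_of_real N"
    define k where "k y = F y * chi (zphi y / N)" for y
    define b where "b y = Q y * chi (zphi y / N) + chi1 (zphi y / N) / (of_real N * of_real (phi01 y))" for y
    define k1 where "k1 y = F y * b y" for y
    have eq: "phi01 y *\<^sub>R w y = k y" if "y \<in> Iphi" for y
      using phi01_nz[OF that] that by (simp add: w_def k_def scaleR_conv_of_real)
    have dk: "(k has_vector_derivative k1 y) (at y)" if y: "y \<in> Iphi" for y
      using has_vector_derivative_mult[OF dF[OF y] dchi[OF y d(1)]]
      by (simp add: k_def[abs_def] k1_def b_def algebra_simps)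
    have pnz: "?p \<noteq> 0" "?n \<noteq> 0" using phi01_nz[OF x] N(2) by auto
    have ppd: "?p * ?p = 2 - 2 * (of_real (dphi x) * of_real (dphi x))"
      using arg_cong[OF phi01_dphi[of x], of complex_of_real] by simp
    have dp: "((\<lambda>x. complex_of_real (phi01 x)) has_vector_derivative of_real (dphi x)) (at x)"
      "((\<lambda>x. complex_of_real (dphi x)) has_vector_derivative of_real (- phi01 x / 2)) (at x)"
      using DERIV_phi01[of x UNIV] DERIV_dphi[of x UNIV]
      by (auto intro!: has_vector_derivative_of_real simp: has_real_derivative_iff_has_vector_derivative simp del: of_real_divide of_real_minus)
    have "((\<lambda>x. inverse (phi01 x)) has_real_derivative - dphi x / (phi01 x * phi01 x)) (at x)"
      using phi01_nz[OF x] by (auto intro!: derivative_eq_intros DERIV_phi01 simp: field_simps)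
    then have "((\<lambda>x. complex_of_real (inverse (phi01 x))) has_vector_derivative of_real (- dphi x / (phi01 x * phi01 x))) (at x)"
      by (intro has_vector_derivative_of_real) (simp add: has_real_derivative_iff_has_vector_derivative)
    then have di: "((\<lambda>x. inverse (complex_of_real (phi01 x))) has_vector_derivative - of_real (dphi x) / (?p * ?p)) (at x)"
      by simp
    have "((\<lambda>x. (\<i> * of_real \<omega> + of_real (dphi x) * (1 / 2)) * inverse (complex_of_real (phi01 x))) has_vector_derivative
        (\<i> * of_real \<omega> + of_real (dphi x) * (1 / 2)) * (- of_real (dphi x) / (?p * ?p)) + (0 + of_real (- phi01 x / 2) * (1 / 2)) * inverse ?p) (at x)"
      by (intro has_vector_derivative_mult has_vector_derivative_add has_vector_derivative_const has_vector_derivative_mult_left di dp)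
    moreover have "(\<lambda>x. (\<i> * of_real \<omega> + of_real (dphi x) * (1 / 2)) * inverse (complex_of_real (phi01 x))) = Q"
      by (simp add: Q_def[abs_def] flip: divide_inverse)
    moreover have "(\<i> * of_real \<omega> + of_real (dphi x) * (1 / 2)) * (- of_real (dphi x) / (?p * ?p)) + (0 + of_real (- phi01 x / 2) * (1 / 2)) * inverse ?p
        = - 1 / 4 - ?P * of_real (dphi x) / (?p * ?p)"
      using pnz by (simp add: field_simps)
    ultimately have dQ: "(Q has_vector_derivative - 1 / 4 - ?P * of_real (dphi x) / (?p * ?p)) (at x)" by (simp only:)
    have "((\<lambda>y. (chi1 (zphi y / N) * inverse (complex_of_real (phi01 y))) * inverse ?n) has_vector_derivative
        (chi1 (zphi x / N) * (- of_real (dphi x) / (?p * ?p)) + (chi2 (zphi x / N) / (?n * ?p)) * inverse ?p) * inverse ?n) (at x)"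
      by (intro has_vector_derivative_mult_left has_vector_derivative_mult di dchi[OF x d(2)])
    moreover have "(\<lambda>y. (chi1 (zphi y / N) * inverse (complex_of_real (phi01 y))) * inverse ?n) =
        (\<lambda>y. chi1 (zphi y / N) / (of_real N * of_real (phi01 y)))"
      by (simp add: divide_inverse mult_ac)
    moreover have "(chi1 (zphi x / N) * (- of_real (dphi x) / (?p * ?p)) + (chi2 (zphi x / N) / (?n * ?p)) * inverse ?p) * inverse ?n
        = chi2 (zphi x / N) / (?n * ?p) / (?n * ?p) - chi1 (zphi x / N) * of_real (dphi x) / (?n * (?p * ?p))"
      using pnz by (simp add: field_simps)
    ultimately have dc: "((\<lambda>y. chi1 (zphi y / N) / (of_real N * of_real (phi01 y))) has_vector_derivative
        chi2 (zphi x / N) / (?n * ?p) / (?n * ?p) - chi1 (zphi x / N) * of_real (dphi x) / (?n * (?p * ?p))) (at x)" by (simp only:)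
    have db: "(b has_vector_derivative (Q x * (chi1 (zphi x / N) / (?n * ?p)) + (- 1 / 4 - ?P * of_real (dphi x) / (?p * ?p)) * chi (zphi x / N))
        + (chi2 (zphi x / N) / (?n * ?p) / (?n * ?p) - chi1 (zphi x / N) * of_real (dphi x) / (?n * (?p * ?p)))) (at x)"
      unfolding b_def[abs_def] by (intro has_vector_derivative_add has_vector_derivative_mult dQ dchi[OF x d(1)] dc)
    note dk1 = has_vector_derivative_mult[OF dF[OF x] db]
    have "L_expr phi01 w x = - (phi01 x *\<^sub>R ((F x * ((Q x * (chi1 (zphi x / N) / (?n * ?p)) + (- 1 / 4 - ?P * of_real (dphi x) / (?p * ?p)) * chi (zphi x / N))
        + (chi2 (zphi x / N) / (?n * ?p) / (?n * ?p) - chi1 (zphi x / N) * of_real (dphi x) / (?n * (?p * ?p)))) + Q x * F x * b x) + 2 * k x))"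
      using dk1 by (intro L_exprI(1)[OF open_Iphi x eq dk]) (simp_all add: k1_def[abs_def])
    also have "\<dots> = - (F x / ?p * (?p * ?p * (Q x * (Q x * chi (zphi x / N) + chi1 (zphi x / N) / (?n * ?p))
        + ((- 1 / 4 - ?P * of_real (dphi x) / (?p * ?p)) * chi (zphi x / N) + Q x * (chi1 (zphi x / N) / (?n * ?p))
        + (chi2 (zphi x / N) / (?n * ?p) / (?n * ?p) - chi1 (zphi x / N) * of_real (dphi x) / (?n * (?p * ?p)))) + 2 * chi (zphi x / N))))"
    proof -
      have fp: "F x / ?p * (?p * ?p * A) = ?p * F x * A" for A using pnz by simp
      show ?thesis unfolding fp k_def b_def by (simp add: scaleR_conv_of_real algebra_simps)
    qed
    finally have L: "L_expr phi01 w x = - (F x / ?p * (e x - (1 / 4 - (\<i> * of_real \<omega>) * (\<i> * of_real \<omega>)) * chi (zphi x / N)))"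
      by (simp only: Q_def e_def of_real_mult iffD2[OF eq_diff_eq weyl_algebra[OF pnz ppd, of "\<i> * of_real \<omega>"
              "chi (zphi x / N)" "chi1 (zphi x / N)" "chi2 (zphi x / N)"]])
    have "w x = F x / ?p * chi (zphi x / N)" using x by (simp add: w_def divide_inverse mult.commute)
    moreover have "1 / 4 - (\<i> * of_real \<omega>) * (\<i> * of_real \<omega>) = complex_of_real (1 / 4 + \<omega>\<^sup>2)"
      by (simp add: complex_eq_iff power2_eq_square)
    ultimately show ?thesis unfolding r_def L by (simp only:) (simp add: algebra_simps)
  qed
  have e_le: "cmod (e x) \<le> K / N" if x: "x \<in> Iphi" "x \<in> {p..q}" for x
  proof -
    have "N \<le> zphi x" using x zphi_le_iff[OF pq(1) x(1)] xphi(2)[of N] by (simp add: p_def)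
    then have "phi01 x * phi01 x \<le> 4 / N"
      using N(2) by (intro order_trans[OF phi01_decay[OF x(1)]] divide_left_mono) auto
    then have 1: "cmod (15 / 8 * of_real (phi01 x * phi01 x) * chi (zphi x / N)) \<le> 15 / 8 * (4 / N) * 1"
      unfolding norm_mult norm_of_real using N(2) by (intro mult_mono chi_le) auto
    have 2: "cmod (2 * (\<i> * of_real \<omega>) * chi1 (zphi x / N) / of_real N) \<le> 2 * \<omega> * M / N"
      using \<omega> N(2) M(1) by (auto simp: norm_mult norm_divide intro!: divide_right_mono mult_left_mono)
    have "cmod (chi2 (zphi x / N) / (of_real N * of_real N)) \<le> M / (N * N)"
      using N(2) M(2) by (auto simp: norm_mult norm_divide intro!: divide_right_mono)
    also have "\<dots> \<le> M / N" using M0 N by (intro divide_left_mono) auto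
    finally have 3: "cmod (chi2 (zphi x / N) / (of_real N * of_real N)) \<le> M / N" .
    have "cmod (e x) \<le> 15 / 8 * (4 / N) * 1 + 2 * \<omega> * M / N + M / N"
      unfolding e_def by (intro norm_triangle_le add_mono 1 2 3)
    also have "\<dots> = K / N" by (simp add: K_def add_divide_distrib)
    finally show ?thesis .
  qed
  have rL: "r \<in> L2_space Mphi" unfolding r_def by (intro L2_diff L2_scale test_L2 L_expr_test w)
  have "(L2_norm Mphi r)\<^sup>2 \<le> (K / N)\<^sup>2 * (zphi q - zphi p)"
  proof (rule L2_norm_le_zphi[OF rL pq])
    fix x assume x: "x \<in> {p..q}"
    then have xI: "x \<in> Iphi" using Iphi_interval[OF pq(1,2)] by auto
    have "(cmod (r x))\<^sup>2 = (cmod (F x))\<^sup>2 * (cmod (e x))\<^sup>2 / (phi01 x)\<^sup>2"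
      unfolding r_eq[OF xI] by (simp add: norm_mult norm_divide power_mult_distrib power_divide)
    also have "\<dots> = (cmod (e x))\<^sup>2 / phi01 x"
      unfolding normF[OF xI] using phi01_pos[OF xI] by (simp add: power2_eq_square)
    also have "\<dots> \<le> (K / N)\<^sup>2 / phi01 x"
      using phi01_pos[OF xI] e_le[OF xI x] by (intro divide_right_mono power_mono) auto
    finally show "(cmod (r x))\<^sup>2 \<le> (K / N)\<^sup>2 / phi01 x" .
  next
    fix x assume x: "x \<in> Iphi" "x \<notin> {p..q}"
    show "r x = 0" unfolding r_eq[OF x(1)] e_def c0[OF supp[OF x]] c1[OF supp[OF x]] c2[OF supp[OF x]] by simp
  qed
  also have "zphi q - zphi p = 2 * N" by (simp add: p_def q_def xphi)
  finally have upper: "(L2_norm Mphi r)\<^sup>2 \<le> 2 * K\<^sup>2 / N" using N(2) by (simp add: power2_eq_square mult_ac)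
  have "m\<^sup>2 * (zphi (xphi (5/2 * N)) - zphi (xphi (3/2 * N))) \<le> (L2_norm Mphi w)\<^sup>2"
  proof (rule L2_norm_ge_zphi[OF test_L2[OF w] xphi(1) xphi(1)])
    show "xphi (3/2 * N) \<le> xphi (5/2 * N)"
      using zphi_le_iff[OF xphi(1) xphi(1), of "3/2 * N" "5/2 * N"] N(2) by (simp add: xphi)
    fix x assume x: "x \<in> {xphi (3/2 * N)..xphi (5/2 * N)}"
    then have xI: "x \<in> Iphi" using Iphi_interval[OF xphi(1) xphi(1)] by blast
    have "3/2 * N \<le> zphi x" "zphi x \<le> 5/2 * N"
      using x zphi_le_iff[OF xphi(1) xI, of "3/2 * N"] zphi_le_iff[OF xI xphi(1), of "5/2 * N"] by (simp_all add: xphi)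
    then have "zphi x / N \<in> {3/2..5/2}" using N(2) by (simp add: field_simps)
    from chi_ge[OF this] have c: "m \<le> cmod (chi (zphi x / N))" .
    have "(cmod (w x))\<^sup>2 = (cmod (F x))\<^sup>2 * (cmod (chi (zphi x / N)))\<^sup>2 / (phi01 x)\<^sup>2"
      using xI by (simp add: w_def norm_mult norm_inverse power_mult_distrib power_inverse divide_inverse)
    then have "(cmod (w x))\<^sup>2 = (cmod (chi (zphi x / N)))\<^sup>2 / phi01 x"
      unfolding normF[OF xI] using phi01_pos[OF xI] by (simp add: power2_eq_square)
    moreover have "m\<^sup>2 / phi01 x \<le> (cmod (chi (zphi x / N)))\<^sup>2 / phi01 x"
      using phi01_pos[OF xI] c m by (intro divide_right_mono power_mono) auto
    ultimately show "m\<^sup>2 / phi01 x \<le> (cmod (w x))\<^sup>2" by simp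
  qed
  then have lower: "m\<^sup>2 * N \<le> (L2_norm Mphi w)\<^sup>2" by (simp add: xphi)
  have "(C * L2_norm Mphi r)\<^sup>2 \<le> C\<^sup>2 * (2 * K\<^sup>2 / N)"
    unfolding power_mult_distrib using upper by (intro mult_left_mono) auto
  also have "\<dots> < m\<^sup>2 * N"
  proof -
    have "(2 * C * K)\<^sup>2 < (m * N)\<^sup>2" using N(3) C K by (intro power_strict_mono) auto
    moreover have "(2 * C * K)\<^sup>2 = 4 * (C * K)\<^sup>2" by (simp add: power_mult_distrib)
    ultimately have "2 * (C * K)\<^sup>2 < (m * N)\<^sup>2" using zero_le_power2[of "C * K"] by linarith
    then show ?thesis using N(2) by (simp add: pos_divide_less_eq power2_eq_square algebra_simps)
  qed
  also note lower
  finally have "C * L2_norm Mphi r < L2_norm Mphi w" by (rule power2_less_imp_less) simp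
  then show thesis using w by (intro that[of w]) (simp_all add: r_def[abs_def])
qed

lemma not_resolvent: assumes "1 / 4 \<le> l" shows "of_real l \<notin> resolvent_set Mphi Lphi"
proof
  assume "of_real l \<in> resolvent_set Mphi Lphi"
  then obtain C where C: "\<And>u g. (u, g) \<in> Lphi \<Longrightarrow> L2_norm Mphi u \<le> C * L2_norm Mphi (\<lambda>x. g x - of_real l * u x)"
    unfolding resolvent_set_def by fast
  define \<omega> where "\<omega> = sqrt (l - 1 / 4)"
  have \<omega>: "\<omega> \<ge> 0" "1 / 4 + \<omega>\<^sup>2 = l" using assms by (auto simp: \<omega>_def)
  obtain w where w: "w \<in> test_functions Iphi" "\<bar>C\<bar> * L2_norm Mphi (\<lambda>x. L_expr phi01 w x - of_real l * w x) < L2_norm Mphi w"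
    using weyl_sequence[OF \<omega>(1), of "\<bar>C\<bar>"] unfolding \<omega>(2) by auto
  have "C * L2_norm Mphi (\<lambda>x. L_expr phi01 w x - of_real l * w x) \<le> \<bar>C\<bar> * L2_norm Mphi (\<lambda>x. L_expr phi01 w x - of_real l * w x)"
    by (intro mult_right_mono) auto
  with C[OF Lphi_test[OF w(1)]] w(2) show False by linarith
qed

text \<open>No residual spectrum arises: the range of \<open>L - \<mu>\<close> is dense unless
  \<open>cnj \<mu>\<close> is an eigenvalue. So the real values from 1/4 on, being neither
  eigenvalues nor resolvent points, belong to the continuous spectrum.\<close>

lemma continuous_spectrum_Lphi: "continuous_spectrum Mphi Lphi = complex_of_real ` {1/4..}"
proof (intro equalityI subsetI)
  fix \<mu> assume \<mu>: "\<mu> \<in> continuous_spectrum Mphi Lphi"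
  then have nr: "\<mu> \<notin> resolvent_set Mphi Lphi" "\<mu> \<notin> point_spectrum Mphi Lphi" by (auto simp: continuous_spectrum_def)
  then have "Im \<mu> = 0" using resolvent_nonreal by blast
  then have \<mu>_eq: "\<mu> = of_real (Re \<mu>)" by (simp add: complex_eq_iff)
  have "\<mu> \<noteq> - 2" "\<mu> \<noteq> 0" using nr(2) eigenfunction_P by (auto simp: point_spectrum_def)
  then have "Re \<mu> \<noteq> - 2" "Re \<mu> \<noteq> 0" using \<mu>_eq by (auto simp: complex_eq_iff)
  then have "\<not> Re \<mu> < 1 / 4" using resolvent_real[of "Re \<mu>"] nr(1) \<mu>_eq by auto
  then show "\<mu> \<in> complex_of_real ` {1/4..}" using \<mu>_eq by (intro image_eqI[of _ _ "Re \<mu>"]) auto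
next
  fix \<mu> assume "\<mu> \<in> complex_of_real ` {1/4..}"
  then obtain l where l: "\<mu> = of_real l" "1 / 4 \<le> l" by auto
  have "\<mu> \<noteq> - 2" "\<mu> \<noteq> 0" using l by (auto simp: complex_eq_iff)
  then have ne: "\<not> eigenfunction Mphi Lphi \<mu> y" for y using eigenvalue_cases by blast
  have "\<exists>(u, g)\<in>Lphi. L2_norm Mphi (\<lambda>x. g x - \<mu> * u x - f x) < e" if "f \<in> L2_space Mphi" "e > 0" for f e
  proof -
    have "\<not> (\<exists>y. eigenfunction Mphi Lphi (cnj \<mu>) y)" using ne l(1) by simp
    from Lphi_range_dense[OF this that] show ?thesis by blast
  qed
  then show "\<mu> \<in> continuous_spectrum Mphi Lphi"
    using ne not_resolvent[OF l(2)] l(1) by (auto simp: continuous_spectrum_def point_spectrum_def)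
qed

theorem proposition4p5:
  fixes a b :: real and I :: "real set" and M :: "real measure" and L :: "real op_graph"
  defines "a \<equiv> - (pi / sqrt 2)" and "b \<equiv> pi / sqrt 2"
  defines "I \<equiv> {a<..<b}"
  defines "M \<equiv> lebesgue_on I"
  defines "L \<equiv> L_op phi01 I"
  shows
    "limit_point_left phi01 a b \<and> limit_point_right phi01 a b \<and>
     (eigenfunction M L (-2) (\<lambda>x. complex_of_real (phi01 x)) \<and>
      (\<forall>x\<in>I. phi01 x > 0) \<and>
      (\<forall>u. eigenfunction M L (-2) u \<longrightarrow>
         (\<exists>c. AE x in M. u x = c * complex_of_real (phi01 x))) \<and>
      (\<forall>\<mu>\<in>point_spectrum M L. \<mu> \<in> \<real> \<and> -2 \<le> Re \<mu>)) \<and>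
     (eigenfunction M L 0 (\<lambda>x. complex_of_real (deriv phi01 x)) \<and>
      (\<forall>\<mu>\<in>point_spectrum M L - {-2}. 0 \<le> Re \<mu>)) \<and>
     continuous_spectrum M L = complex_of_real ` {1/4..}"
proof -
  have I: "I = Iphi" by (simp add: I_def a_def b_def Iphi_def)
  have M: "M = Mphi" and L: "L = Lphi" by (simp_all add: M_def L_def I)
  have d: "deriv phi01 = dphi" using DERIV_phi01[of _ UNIV] by (auto intro!: DERIV_imp_deriv)
  have ps: "\<mu> = - 2 \<or> \<mu> = 0" if "\<mu> \<in> point_spectrum Mphi Lphi" for \<mu>
    using that eigenvalue_cases by (auto simp: point_spectrum_def)
  have "limit_point_left phi01 a b" "limit_point_right phi01 a b"
    unfolding a_def b_def by (rule limit_point_phi01)+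
  moreover have "\<mu> \<in> \<real> \<and> - 2 \<le> Re \<mu>" if "\<mu> \<in> point_spectrum M L" for \<mu>
    using ps[of \<mu>] that by (auto simp: M L)
  moreover have "0 \<le> Re \<mu>" if "\<mu> \<in> point_spectrum M L - {- 2}" for \<mu>
    using ps[of \<mu>] that by (auto simp: M L)
  ultimately show ?thesis
    unfolding I M L d using eigenfunction_P phi01_pos ground_state_unique continuous_spectrum_Lphi
    by blast
qed

end
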